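(* For each signature $F\in\mathscr{M}_P-\mathscr{A}$ of arity $n$, there is a symmetric signature $g\in\mathscr{M}-\mathscr{A}$ that can be realized by $\{F\}\mid\{[1,0],[1,0,1],[1,0,1,0]\}$ as a planar left-side gadget.
   Context: A signature of arity $k$ is a function $f:\{0,1\}^k\to\mathbb{C}$. It is symmetric if its value depends only on the Hamming weight of the input, and is then written $[f_0,f_1,\dots,f_k]$, $f_i$ being the value at inputs of Hamming weight $i$. $\mathscr{M}$ (matchgate signatures): a matchgate is a plane graph $G=(V,E)$ with edge weights $w:E\to\mathbb{C}$ and external nodes $U\subseteq V$ on its outer face labelled $1,\dots,|U|$ in clockwise order. Its signature $f$ has arity $|U|$ and, for $\alpha\in\{0,1\}^{|U|}$, $f(\alpha)=\#\mathrm{PM}(G-X)$, where $X\subseteq U$ consists of the external nodes whose label $i$ satisfies $\alpha_i=1$, and $\#\mathrm{PM}(G)=\sum_{M}\prod_{e\in M}w(e)$, the sum over all perfect matchings $M$ of $G$. $\mathscr{M}$ is the set of all signatures of matchgates. $\mathscr{M}_P$ (permutable matchgate signatures): signatures $f$ of some arity $n$ such that for every $\pi\in S_n$ the signature $f_\pi$ obtained from $f$ by permuting its variables by $\pi$ is in $\mathscr{M}$. $\mathscr{A}$ (affine type): all signatures of arity $k\ge 1$ of the form $\lambda\,\chi_{AX=b}\cdot \mathfrak{i}^{\sum_{1\le i\le k}a_i x_i^2+2\sum_{1\le i<j\le k}b_{ij}x_ix_j}$, where $\mathfrak{i}$ is the imaginary unit, $\lambda\in\mathbb{C}$, $a_i\in\{0,1,2,3\}$,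 $b_{ij}\in\{0,1\}$, $AX=b$ is a system of linear equations over $\mathbb{Z}_2$ in $X=(x_1,\dots,x_k)$, and $\chi_{AX=b}$ is $1$ if $AX=b$ and $0$ otherwise. Left-side gadget of $\mathcal{F}_1\mid\mathcal{F}_2$: a bipartite (multi)graph with vertex classes $U,V$, normal edges $E$ (each joining $U$ to $V$) and dangling edges $D$ (edges with only one endpoint), where every vertex of $U$ is assigned a signature from $\mathcal{F}_1$, every vertex of $V$ a signature from $\mathcal{F}_2$ (the arguments of the signature at a vertex being the edges at that vertex, matched with them in some order), and the endpoint of every dangling edge lies in $U$. It realizes the signature $f$ of arity $|D|$ given by $f(\alpha)=\sum_{\sigma\in\{0,1\}^{E}}\prod_{v\in U\cup V}f_v(\alpha\sigma)$ for $\alpha\in\{0,1\}^D$, where $f_v(\alpha\sigma)$ is the value of the signature at $v$ on the bits assigned to its edges. The gadget is planar if the graph can be drawn in the plane without crossings with all dangling edges leading to the outer face (no condition being imposed on the cyclic order of the arguments around a vertex). *)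

theory Defs
  imports
    "HOL-Complex_Analysis.Complex_Analysis"
    "HOL-Combinatorics.Permutations"
    "HOL-Library.Z2"
    "HOL-Library.FuncSet"
begin

section \<open>Signatures\<close>

text \<open>
  A signature is an arity \<open>k\<close> together with its values on \<open>{0,1}\<^sup>k\<close>; bits are Booleans and elements
  of \<open>{0,1}\<^sup>k\<close> are lists of length \<open>k\<close>. The values on lists of any other length are junk, and no
  definition below constrains them.
\<close>

type_synonym signature = "nat \<times> (bool list \<Rightarrow> complex)"

abbreviation arity :: "signature \<Rightarrow> nat" where
  "arity \<equiv> fst"

abbreviation sigval :: "signature \<Rightarrow> bool list \<Rightarrow> complex" where
  "sigval \<equiv> snd"

abbreviation hamming_weight :: "bool list \<Rightarrow> nat" where
  "hamming_weight x \<equiv> count_list x True"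

definition symmetric_sig :: "signature \<Rightarrow> bool" where
  "symmetric_sig f \<longleftrightarrow>
     (\<forall>x y. length x = arity f \<longrightarrow> length y = arity f \<longrightarrow> hamming_weight x = hamming_weight y
        \<longrightarrow> sigval f x = sigval f y)"

text \<open>The symmetric signature \<open>[f\<^sub>0, f\<^sub>1, \<dots>, f\<^sub>k]\<close>, of arity \<open>k\<close>.\<close>

definition symsig :: "complex list \<Rightarrow> signature" where
  "symsig fs = (length fs - 1, \<lambda>x. fs ! hamming_weight x)"


section \<open>Matchgate signatures\<close>

text \<open>
  A (finite, simple) plane graph has points of the plane as vertices and arcs (as point sets) as
  edges. An edge contains no vertices but its two ends, so the ends of \<open>e\<close> are \<open>e \<inter> V\<close>, and
  \<open>v \<in> e\<close> expresses incidence.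
\<close>

definition plane_graph :: "complex set \<Rightarrow> complex set set \<Rightarrow> bool" where
  "plane_graph V E \<longleftrightarrow>
     finite V \<and> finite E \<and>
     (\<forall>e\<in>E. \<exists>c. arc c \<and> e = path_image c \<and> e \<inter> V = {pathstart c, pathfinish c}) \<and>
     (\<forall>e\<in>E. \<forall>e'\<in>E. e \<noteq> e' \<longrightarrow> e \<inter> e' \<subseteq> V) \<and>
     inj_on (\<lambda>e. e \<inter> V) E"

definition perfect_matchings :: "complex set \<Rightarrow> complex set set \<Rightarrow> complex set set set" where
  "perfect_matchings V E = {M. M \<subseteq> E \<and> (\<forall>v\<in>V. \<exists>!e. e \<in> M \<and> v \<in> e)}"

definition PM :: "complex set \<Rightarrow> complex set set \<Rightarrow> (complex set \<Rightarrow> complex) \<Rightarrow> complex" where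
  "PM V E w = (\<Sum>M\<in>perfect_matchings V E. \<Prod>e\<in>M. w e)"

text \<open>
  The points \<open>us\<close> of the drawing \<open>S\<close> lie on its outer face, in clockwise order: some closed Jordan
  curve encloses \<open>S\<close>, meets \<open>S\<close> in these points only, and visits them in this order when traversed
  clockwise (winding number \<open>-1\<close>). The exterior of the curve lies in the outer face of \<open>S\<close>, so the
  points are indeed on the boundary of that face. A vertex that occurs several times on the boundary
  walk may take its place in the order at any one of its occurrences.
\<close>

definition clockwise_on_outer_face :: "complex set \<Rightarrow> complex list \<Rightarrow> bool" where
  "clockwise_on_outer_face S us \<longleftrightarrow>
     (\<exists>c ts. simple_path c \<and> pathfinish c = pathstart c \<and>
        (\<forall>z\<in>inside (path_image c). winding_number c z = -1) \<and>
        S \<subseteq> path_image c \<union> inside (path_image c) \<and>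
        S \<inter> path_image c = set us \<and>
        sorted_wrt (<) ts \<and> set ts \<subseteq> {0..<1} \<and> us = map c ts)"

definition matchgate ::
  "complex set \<Rightarrow> complex set set \<Rightarrow> complex list \<Rightarrow> bool" where
  "matchgate V E us \<longleftrightarrow>
     plane_graph V E \<and> distinct us \<and> set us \<subseteq> V \<and> clockwise_on_outer_face (V \<union> \<Union>E) us"

definition matchgate_val ::
  "complex set \<Rightarrow> complex set set \<Rightarrow> (complex set \<Rightarrow> complex) \<Rightarrow> complex list \<Rightarrow> bool list \<Rightarrow> complex"
  where
  "matchgate_val V E w us \<alpha> =
     (let X = {us ! i | i. i < length us \<and> \<alpha> ! i}
      in PM (V - X) {e \<in> E. e \<inter> X = {}} w)"

definition matchgate_sigs :: "signature set" where
  "matchgate_sigs =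
     {f. \<exists>V E w us. matchgate V E us \<and> arity f = length us \<and>
           (\<forall>\<alpha>. length \<alpha> = arity f \<longrightarrow> sigval f \<alpha> = matchgate_val V E w us \<alpha>)}"

definition permute_sig :: "(nat \<Rightarrow> nat) \<Rightarrow> signature \<Rightarrow> signature" where
  "permute_sig \<pi> f = (arity f, \<lambda>\<alpha>. sigval f (permute_list \<pi> \<alpha>))"

definition permutable_matchgate_sigs :: "signature set" where
  "permutable_matchgate_sigs =
     {f. \<forall>\<pi>. \<pi> permutes {..<arity f} \<longrightarrow> permute_sig \<pi> f \<in> matchgate_sigs}"


section \<open>Affine signatures\<close>

text \<open>
  The linear system \<open>AX = c\<close> has \<open>m\<close> equations; variables are numbered from \<open>0\<close>. No signature of
  arity \<open>0\<close> is affine, not even a constant, so an existence claim about non-affine signatures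
  has to rule out arity \<open>0\<close> separately.
\<close>

definition affine_sigs :: "signature set" where
  "affine_sigs =
     {f. arity f \<ge> 1 \<and>
        (\<exists>(l::complex) (m::nat) (A :: nat \<Rightarrow> nat \<Rightarrow> bit) (c :: nat \<Rightarrow> bit)
          (a :: nat \<Rightarrow> nat) (b :: nat \<Rightarrow> nat \<Rightarrow> nat).
          (\<forall>i. a i \<in> {0,1,2,3}) \<and> (\<forall>i j. b i j \<in> {0,1}) \<and>
          (\<forall>x. length x = arity f \<longrightarrow>
             sigval f x =
               l * of_bool (\<forall>r<m. (\<Sum>j<arity f. A r j * of_bool (x ! j)) = c r)
                 * \<i> ^ ((\<Sum>i<arity f. a i * (of_bool (x ! i))\<^sup>2)
                        + 2 * (\<Sum>j<arity f. \<Sum>i<j. b i j * of_bool (x ! i) * of_bool (x ! j)))))}"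


section \<open>Left-side gadgets\<close>

text \<open>
  The two vertex classes are \<open>gU\<close> and \<open>gV\<close>, the normal edges \<open>gE\<close>, and the dangling edges \<open>gD\<close> are
  listed in the order of the variables of the realized signature. \<open>gfst e\<close> is the endpoint in \<open>gU\<close>
  of a normal or dangling edge, \<open>gsnd e\<close> the endpoint in \<open>gV\<close> of a normal edge; parallel edges are
  allowed. \<open>gargs v\<close> lists the edges at \<open>v\<close> in the order of the arguments of its signature \<open>gsig v\<close>.
\<close>

record gadget =
  gU :: "nat set"
  gV :: "nat set"
  gE :: "nat set"
  gD :: "nat list"
  gfst :: "nat \<Rightarrow> nat"
  gsnd :: "nat \<Rightarrow> nat"
  gsig :: "nat \<Rightarrow> signature"
  gargs :: "nat \<Rightarrow> nat list"

definition edges_at :: "gadget \<Rightarrow> nat \<Rightarrow> nat set" where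
  "edges_at G v =
     (if v \<in> gU G then {e \<in> gE G \<union> set (gD G). gfst G e = v} else {e \<in> gE G. gsnd G e = v})"

definition left_gadget :: "signature set \<Rightarrow> signature set \<Rightarrow> gadget \<Rightarrow> bool" where
  "left_gadget F1 F2 G \<longleftrightarrow>
     finite (gU G) \<and> finite (gV G) \<and> gU G \<inter> gV G = {} \<and>
     finite (gE G) \<and> distinct (gD G) \<and> gE G \<inter> set (gD G) = {} \<and>
     (\<forall>e\<in>gE G. gfst G e \<in> gU G \<and> gsnd G e \<in> gV G) \<and>
     (\<forall>e\<in>set (gD G). gfst G e \<in> gU G) \<and>
     (\<forall>v\<in>gU G. gsig G v \<in> F1) \<and> (\<forall>v\<in>gV G. gsig G v \<in> F2) \<and>
     (\<forall>v\<in>gU G \<union> gV G. distinct (gargs G v) \<and> set (gargs G v) = edges_at G v \<and>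
        length (gargs G v) = arity (gsig G v))"

text \<open>
  \<open>\<tau>\<close> is the combined assignment \<open>\<alpha>\<sigma>\<close>: it ranges over the assignments to all edges that agree with
  \<open>\<alpha>\<close> on the dangling ones.
\<close>

definition gadget_val :: "gadget \<Rightarrow> bool list \<Rightarrow> complex" where
  "gadget_val G \<alpha> =
     (\<Sum>\<tau> | \<tau> \<in> (gE G \<union> set (gD G)) \<rightarrow>\<^sub>E (UNIV :: bool set) \<and> map \<tau> (gD G) = \<alpha>.
        \<Prod>v\<in>gU G \<union> gV G. sigval (gsig G v) (map \<tau> (gargs G v)))"

text \<open>
  In a drawing without crossings, a dangling edge is an arc whose second end is free. It leads to the
  outer face if that free end lies in the unbounded face of the drawing of the vertices and normal
  edges; the arc, minus its first end, then runs entirely in that face.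
\<close>

definition planar_gadget :: "gadget \<Rightarrow> bool" where
  "planar_gadget G \<longleftrightarrow>
     (\<exists>(p :: nat \<Rightarrow> complex) (c :: nat \<Rightarrow> real \<Rightarrow> complex).
        let P = p ` (gU G \<union> gV G) in
        inj_on p (gU G \<union> gV G) \<and>
        (\<forall>e\<in>gE G \<union> set (gD G). arc (c e) \<and> pathstart (c e) = p (gfst G e)) \<and>
        (\<forall>e\<in>gE G. pathfinish (c e) = p (gsnd G e) \<and>
           path_image (c e) \<inter> P = {p (gfst G e), p (gsnd G e)}) \<and>
        (\<forall>e\<in>set (gD G). path_image (c e) \<inter> P = {p (gfst G e)} \<and>
           pathfinish (c e) \<in> outside (P \<union> (\<Union>e\<in>gE G. path_image (c e)))) \<and>
        (\<forall>e\<in>gE G \<union> set (gD G). \<forall>e'\<in>gE G \<union> set (gD G).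
           e \<noteq> e' \<longrightarrow> path_image (c e) \<inter> path_image (c e') \<subseteq> P))"

definition planar_left_realizable :: "signature set \<Rightarrow> signature set \<Rightarrow> signature \<Rightarrow> bool" where
  "planar_left_realizable F1 F2 f \<longleftrightarrow>
     (\<exists>G. left_gadget F1 F2 G \<and> planar_gadget G \<and> arity f = length (gD G) \<and>
        (\<forall>\<alpha>. length \<alpha> = arity f \<longrightarrow> sigval f \<alpha> = gadget_val G \<alpha>))"

end

theory Submission
  imports Defs
begin

text \<open>
  Write \<open>H(A)\<close> for the value of \<open>F\<close> at the indicator vector of \<open>A\<close>. Superposing two perfect matchings
  of a matchgate gives alternating paths that pair up the external nodes covered by only one of
  them, and planarity keeps these paths from crossing; swapping along a path yields the matchgate
  identities. When they hold for every order of the variables, they collapse to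
  \<open>H(A) H(B) = H(A \<triangle> {i,j}) H(B \<triangle> {i,j})\<close> for all \<open>i, j \<in> A \<triangle> B\<close>. With the parity condition
  this determines \<open>F\<close> from the ratios \<open>a\<^sub>i\<^sub>j = H(X \<triangle> {i,j}) / H(X)\<close> at one support vector \<open>X\<close>, and \<open>F\<close>
  is affine unless
  (1) \<open>a\<^sub>i\<^sub>j, a\<^sub>i\<^sub>k \<noteq> 0 = a\<^sub>j\<^sub>k\<close>, or (2) some nonzero \<open>a\<^sub>i\<^sub>j\<close> has \<open>a\<^sub>i\<^sub>j\<^sup>4 \<noteq> 1\<close>, or
  (3) \<open>a\<^sub>i\<^sub>j, a\<^sub>i\<^sub>k, a\<^sub>j\<^sub>k \<noteq> 0\<close> and \<open>(a\<^sub>i\<^sub>j a\<^sub>i\<^sub>k / a\<^sub>j\<^sub>k)\<^sup>2 \<noteq> 1\<close>, for some \<open>i, j, k\<close>.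

  So two or three variables witness the failure once the others are pinned to \<open>X\<close>. Zeros are
  pinned by \<open>[1,0]\<close>. Below a support vector of minimal weight \<open>w\<close> all ones are forced, so joining
  them in pairs provides edges that carry the bit 1, in any positive number congruent to \<open>w\<close>
  modulo 2; an edge left over turns the parity signature \<open>[1,0,1,0]\<close> into a negation. In case (1)
  two copies joined crosswise give \<open>[v\<^sub>1\<^sup>2, 0, 2 v\<^sub>2 v\<^sub>3]\<close>, which is not affine because the \<open>v\<^sub>i\<close> have equal
  modulus unless (2) applies; case (2) gives \<open>[1, 0, a]\<close>; in case (3), diagonal binary gadgets make
  the three values of weight 2 equal, which gives \<open>[1, 0, s, 0]\<close> with \<open>s\<^sup>2 \<noteq> 1\<close>.
\<close>

text \<open>Three obstacles shape the proof. Matchgates are drawn with arbitrary arcs, so that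
  alternating paths do not cross is a fact of plane topology; it is reduced to a crossing lemma for
  Jordan domains. In a left-side gadget every dangling edge starts at a copy of F. A cap can
  therefore not be exposed, there is no bare wire, and each negation has to end in a diagonal binary
  tensor made from F itself. Finally, all caps have even support: if F has even support too, then so
  has every gadget, and no gadget carries a single 1. This is why the parity of the number of pinned
  ones runs through all three cases and why surplus ones are kept open until they can be joined.
  That the realized signature is a matchgate signature is read off its values: every [a, 0, b] and,
  for nonzero b, every [a, 0, b, 0] comes from an explicit matchgate with four vertices.\<close>

section \<open>Crossing paths in a Jordan domain\<close>

lemma simple_closed_path_eq_imp:
  assumes "simple_path c" "s \<in> {0..1}" "t \<in> {0..1}" "c s = c t"
  shows "s = t \<or> s = 0 \<and> t = 1 \<or> s = 1 \<and> t = 0"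
  using assms unfolding simple_path_def loop_free_def by blast

text \<open>Neither set is assumed to meet the curve only in its two given points, since an
  alternating path may run through further external nodes. \<open>P\<close> is merely compact and
  connected, because it will be a union of edges; that is enough for Janiszewski's theorem.\<close>

lemma paths_in_Jordan_disc_cross:
  fixes c g :: "real \<Rightarrow> complex"
  assumes c: "simple_path c" "pathfinish c = pathstart c"
    and t: "0 \<le> t1" "t1 < t2" "t2 < t3" "t3 < t4" "t4 < 1"
    and P: "compact P" "connected P" "P \<subseteq> path_image c \<union> inside (path_image c)" "c t1 \<in> P" "c t3 \<in> P"
    and g: "path g" "path_image g \<subseteq> path_image c \<union> inside (path_image c)"
      "(pathstart g = c t2 \<and> pathfinish g = c t4) \<or> (pathstart g = c t4 \<and> pathfinish g = c t2)"
  shows "P \<inter> path_image g \<noteq> {}"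
proof
  assume disj: "P \<inter> path_image g = {}"
  define h where "h = (if pathstart g = c t2 then g else reversepath g)"
  have h: "path h" "path_image h = path_image g" "pathstart h = c t2" "pathfinish h = c t4"
    using g unfolding h_def by auto
  define A where "A = c ` {t1..t3}"
  define B where "B = c ` ({0..t1} \<union> {t3..1})"
  have cc: "continuous_on {0..1} c"
    using c(1) by (simp add: simple_path_def path_def)
  have cA: "compact A" unfolding A_def
    using t by (intro compact_continuous_image continuous_on_subset[OF cc]) auto
  have cB: "compact B" unfolding B_def
    using t by (intro compact_continuous_image continuous_on_subset[OF cc]) auto
  have AB: "A \<union> B = path_image c"
    using t unfolding A_def B_def path_image_def image_Un[symmetric] by (intro arg_cong2[where f=image]) auto
  have AiB: "A \<inter> B \<subseteq> {c t1, c t3}"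
  proof
    fix z assume "z \<in> A \<inter> B"
    then obtain s u where s: "s \<in> {t1..t3}" "z = c s" and u: "u \<in> {0..t1} \<union> {t3..1}" "z = c u"
      unfolding A_def B_def by blast
    from simple_closed_path_eq_imp[OF c(1), of s u] s u t
    have "s = u \<or> s = 0 \<and> u = 1 \<or> s = 1 \<and> u = 0" by auto
    then have "s = t1 \<or> s = t3" using s u t by auto
    then show "z \<in> {c t1, c t3}" using s by auto
  qed
  have jo: "inside (path_image c) \<inter> path_image c = {}" "outside (path_image c) \<inter> path_image c = {}"
     "inside (path_image c) \<inter> outside (path_image c) = {}"
     "connected (outside (path_image c))" "frontier (outside (path_image c)) = path_image c"
    using Jordan_inside_outside[OF c] by (auto simp: inside_no_overlap outside_no_overlap inside_Int_outside)
  have ch: "continuous_on {0..1} h" using h by (simp add: path_def)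
  \<comment> \<open>Shorten \<open>h\<close> to a piece \<open>[s0, s1]\<close> from \<open>A\<close> to \<open>B\<close> running inside. From its midpoint one escapes to
    the outside of the curve past \<open>B\<close>, avoiding \<open>A \<union> P\<close>, and past \<open>A\<close>, avoiding \<open>B \<union> P\<close>; as
    \<open>(A \<union> P) \<inter> (B \<union> P) = P\<close> is connected, Janiszewski's theorem contradicts the Jordan curve theorem.\<close>
  define SB where "SB = {s \<in> {0..1}. h s \<in> B}"
  have "closed SB" unfolding SB_def
    using continuous_closed_preimage[OF ch _ compact_imp_closed[OF cB]]
    by (simp add: vimage_def Int_def)
  moreover have "SB \<subseteq> {0..1}" unfolding SB_def by auto
  ultimately have "compact SB" by (metis compact_Icc closed_Int_compact inf.absorb_iff1)
  moreover have "1 \<in> SB" using h t unfolding SB_def B_def pathfinish_def by auto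
  ultimately obtain s1 where s1: "s1 \<in> SB" "\<And>s. s \<in> SB \<Longrightarrow> s1 \<le> s"
    using compact_attains_inf[of SB] by blast
  define SA where "SA = {s \<in> {0..s1}. h s \<in> A}"
  have s1': "0 \<le> s1" "s1 \<le> 1" "h s1 \<in> B" using s1 by (auto simp: SB_def)
  have "closed SA" unfolding SA_def
    using continuous_closed_preimage[OF continuous_on_subset[OF ch] _ compact_imp_closed[OF cA], of "{0..s1}"] s1'
    by (simp add: vimage_def Int_def)
  moreover have "SA \<subseteq> {0..1}" using s1' unfolding SA_def by auto
  ultimately have "compact SA" by (metis compact_Icc closed_Int_compact inf.absorb_iff1)
  moreover have "0 \<in> SA" using h t s1' unfolding SA_def A_def pathstart_def by auto
  ultimately obtain s0 where s0: "s0 \<in> SA" "\<And>s. s \<in> SA \<Longrightarrow> s \<le> s0"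
    using compact_attains_sup[of SA] by blast
  have s0': "0 \<le> s0" "s0 \<le> s1" "h s0 \<in> A" using s0 by (auto simp: SA_def)
  have hP: "h s \<notin> P" if "s \<in> {0..1}" for s
    using that disj h unfolding path_image_def by blast
  have hin: "h s \<in> path_image c \<union> inside (path_image c)" if "s \<in> {0..1}" for s
    using that g h unfolding path_image_def by blast
  \<comment> \<open>\<open>A\<close> and \<open>B\<close> share only the points \<open>c t1\<close>
    and \<open>c t3\<close>; both belong to \<open>P\<close>, which \<open>h\<close> avoids.\<close>
  have "s0 \<noteq> s1" using AiB s0' s1' hP[of s1] P by auto
  then have s01: "s0 < s1" using s0' by simp
  have hA: "h s \<notin> A" if "s0 < s" "s \<le> s1" for s
    using s0(2)[of s] that s0' unfolding SA_def by auto
  have hB: "h s \<notin> B" if "0 \<le> s" "s < s1" for s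
    using s1(2)[of s] that s1' unfolding SB_def by auto
  define m where "m = (s0 + s1) / 2"
  have m: "s0 < m" "m < s1" "m \<in> {0..1}" using s01 s0' s1' by (auto simp: m_def)
  have xin: "h m \<in> inside (path_image c)"
    using hin[of m] hA[of m] hB[of m] m s0' AB by auto
  \<comment> \<open>\<open>h\<close> leads from its midpoint to a point \<open>h s\<close> of the
    curve. That point is a limit of outside points, and since \<open>K\<close> and \<open>P\<close>
    are closed, a small ball around it bridges the gap to the outside.\<close>
  have key: "connected_component (- (K \<union> P)) (h m) w"
    if K: "compact K" "K \<subseteq> path_image c" "I \<subseteq> {0..1}" "connected I" "m \<in> I" "s \<in> I"
        "\<And>s. s \<in> I \<Longrightarrow> h s \<notin> K" "h s \<in> path_image c" and w: "w \<in> outside (path_image c)" for K I s w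
  proof -
    have "connected (h ` I)"
      using K by (intro connected_continuous_image continuous_on_subset[OF ch])
    moreover have "h ` I \<subseteq> - (K \<union> P)" using K hP by blast
    ultimately have 1: "connected_component (- (K \<union> P)) (h m) (h s)"
      using K unfolding connected_component_def by blast
    have op: "open (- (K \<union> P))"
      using K(1) P(1) by (intro open_Compl closed_Un compact_imp_closed)
    have hs: "h s \<in> - (K \<union> P)" using K hP by blast
    then obtain e where e: "e > 0" "ball (h s) e \<subseteq> - (K \<union> P)" using op open_contains_ball by blast
    have "h s \<in> closure (outside (path_image c))" using K jo(5) frontier_def by (metis DiffD1)
    then obtain w' where w': "w' \<in> outside (path_image c)" "dist w' (h s) < e"
      using e closure_approachable by blast
    have 2: "connected_component (- (K \<union> P)) (h s) w'"
      unfolding connected_component_def using e w'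
      by (intro exI[of _ "ball (h s) e"]) (auto simp: dist_commute)
    have "outside (path_image c) \<subseteq> - (K \<union> P)"
      using K(2) P(3) jo by blast
    then have 3: "connected_component (- (K \<union> P)) w' w"
      unfolding connected_component_def using w w' jo(4) by blast
    show ?thesis using 1 2 3 connected_component_trans by blast
  qed
  obtain w where w: "w \<in> outside (path_image c)"
    using Jordan_inside_outside[OF c] by blast
  have 1: "connected_component (- (A \<union> P)) (h m) w"
    by (rule key[where I="{m..s1}" and s=s1]) (use AB cA m s0' s1' hA w in auto)
  have 2: "connected_component (- (B \<union> P)) (h m) w"
    by (rule key[where I="{s0..m}" and s=s0]) (use AB cB m s0' s1' hB w in auto)
  have "(A \<union> P) \<inter> (B \<union> P) = P" using AiB P by auto
  then have "connected_component (- ((A \<union> P) \<union> (B \<union> P))) (h m) w"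
    using Janiszewski[of "A \<union> P" "B \<union> P", OF _ _ _ 1 2] P cA cB by (simp add: compact_Un compact_imp_closed closed_Un)
  then have "connected_component (- path_image c) (h m) w"
    using connected_component_mono[of "- ((A \<union> P) \<union> (B \<union> P))" "- path_image c"] AB by blast
  then obtain T where T: "connected T" "T \<subseteq> - path_image c" "h m \<in> T" "w \<in> T"
    unfolding connected_component_def by blast
  have "T \<subseteq> connected_component_set (- path_image c) (h m)"
    using T by (simp add: connected_component_maximal)
  then have "w \<in> inside (path_image c)"
    using xin T(4) inside_same_component[of "path_image c" "h m" w] by blast
  then show False using w jo by blast
qed

section \<open>Superpositions of matchings\<close>

text \<open>A perfect matching of the graph that remains after the vertices in \<open>X\<close> are
  removed. Edges are abstract objects with ends \<open>en e\<close>, which keeps the combinatorics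
  free of the drawing; it is applied with \<open>en e = e \<inter> V\<close>.\<close>

definition covers_exactly :: "('e \<Rightarrow> 'v set) \<Rightarrow> 'v set \<Rightarrow> 'e set \<Rightarrow> 'v set \<Rightarrow> bool" where
  "covers_exactly en V M X \<longleftrightarrow>
     (\<forall>e\<in>M. card (en e) = 2 \<and> en e \<subseteq> V - X) \<and> (\<forall>v\<in>V - X. \<exists>!e. e \<in> M \<and> v \<in> en e)"

definition component :: "('e \<Rightarrow> 'v set) \<Rightarrow> 'e set \<Rightarrow> 'v \<Rightarrow> 'v set" where
  "component en L u = {v. (u, v) \<in> {(a, b). \<exists>e\<in>L. a \<in> en e \<and> b \<in> en e}\<^sup>*}"

lemma component_refl: "u \<in> component en L u"
  by (simp add: component_def)

lemma component_closed:
  assumes "e \<in> L" "a \<in> en e" "a \<in> component en L u"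
  shows "en e \<subseteq> component en L u"
proof
  fix b assume b: "b \<in> en e"
  have "(u, a) \<in> {(a, b). \<exists>e\<in>L. a \<in> en e \<and> b \<in> en e}\<^sup>*" using assms by (simp add: component_def)
  moreover have "(a, b) \<in> {(a, b). \<exists>e\<in>L. a \<in> en e \<and> b \<in> en e}" using assms b by auto
  ultimately have "(u, b) \<in> {(a, b). \<exists>e\<in>L. a \<in> en e \<and> b \<in> en e}\<^sup>*"
    by (rule rtrancl_into_rtrancl)
  then show "b \<in> component en L u" by (simp add: component_def)
qed

lemma component_least:
  assumes "u \<in> K" and cl: "\<And>e. e \<in> L \<Longrightarrow> en e \<inter> K \<noteq> {} \<Longrightarrow> en e \<subseteq> K"
  shows "component en L u \<subseteq> K"
proof
  fix v assume "v \<in> component en L u"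
  then have "(u, v) \<in> {(a, b). \<exists>e\<in>L. a \<in> en e \<and> b \<in> en e}\<^sup>*" by (simp add: component_def)
  then show "v \<in> K"
  proof (induction rule: rtrancl_induct)
    case base then show ?case using assms by simp
  next
    case (step y z)
    then obtain e where "e \<in> L" "y \<in> en e" "z \<in> en e" by auto
    then show ?case using cl[of e] step by blast
  qed
qed

lemma component_sym:
  assumes "v \<in> component en L u" shows "component en L v = component en L u"
proof -
  let ?R = "{(a, b). \<exists>e\<in>L. a \<in> en e \<and> b \<in> en e}"
  have "sym ?R" unfolding sym_def by auto
  then have s: "sym (?R\<^sup>*)" by (rule sym_rtrancl)
  have uv: "(u, v) \<in> ?R\<^sup>*" using assms by (simp add: component_def)
  then have vu: "(v, u) \<in> ?R\<^sup>*" using s by (simp add: sym_def)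
  show ?thesis unfolding component_def using uv vu by (meson rtrancl_trans Collect_cong)
qed

text \<open>Induction along the path. At \<open>u\<close> only \<open>M\<close> has an edge, say to
  \<open>v\<close>. If \<open>v\<close> is in \<open>Y\<close>, the path ends there. Otherwise that
  edge is removed, which exposes \<open>u\<close> and \<open>v\<close> in \<open>M\<close>; then
  \<open>v\<close> is covered by \<open>N\<close> only, and the hypothesis applies from
  \<open>v\<close> with the two matchings exchanged.\<close>

lemma alternating_component_aux:
  assumes "finite M" "finite N" "covers_exactly en V M X" "covers_exactly en V N Y"
    and "X \<subseteq> V" "Y \<subseteq> V" "u \<in> Y - X"
  shows "\<exists>u'. u' \<noteq> u \<and> component en (M \<union> N) u \<inter> sym_diff X Y = {u, u'}"
  using assms
proof (induction "card M + card N" arbitrary: M N X Y u rule: less_induct)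
  case less
  note M = less.prems(3) and N = less.prems(4)
  have uV: "u \<in> V - X" using less.prems by auto
  then obtain e where e: "e \<in> M" "u \<in> en e" and eu: "\<And>e'. e' \<in> M \<Longrightarrow> u \<in> en e' \<Longrightarrow> e' = e"
    using M unfolding covers_exactly_def by metis
  obtain v where v: "en e = {u, v}" "v \<noteq> u" "v \<in> V - X"
    using M e unfolding covers_exactly_def by (metis card_2_iff doubleton_eq_iff insertE insert_subset singletonD)
  have v_only: "e' = e" if "e' \<in> M" "v \<in> en e'" for e'
  proof -
    have "\<exists>!e. e \<in> M \<and> v \<in> en e" using M v(3) unfolding covers_exactly_def by blast
    moreover have "v \<in> en e" using v by simp
    ultimately show ?thesis using e(1) that by blast
  qed
  have Nu: "\<And>e'. e' \<in> N \<Longrightarrow> u \<notin> en e'"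
    using N less.prems unfolding covers_exactly_def by blast
  show ?case
  proof (cases "v \<in> Y")
    case True
    have Nv: "\<And>e'. e' \<in> N \<Longrightarrow> v \<notin> en e'"
      using N True unfolding covers_exactly_def by blast
    have "component en (M \<union> N) u \<subseteq> {u, v}"
      by (rule component_least) (use eu v_only Nu Nv v in blast)+
    moreover have "{u, v} \<subseteq> component en (M \<union> N) u"
      using component_closed[of e "M \<union> N" u en u] e v component_refl by fastforce
    ultimately have "component en (M \<union> N) u = {u, v}" by blast
    moreover have "v \<in> sym_diff X Y" "u \<in> sym_diff X Y" using True v less.prems by auto
    ultimately show ?thesis using v by blast
  next
    case False
    define M0 where "M0 = M - {e}"
    define X0 where "X0 = X \<union> {u, v}"
    have M0: "covers_exactly en V M0 X0"
      unfolding covers_exactly_def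
    proof (intro conjI ballI)
      fix e' assume e': "e' \<in> M0"
      then show "card (en e') = 2" using M unfolding covers_exactly_def M0_def by blast
      show "en e' \<subseteq> V - X0" using M e' eu v_only unfolding covers_exactly_def M0_def X0_def by blast
    next
      fix x assume x: "x \<in> V - X0"
      then obtain e' where "e' \<in> M" "x \<in> en e'" "\<And>f. f \<in> M \<Longrightarrow> x \<in> en f \<Longrightarrow> f = e'"
        using M unfolding covers_exactly_def X0_def by blast
      moreover have "e' \<noteq> e" using calculation x v unfolding X0_def by blast
      ultimately show "\<exists>!e'. e' \<in> M0 \<and> x \<in> en e'" unfolding M0_def by blast
    qed
    have "card N + card M0 < card M + card N"
      using less.prems(1) e card_Diff1_less[of M e] unfolding M0_def by simp
    from less.hyps[OF this _ _ N M0, of v] less.prems v False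
    obtain u' where u': "u' \<noteq> v" "component en (N \<union> M0) v \<inter> sym_diff Y X0 = {v, u'}"
      unfolding M0_def X0_def by auto
    let ?C = "component en (M \<union> N) u" and ?K = "component en (N \<union> M0) v"
    have "?C = insert u ?K"
    proof (rule subset_antisym)
      show "?C \<subseteq> insert u ?K"
      proof (rule component_least)
        fix e' assume e': "e' \<in> M \<union> N" "en e' \<inter> insert u ?K \<noteq> {}"
        show "en e' \<subseteq> insert u ?K"
        proof (cases "e' = e")
          case True then show ?thesis using v component_refl[of v] by auto
        next
          case False
          then have "e' \<in> N \<union> M0" using e' M0_def by auto
          moreover have "u \<notin> en e'" using e' False eu Nu by blast
          ultimately show ?thesis using e' component_closed[of e' "N \<union> M0" _ en v] by blast
        qed
      qed simp
    next
      have 1: "v \<in> ?C" using component_closed[of e "M \<union> N" u en u] e v component_refl by fastforce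
      have "?K \<subseteq> ?C"
        by (rule component_least) (use 1 component_closed[of _ "M \<union> N" _ en u] M0_def in blast)+
      then show "insert u ?K \<subseteq> ?C" using component_refl by fastforce
    qed
    moreover have "sym_diff X Y = insert u (sym_diff Y X0 - {v})"
      using less.prems v False unfolding X0_def by auto
    ultimately have "?C \<inter> sym_diff X Y = insert u (?K \<inter> sym_diff Y X0 - {v})"
      by auto
    also have "\<dots> = {u, u'}" using u' by auto
    finally have "?C \<inter> sym_diff X Y = {u, u'}" .
    moreover have "u' \<noteq> u" using u' less.prems unfolding X0_def by auto
    ultimately show ?thesis by blast
  qed
qed

text \<open>A component of the superposition of two matchings is an alternating cycle or an alternating
  path; the ends of the paths are the vertices covered by exactly one of the two matchings.\<close>

lemma alternating_component:
  assumes "finite M" "finite N" "covers_exactly en V M X" "covers_exactly en V N Y"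
    and "X \<subseteq> V" "Y \<subseteq> V" "u \<in> sym_diff X Y"
  shows "\<exists>u'. u' \<noteq> u \<and> component en (M \<union> N) u \<inter> sym_diff X Y = {u, u'}"
proof (cases "u \<in> Y")
  case True then show ?thesis using alternating_component_aux[OF assms(1-6)] assms by blast
next
  case False
  have s: "sym_diff Y X = sym_diff X Y" by blast
  show ?thesis
    using alternating_component_aux[OF assms(2,1,4,3,6,5), of u] assms False
    unfolding s Un_commute[of N M] by blast
qed

text \<open>No edge joins \<open>K\<close> to its complement, so \<open>N\<close> may be used inside
  and \<open>M\<close> outside without conflict.\<close>

lemma covers_exactly_swap:
  assumes M: "covers_exactly en V M X" and N: "covers_exactly en V N Y"
    and cl: "\<And>e. e \<in> M \<union> N \<Longrightarrow> en e \<inter> K \<noteq> {} \<Longrightarrow> en e \<subseteq> K"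
  shows "covers_exactly en V ({e \<in> M. en e \<inter> K = {}} \<union> {e \<in> N. en e \<inter> K \<noteq> {}}) ((X - K) \<union> (Y \<inter> K))"
    (is "covers_exactly en V ?M ?X")
  unfolding covers_exactly_def
proof (intro conjI ballI)
  fix e assume e: "e \<in> ?M"
  have M': "card (en e) = 2 \<and> en e \<subseteq> V - X" if "e \<in> M" using M that unfolding covers_exactly_def by metis
  have N': "card (en e) = 2 \<and> en e \<subseteq> V - Y" if "e \<in> N" using N that unfolding covers_exactly_def by metis
  show "card (en e) = 2" using e M' N' by auto
  show "en e \<subseteq> V - ?X"
  proof (cases "e \<in> M \<and> en e \<inter> K = {}")
    case True then show ?thesis using M' by auto
  next
    case False
    then have "e \<in> N" "en e \<inter> K \<noteq> {}" using e by auto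
    then show ?thesis using N' cl[of e] by auto
  qed
next
  fix v assume v: "v \<in> V - ?X"
  show "\<exists>!e. e \<in> ?M \<and> v \<in> en e"
  proof (cases "v \<in> K")
    case True
    then have "\<exists>!e. e \<in> N \<and> v \<in> en e" using v N unfolding covers_exactly_def by blast
    then show ?thesis using True by blast
  next
    case False
    then have "\<exists>!e. e \<in> M \<and> v \<in> en e" using v M unfolding covers_exactly_def by blast
    then show ?thesis using False cl by blast
  qed
qed

text \<open>Summing 1 over \<open>B\<close> in \<open>bit\<close>, where 1 + 1 = 0, turns the
  cancellation of sums under an involution into a statement on parity.\<close>

lemma even_card_involution:
  assumes "\<And>x. x \<in> B \<Longrightarrow> h x \<in> B" "\<And>x. x \<in> B \<Longrightarrow> h (h x) = x" "\<And>x. x \<in> B \<Longrightarrow> h x \<noteq> x"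
  shows "even (card B)"
proof -
  have "(\<Sum>x\<in>B. (1::bit)) = 0"
    by (rule sum_involution_eq_0[where h = h]) (use assms in auto)
  moreover have "(of_nat n :: bit) = of_bool (odd n)" for n by (induction n) auto
  ultimately show ?thesis by simp
qed

text \<open>A point strictly between \<open>d\<close> and \<open>p d\<close> has its partner there
  too, as the two pairs would cross otherwise. So \<open>p\<close> permutes these points without
  fixed points, their number is even, and the ranks of \<open>d\<close> and \<open>p d\<close>
  differ by an odd number.\<close>

lemma noncrossing_pairing_parity:
  fixes D :: "nat set"
  assumes "finite D" and p: "\<And>x. x \<in> D \<Longrightarrow> p x \<in> D" "\<And>x. x \<in> D \<Longrightarrow> p (p x) = x" "\<And>x. x \<in> D \<Longrightarrow> p x \<noteq> x"
    and nc: "\<And>a b. a \<in> D \<Longrightarrow> b \<in> D \<Longrightarrow> \<not> (a < b \<and> b < p a \<and> p a < p b)"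
    and d: "d \<in> D"
  shows "(-1::complex) ^ card {x \<in> D. x < p d} = - ((-1) ^ card {x \<in> D. x < d})"
proof -
  have main: "odd (card {x \<in> D. x < p d} + card {x \<in> D. x < d})" if d: "d \<in> D" "d < p d" for d
  proof -
    let ?B = "{x \<in> D. d < x \<and> x < p d}"
    have ev: "even (card ?B)"
    proof (rule even_card_involution[where h = p])
      fix x assume x: "x \<in> ?B"
      have "p x \<noteq> d" "p x \<noteq> p d" using x p d by (metis (no_types, lifting) mem_Collect_eq nat_neq_iff)+
      moreover have "\<not> p x < d" using nc[of "p x" d] x p[of x] d by auto
      moreover have "\<not> p x > p d" using nc[of d x] x d by auto
      ultimately show "p x \<in> ?B" using p x by auto
    qed (use p in auto)
    have "{x \<in> D. x < p d} = insert d ({x \<in> D. x < d} \<union> ?B)" using d by auto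
    then have "card {x \<in> D. x < p d} = Suc (card ({x \<in> D. x < d} \<union> ?B))" using assms(1) by simp
    also have "card ({x \<in> D. x < d} \<union> ?B) = card {x \<in> D. x < d} + card ?B"
      using assms(1) by (intro card_Un_disjoint) auto
    finally have "card {x \<in> D. x < p d} = Suc (card {x \<in> D. x < d} + card ?B)" .
    with ev show ?thesis by simp
  qed
  have "odd (card {x \<in> D. x < p d} + card {x \<in> D. x < d})"
    using main[of d] main[of "p d"] p[OF d] d by (metis add.commute nat_neq_iff)
  then show ?thesis by (cases "even (card {x \<in> D. x < d})") auto
qed

section \<open>The matchgate identity\<close>

definition exposed_pm :: "complex set \<Rightarrow> complex set set \<Rightarrow> complex list \<Rightarrow> nat set \<Rightarrow> complex set set set" where
  "exposed_pm V E us A = perfect_matchings (V - (!) us ` A) {e \<in> E. e \<inter> (!) us ` A = {}}"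

definition exposed_val ::
    "complex set \<Rightarrow> complex set set \<Rightarrow> (complex set \<Rightarrow> complex) \<Rightarrow> complex list \<Rightarrow> nat set \<Rightarrow> complex" where
  "exposed_val V E w us A = PM (V - (!) us ` A) {e \<in> E. e \<inter> (!) us ` A = {}} w"

lemma exposed_val_eq: "exposed_val V E w us A = (\<Sum>M\<in>exposed_pm V E us A. \<Prod>e\<in>M. w e)"
  by (simp add: exposed_val_def PM_def exposed_pm_def)

lemma matchgate_val_exposed:
  assumes "length \<alpha> = length us"
  shows "matchgate_val V E w us \<alpha> = exposed_val V E w us {i. i < length us \<and> \<alpha> ! i}"
  unfolding matchgate_val_def exposed_val_def Let_def
  by (rule arg_cong2[where f = "\<lambda>X Y. PM (V - X) {e \<in> E. e \<inter> Y = {}} w"]) auto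

lemma plane_graphD:
  assumes "plane_graph V E"
  shows "finite V" "finite E"
    "\<And>e. e \<in> E \<Longrightarrow> \<exists>c. arc c \<and> e = path_image c \<and> e \<inter> V = {pathstart c, pathfinish c}"
    "\<And>e e'. e \<in> E \<Longrightarrow> e' \<in> E \<Longrightarrow> e \<noteq> e' \<Longrightarrow> e \<inter> e' \<subseteq> V"
  using assms unfolding plane_graph_def by (elim conjE, simp)+

lemma plane_graph_card_ends:
  assumes "plane_graph V E" "e \<in> E" shows "card (e \<inter> V) = 2"
proof -
  obtain c where "arc c" "e \<inter> V = {pathstart c, pathfinish c}"
    using plane_graphD(3)[OF assms] by metis
  then show ?thesis using arc_distinct_ends[of c] by simp
qed

text \<open>Dropping the edges at removed nodes amounts to asking that no end of an edge is removed;
  in this form the superposition argument applies.\<close>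

lemma exposed_pm_iff:
  assumes "plane_graph V E" "set us \<subseteq> V" "A \<subseteq> {..<length us}"
  shows "M \<in> exposed_pm V E us A \<longleftrightarrow>
    M \<subseteq> E \<and> covers_exactly (\<lambda>e. e \<inter> V) V M ((!) us ` A)"
proof -
  have X: "(!) us ` A \<subseteq> V" using assms nth_mem by blast
  have 1: "M \<subseteq> {e \<in> E. e \<inter> (!) us ` A = {}} \<longleftrightarrow>
      M \<subseteq> E \<and> (\<forall>e\<in>M. card (e \<inter> V) = 2 \<and> e \<inter> V \<subseteq> V - (!) us ` A)"
  proof -
    have "e \<inter> (!) us ` A = {} \<longleftrightarrow> e \<inter> V \<subseteq> V - (!) us ` A" for e using X by blast
    moreover have "M \<subseteq> {e \<in> E. e \<inter> (!) us ` A = {}} \<longleftrightarrow>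
        M \<subseteq> E \<and> (\<forall>e\<in>M. card (e \<inter> V) = 2 \<and> e \<inter> (!) us ` A = {})"
      using plane_graph_card_ends[OF assms(1)] unfolding subset_iff mem_Collect_eq by meson
    ultimately show ?thesis by presburger
  qed
  have 2: "(\<forall>v\<in>V - (!) us ` A. \<exists>!e. e \<in> M \<and> v \<in> e \<inter> V) \<longleftrightarrow> (\<forall>v\<in>V - (!) us ` A. \<exists>!e. e \<in> M \<and> v \<in> e)"
    by (rule ball_cong) auto
  show ?thesis
    unfolding exposed_pm_def perfect_matchings_def covers_exactly_def mem_Collect_eq 1 2 by simp
qed

text \<open>A nonzero value requires at least one matching, and this splits the remaining vertices
  into pairs.\<close>

lemma exposed_val_parity:
  assumes pg: "plane_graph V E" and us: "set us \<subseteq> V" "A \<subseteq> {..<length us}" "distinct us"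
    and nz: "exposed_val V E w us A \<noteq> 0"
  shows "even (card V + card A)"
proof -
  obtain M where M: "M \<in> exposed_pm V E us A"
    using nz unfolding exposed_val_eq by (metis sum.neutral empty_iff)
  then have ME: "M \<subseteq> E" and co: "covers_exactly (\<lambda>e. e \<inter> V) V M ((!) us ` A)"
    using exposed_pm_iff[OF pg us(1,2)] by auto
  note fin = plane_graphD(1,2)[OF pg]
  have X: "(!) us ` A \<subseteq> V" using us nth_mem by blast
  have co1: "\<And>e. e \<in> M \<Longrightarrow> card (e \<inter> V) = 2" "\<And>e. e \<in> M \<Longrightarrow> e \<inter> V \<subseteq> V - (!) us ` A"
    and co2: "\<And>v. v \<in> V - (!) us ` A \<Longrightarrow> \<exists>!e. e \<in> M \<and> v \<in> e \<inter> V"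
    using co unfolding covers_exactly_def by auto
  have "V - (!) us ` A = (\<Union>e\<in>M. e \<inter> V)"
  proof (rule subset_antisym)
    show "V - (!) us ` A \<subseteq> (\<Union>e\<in>M. e \<inter> V)" using co2 by (meson UN_I ex1_implies_ex subsetI)
    show "(\<Union>e\<in>M. e \<inter> V) \<subseteq> V - (!) us ` A" using co1(2) by (rule UN_least)
  qed
  also have "card \<dots> = (\<Sum>e\<in>M. card (e \<inter> V))"
  proof (rule card_UN_disjoint)
    show "finite M" using ME fin finite_subset by blast
    show "\<forall>i\<in>M. \<forall>j\<in>M. i \<noteq> j \<longrightarrow> (i \<inter> V) \<inter> (j \<inter> V) = {}"
    proof (intro ballI impI, rule ccontr)
      fix i j assume ij: "i \<in> M" "j \<in> M" "i \<noteq> j" "(i \<inter> V) \<inter> (j \<inter> V) \<noteq> {}"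
      then obtain v where v: "v \<in> i \<inter> V" "v \<in> j \<inter> V" by blast
      then have "v \<in> V - (!) us ` A" using co1(2)[OF ij(1)] by blast
      from co2[OF this] show False using ij v by metis
    qed
  qed (use fin in auto)
  also have "\<dots> = 2 * card M" using co1 by simp
  finally have "even (card (V - (!) us ` A))" by simp
  moreover have "card (V - (!) us ` A) = card V - card A" "card A \<le> card V"
  proof -
    have inj: "inj_on ((!) us) A" using us by (meson inj_on_nth inj_on_subset lessThan_iff order_refl subset_eq)
    show "card (V - (!) us ` A) = card V - card A"
      using X fin card_image[OF inj] by (metis card_Diff_subset finite_subset)
    show "card A \<le> card V" using X fin card_image[OF inj] card_mono by metis
  qed
  ultimately show ?thesis by (metis add.commute even_add le_add_diff_inverse even_diff_nat)
qed

text \<open>Each step of the component relation stays inside one path connected edge. The case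
  \<open>v = u\<close> is excluded because at an isolated \<open>u\<close> the union of edges is
  empty and does not contain \<open>u\<close>.\<close>

lemma component_region_connected:
  fixes L :: "complex set set"
  assumes arcs: "\<And>e. e \<in> L \<Longrightarrow> path_connected e" and "v \<in> component (\<lambda>e. e \<inter> V) L u" "v \<noteq> u"
  shows "path_component (\<Union>{e \<in> L. e \<inter> V \<inter> component (\<lambda>e. e \<inter> V) L u \<noteq> {}}) u v"
    (is "path_component ?W u v")
proof -
  let ?C = "component (\<lambda>e. e \<inter> V) L u"
  have st: "path_component ?W a b" if "a \<in> ?C" "e \<in> L" "a \<in> e \<inter> V" "b \<in> e" for a b e
  proof -
    have "e \<inter> V \<inter> ?C \<noteq> {}" using that(1,3) by blast
    then have "e \<subseteq> ?W" using that(2) by (intro Union_upper) simp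
    moreover have "path_component e a b" using arcs that by (auto simp: path_connected_component)
    ultimately show ?thesis by (rule path_component_of_subset)
  qed
  have "(u, v) \<in> {(a, b). \<exists>e\<in>L. a \<in> e \<inter> V \<and> b \<in> e \<inter> V}\<^sup>*" using assms by (simp add: component_def)
  then have "v \<noteq> u \<longrightarrow> path_component ?W u v"
  proof (induction rule: rtrancl_induct)
    case base then show ?case by simp
  next
    case (step y z)
    then have y: "y \<in> ?C" by (simp add: component_def)
    from step obtain e where e: "e \<in> L" "y \<in> e \<inter> V" "z \<in> e \<inter> V" by auto
    have "path_component ?W y z" by (rule st[OF y e(1,2)]) (use e in simp)
    then show ?case using step.IH path_component_trans by (cases "y = u") (blast, blast)
  qed
  then show ?thesis using assms by blast
qed

lemma path_connected_if_from_point: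
  assumes "\<And>z. z \<in> W \<Longrightarrow> path_component W u z"
  shows "path_connected W"
  unfolding path_connected_component
proof (intro ballI)
  fix x y assume "x \<in> W" "y \<in> W"
  then show "path_component W x y"
    using path_component_trans[OF path_component_sym] assms by blast
qed

lemma component_path:
  fixes L :: "complex set set"
  assumes arcs: "\<And>e. e \<in> L \<Longrightarrow> path_connected e"
    and v: "v \<in> component (\<lambda>e. e \<inter> V) L u" "v \<noteq> u"
  shows "path_connected (\<Union>{e \<in> L. e \<inter> V \<inter> component (\<lambda>e. e \<inter> V) L u \<noteq> {}})" (is "path_connected ?W")
proof -
  let ?C = "component (\<lambda>e. e \<inter> V) L u"
  have u: "u \<in> ?W"
    by (rule path_component_mem(1)[OF component_region_connected[OF assms]])
  have "path_component ?W u z" if z: "z \<in> ?W" for z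
  proof -
    from z obtain e where "z \<in> e" "e \<in> {e \<in> L. e \<inter> V \<inter> ?C \<noteq> {}}" by (rule UnionE)
    then have e0: "e \<in> L" "e \<inter> V \<inter> ?C \<noteq> {}" "z \<in> e" by simp_all
    then obtain a where e: "e \<in> L" "a \<in> e \<inter> V" "a \<in> ?C" "z \<in> e" by fast
    have "e \<subseteq> ?W" using e0 by (intro Union_upper) simp
    moreover have "path_component e a z" using arcs e by (auto simp: path_connected_component)
    ultimately have "path_component ?W a z" by (rule path_component_of_subset)
    moreover have "path_component ?W u a"
    proof (cases "a = u")
      case True then show ?thesis using u by (simp add: path_component_refl)
    next
      case False then show ?thesis by (intro component_region_connected[OF arcs e(3)])
    qed
    ultimately show ?thesis by (rule path_component_trans[rotated])
  qed
  then show ?thesis by (rule path_connected_if_from_point)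
qed

text \<open>If the components were different, the edges of the first would form a compact connected
  set through \<open>us ! d1\<close> and \<open>us ! d3\<close>, and those of the second would
  contain a path between \<open>us ! d2\<close> and \<open>us ! d4\<close>. By the crossing lemma
  they meet; as distinct edges of a plane graph share only vertices, the components then have a
  vertex in common.\<close>

lemma components_noncrossing:
  assumes mg: "matchgate V E us" and L: "L \<subseteq> E"
    and d: "d1 < d2" "d2 < d3" "d3 < d4" "d4 < length us"
    and c13: "us ! d3 \<in> component (\<lambda>e. e \<inter> V) L (us ! d1)"
    and c24: "us ! d4 \<in> component (\<lambda>e. e \<inter> V) L (us ! d2)"
  shows "us ! d2 \<in> component (\<lambda>e. e \<inter> V) L (us ! d1)"
proof (rule ccontr)
  assume neg: "us ! d2 \<notin> component (\<lambda>e. e \<inter> V) L (us ! d1)"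
  let ?C = "component (\<lambda>e. e \<inter> V) L"
  let ?W = "\<lambda>d. \<Union>{e \<in> L. e \<inter> V \<inter> ?C (us ! d) \<noteq> {}}"
  have pg: "plane_graph V E" and di: "distinct us" and usV: "set us \<subseteq> V"
    and co: "clockwise_on_outer_face (V \<union> \<Union>E) us"
    using mg unfolding matchgate_def by auto
  note fin = plane_graphD(1,2)[OF pg]
  obtain c ts where c: "simple_path c" "pathfinish c = pathstart c"
    "V \<union> \<Union>E \<subseteq> path_image c \<union> inside (path_image c)"
    "sorted_wrt (<) ts" "set ts \<subseteq> {0..<1}" "us = map c ts"
    using co unfolding clockwise_on_outer_face_def by blast
  have len: "length ts = length us" using c by simp
  have usc: "us ! i = c (ts ! i)" if "i < length us" for i using c that by simp
  have arcs: "path_connected e \<and> compact e" if eL: "e \<in> L" for e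
  proof -
    obtain g where "arc g" "e = path_image g" using plane_graphD(3)[OF pg, of e] L eL by blast
    then show ?thesis by (simp add: compact_arc_image path_connected_path_image arc_imp_path)
  qed
  have ne: "us ! d3 \<noteq> us ! d1" "us ! d4 \<noteq> us ! d2"
    using di d by (auto simp: nth_eq_iff_index_eq)
  have tl: "ts ! i < ts ! j" if "i < j" "j < length us" for i j
    using c(4) that len sorted_wrt_nth_less by metis
  have t0: "0 \<le> ts ! d1" using c(5) d len nth_mem[of d1 ts] by force
  have t1: "ts ! d4 < 1" using c(5) d len nth_mem[of d4 ts] by force
  have sub: "?W d \<subseteq> path_image c \<union> inside (path_image c)" for d using c(3) L by blast
  have comp: "compact (?W d1)"
  proof (rule compact_Union)
    have "finite L" using L fin finite_subset by blast
    then show "finite {e \<in> L. e \<inter> V \<inter> ?C (us ! d1) \<noteq> {}}" by simp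
  qed (use arcs in auto)
  have pc1: "path_connected (?W d1)" by (rule component_path[OF _ c13 ne(1)]) (use arcs in auto)
  have p1: "path_component (?W d1) (us ! d1) (us ! d3)"
    by (rule component_region_connected[OF _ c13 ne(1)]) (use arcs in auto)
  have p2: "path_component (?W d2) (us ! d2) (us ! d4)"
    by (rule component_region_connected[OF _ c24 ne(2)]) (use arcs in auto)
  obtain g where g: "path g" "path_image g \<subseteq> ?W d2" "pathstart g = us ! d2" "pathfinish g = us ! d4"
    using p2 unfolding path_component_def by blast
  have "?W d1 \<inter> path_image g \<noteq> {}"
  proof (rule paths_in_Jordan_disc_cross[OF c(1,2)])
    show "connected (?W d1)" using pc1 path_connected_imp_connected by blast
    show "c (ts ! d1) \<in> ?W d1" "c (ts ! d3) \<in> ?W d1"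
      using p1 path_component_mem[of "?W d1"] usc[of d1] usc[of d3] d by auto
    show "path_image g \<subseteq> path_image c \<union> inside (path_image c)" using g sub by blast
    show "pathstart g = c (ts ! d2) \<and> pathfinish g = c (ts ! d4) \<or> pathstart g = c (ts ! d4) \<and> pathfinish g = c (ts ! d2)"
      using g usc d by auto
  qed (use t0 t1 tl d comp sub g in auto)
  then obtain z where "z \<in> ?W d1 \<inter> path_image g" unfolding ex_in_conv[symmetric] by (rule exE)
  then have z1: "z \<in> ?W d1" and z2: "z \<in> ?W d2" using subsetD[OF g(2)] by (simp_all only: Int_iff)
  from z1 obtain e where "z \<in> e" "e \<in> {e \<in> L. e \<inter> V \<inter> ?C (us ! d1) \<noteq> {}}" by (rule UnionE)
  moreover from z2 obtain e' where "z \<in> e'" "e' \<in> {e \<in> L. e \<inter> V \<inter> ?C (us ! d2) \<noteq> {}}" by (rule UnionE)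
  ultimately have z: "z \<in> e" "z \<in> e'" "e \<in> L" "e' \<in> L"
    "e \<inter> V \<inter> ?C (us ! d1) \<noteq> {}" "e' \<inter> V \<inter> ?C (us ! d2) \<noteq> {}"
    by simp_all
  have sub1: "e \<inter> V \<subseteq> ?C (us ! d1)"
    using component_closed[of e L _ "\<lambda>e. e \<inter> V"] z by blast
  have sub2: "e' \<inter> V \<subseteq> ?C (us ! d2)"
    using component_closed[of e' L _ "\<lambda>e. e \<inter> V"] z by blast
  have "z \<in> V \<or> e = e'" using plane_graphD(4)[OF pg, of e e'] L z by blast
  then obtain y where "y \<in> ?C (us ! d1)" "y \<in> ?C (us ! d2)"
    using sub1 sub2 z by blast
  then have "?C (us ! d1) = ?C (us ! d2)"
    using component_sym[of y "\<lambda>e. e \<inter> V" L] by metis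
  then show False using neg component_refl[of "us ! d2"] by metis
qed

text \<open>The swap moves edges between \<open>M\<close> and \<open>N\<close> but keeps their
  multiset union, in which common edges count twice.\<close>

lemma prod_swap_sets:
  fixes w :: "'a \<Rightarrow> complex"
  assumes "finite M" "finite N"
  shows "prod w ({e\<in>M. \<not> Q e} \<union> {e\<in>N. Q e}) * prod w ({e\<in>N. \<not> Q e} \<union> {e\<in>M. Q e}) = prod w M * prod w N"
proof -
  have a: "prod w ({e\<in>A. \<not> Q e} \<union> {e\<in>B. Q e}) = prod w {e\<in>A. \<not> Q e} * prod w {e\<in>B. Q e}"
    if "finite A" "finite B" for A B
    using that by (intro prod.union_disjoint) auto
  have b: "prod w A = prod w {e\<in>A. \<not> Q e} * prod w {e\<in>A. Q e}" if "finite A" for A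
  proof -
    have "{e\<in>A. \<not> Q e} \<union> {e\<in>A. Q e} = A" by auto
    then show ?thesis using a[OF that that] by simp
  qed
  show ?thesis using a[OF assms] a[OF assms(2,1)] b[OF assms(1)] b[OF assms(2)] by (simp add: mult_ac)
qed

text \<open>The pairs of matchings in all terms together carry an involution: swap the two matchings along
  the component of the external node \<open>d\<close>, whose other end \<open>d'\<close> becomes the new index. As the components
  do not cross, an even number of elements of \<open>D\<close> lies between \<open>d\<close> and \<open>d'\<close>, so the sign changes.\<close>

lemma matchgate_identity:
  assumes mg: "matchgate V E us" and A: "A \<subseteq> {..<length us}" and B: "B \<subseteq> {..<length us}"
    and D: "D = sym_diff A B"
  shows "(\<Sum>d\<in>D. (-1) ^ card {x \<in> D. x < d} *
           (exposed_val V E w us (sym_diff A {d}) * exposed_val V E w us (sym_diff B {d}))) = 0"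
proof -
  have pg: "plane_graph V E" and di: "distinct us" and usV: "set us \<subseteq> V"
    using mg unfolding matchgate_def by auto
  note fin = plane_graphD(1,2)[OF pg]
  have Dn: "D \<subseteq> {..<length us}" and finD: "finite D"
    using A B D finite_subset[of D "{..<length us}"] by auto
  let ?X = "\<lambda>A d. (!) us ` sym_diff A {d}"
  let ?en = "\<lambda>e. e \<inter> V"
  have inj: "us ! i = us ! j \<longleftrightarrow> i = j" if "i < length us" "j < length us" for i j
    using di that by (simp add: nth_eq_iff_index_eq)
  have XV: "?X S d \<subseteq> V" "sym_diff S {d} \<subseteq> {..<length us}" if "d \<in> D" "S \<subseteq> {..<length us}" for S d
  proof -
    show "sym_diff S {d} \<subseteq> {..<length us}" using that Dn by auto
    then show "?X S d \<subseteq> V" using usV by (meson image_subsetI lessThan_iff nth_mem subsetD)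
  qed
  have mem: "us ! i \<in> (!) us ` S \<longleftrightarrow> i \<in> S" if "i < length us" "S \<subseteq> {..<length us}" for i S
  proof
    assume "us ! i \<in> (!) us ` S"
    then obtain j where j: "j \<in> S" "us ! i = us ! j" by (rule imageE)
    then show "i \<in> S" using inj[of i j] that by auto
  qed simp
  \<comment> \<open>The nodes covered by only one of the two matchings are the same in all terms of
    the sum. Hence a swap can turn a pair belonging to one index into a pair belonging to
    another.\<close>
  have sd: "sym_diff (?X A d) (?X B d) = (!) us ` D" if d: "d \<in> D" for d
  proof -
    have diff: "(!) us ` S - (!) us ` T = (!) us ` (S - T)" if "S \<subseteq> {..<length us}" "T \<subseteq> {..<length us}" for S T
      using that inj by (auto simp: image_iff)
    have gen: "sym_diff ((!) us ` S) ((!) us ` T) = (!) us ` sym_diff S T" if "S \<subseteq> {..<length us}" "T \<subseteq> {..<length us}" for S T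
      unfolding diff[OF that] diff[OF that(2,1)] by (rule image_Un[symmetric])
    have "sym_diff (?X A d) (?X B d) = (!) us ` sym_diff (sym_diff A {d}) (sym_diff B {d})"
      by (rule gen[OF XV(2)[OF d A] XV(2)[OF d B]])
    also have "sym_diff (sym_diff A {d}) (sym_diff B {d}) = D" unfolding D by auto
    finally show ?thesis .
  qed
  define \<Omega> where "\<Omega> = (SIGMA d:D. exposed_pm V E us (sym_diff A {d}) \<times> exposed_pm V E us (sym_diff B {d}))"
  define C where "C L d = component ?en L (us ! d)" for L d
  define p where "p L d = (THE d'. d' \<in> D \<and> d' \<noteq> d \<and> us ! d' \<in> C L d)" for L d
  have finPM: "finite (exposed_pm V E us S)" for S
    by (rule finite_subset[of _ "Pow E"]) (auto simp: exposed_pm_def perfect_matchings_def fin)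
  have L: "M \<subseteq> E" "N \<subseteq> E" "finite M" "finite N" "covers_exactly ?en V M (?X A d)" "covers_exactly ?en V N (?X B d)"
    "d \<in> D"
    if "(d, M, N) \<in> \<Omega>" for d M N
  proof -
    from that have d: "d \<in> D" and MN: "M \<in> exposed_pm V E us (sym_diff A {d})" "N \<in> exposed_pm V E us (sym_diff B {d})"
      unfolding \<Omega>_def by simp_all
    show "M \<subseteq> E" "N \<subseteq> E" "covers_exactly ?en V M (?X A d)" "covers_exactly ?en V N (?X B d)" "d \<in> D"
      using MN d exposed_pm_iff[OF pg usV XV(2)[OF d A]] exposed_pm_iff[OF pg usV XV(2)[OF d B]] by simp_all
    then show "finite M" "finite N" using fin finite_subset by metis+
  qed
  have pair: "\<exists>d'. d' \<in> D \<and> d' \<noteq> x \<and> C (M \<union> N) x \<inter> (!) us ` D = {us ! x, us ! d'}"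
    if o: "(d, M, N) \<in> \<Omega>" and x: "x \<in> D" for d M N x
  proof -
    note l = L[OF o]
    obtain u where u: "u \<noteq> us ! x" "C (M \<union> N) x \<inter> (!) us ` D = {us ! x, u}"
      using alternating_component[OF l(3-6) XV(1)[OF l(7) A] XV(1)[OF l(7) B], of "us ! x"] x
      unfolding sd[OF l(7)] C_def by blast
    then obtain d' where "d' \<in> D" "u = us ! d'" by blast
    then show ?thesis using u by blast
  qed
  have p: "p (M \<union> N) x \<in> D" "p (M \<union> N) x \<noteq> x" "C (M \<union> N) x \<inter> (!) us ` D = {us ! x, us ! p (M \<union> N) x}"
    "C (M \<union> N) (p (M \<union> N) x) = C (M \<union> N) x" "p (M \<union> N) (p (M \<union> N) x) = x"
    if o: "(d, M, N) \<in> \<Omega>" and x: "x \<in> D" for d M N x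
  proof -
    have peq: "p (M \<union> N) x = d'" if "x \<in> D" "d' \<in> D" "d' \<noteq> x" "C (M \<union> N) x \<inter> (!) us ` D = {us ! x, us ! d'}" for x d'
      unfolding p_def
    proof (rule the_equality)
      show "d' \<in> D \<and> d' \<noteq> x \<and> us ! d' \<in> C (M \<union> N) x" using that by blast
      fix y assume y: "y \<in> D \<and> y \<noteq> x \<and> us ! y \<in> C (M \<union> N) x"
      then have "us ! y = us ! x \<or> us ! y = us ! d'" using that by blast
      then show "y = d'" using inj y that Dn by (meson lessThan_iff subsetD)
    qed
    obtain d' where d': "d' \<in> D" "d' \<noteq> x" "C (M \<union> N) x \<inter> (!) us ` D = {us ! x, us ! d'}"
      using pair[OF o x] by blast
    have e: "p (M \<union> N) x = d'" by (rule peq[OF x d'])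
    have "us ! d' \<in> C (M \<union> N) x" using d' by blast
    then have c: "C (M \<union> N) d' = C (M \<union> N) x" unfolding C_def by (rule component_sym)
    have "p (M \<union> N) d' = x" by (rule peq) (use d' x c in auto)
    then show "p (M \<union> N) x \<in> D" "p (M \<union> N) x \<noteq> x" "C (M \<union> N) x \<inter> (!) us ` D = {us ! x, us ! p (M \<union> N) x}"
    "C (M \<union> N) (p (M \<union> N) x) = C (M \<union> N) x" "p (M \<union> N) (p (M \<union> N) x) = x" using e c d' by auto
  qed
  have nc: "\<not> (a < b \<and> b < p (M \<union> N) a \<and> p (M \<union> N) a < p (M \<union> N) b)"
    if o: "(d, M, N) \<in> \<Omega>" and ab: "a \<in> D" "b \<in> D" for d M N a b
  proof
    assume h: "a < b \<and> b < p (M \<union> N) a \<and> p (M \<union> N) a < p (M \<union> N) b"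
    note pa = p[OF o ab(1)] and pb = p[OF o ab(2)]
    have "us ! b \<in> C (M \<union> N) a" unfolding C_def
    proof (rule components_noncrossing[OF mg])
      show "M \<union> N \<subseteq> E" using L[OF o] by blast
      show "us ! p (M \<union> N) a \<in> component ?en (M \<union> N) (us ! a)" "us ! p (M \<union> N) b \<in> component ?en (M \<union> N) (us ! b)"
        using pa(3) pb(3) unfolding C_def by blast+
      show "p (M \<union> N) b < length us" using pb(1) Dn by blast
    qed (use h in auto)
    then have "us ! b = us ! a \<or> us ! b = us ! p (M \<union> N) a" using pa(3) ab by blast
    then have "b = a \<or> b = p (M \<union> N) a" using inj ab pa(1) Dn by (meson lessThan_iff subsetD)
    then show False using h by auto
  qed
  define \<Phi> where "\<Phi> = (\<lambda>(d, M, N).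
     let K = C (M \<union> N) d in
     (p (M \<union> N) d, {e \<in> M. e \<inter> V \<inter> K = {}} \<union> {e \<in> N. e \<inter> V \<inter> K \<noteq> {}},
                   {e \<in> N. e \<inter> V \<inter> K = {}} \<union> {e \<in> M. e \<inter> V \<inter> K \<noteq> {}}))"
  define f where "f = (\<lambda>(d, M, N). (-1) ^ card {x \<in> D. x < d} * (prod w M * prod w N))"
  have \<Phi>: "f (\<Phi> y) + f y = 0 \<and> \<Phi> y \<in> \<Omega> \<and> \<Phi> (\<Phi> y) = y \<and> \<Phi> y \<noteq> y" if y: "y \<in> \<Omega>" for y
  proof -
    obtain d M N where [simp]: "y = (d, M, N)" by (cases y)
    have o: "(d, M, N) \<in> \<Omega>" using y by simp
    note l = L[OF o] and pp = p[OF o l(7)]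
    define K where "K = C (M \<union> N) d"
    define M' where "M' = {e \<in> M. e \<inter> V \<inter> K = {}} \<union> {e \<in> N. e \<inter> V \<inter> K \<noteq> {}}"
    define N' where "N' = {e \<in> N. e \<inter> V \<inter> K = {}} \<union> {e \<in> M. e \<inter> V \<inter> K \<noteq> {}}"
    let ?d = "p (M \<union> N) d"
    have \<Phi>y: "\<Phi> y = (?d, M', N')" by (simp only: \<open>y = (d, M, N)\<close> \<Phi>_def Let_def prod.case K_def M'_def N'_def)
    \<comment> \<open>The swap leaves the superposition unchanged, hence also its components and the
      pairing \<open>p\<close>; a second swap undoes the first.\<close>
    have U: "M' \<union> N' = M \<union> N" unfolding M'_def N'_def by auto
    have cl: "e \<inter> V \<subseteq> K" if "e \<in> M \<union> N" "e \<inter> V \<inter> K \<noteq> {}" for e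
      using that component_closed[of e "M \<union> N" _ ?en "us ! d"] unfolding K_def C_def by blast
    have "\<Phi> (\<Phi> y) = (d, {e \<in> M'. e \<inter> V \<inter> K = {}} \<union> {e \<in> N'. e \<inter> V \<inter> K \<noteq> {}},
        {e \<in> N'. e \<inter> V \<inter> K = {}} \<union> {e \<in> M'. e \<inter> V \<inter> K \<noteq> {}})"
    proof -
      have "C (M' \<union> N') ?d = K" "p (M' \<union> N') ?d = d" using pp(4,5) unfolding U K_def by simp_all
      then show ?thesis unfolding \<Phi>y by (simp only: \<Phi>_def Let_def prod.case)
    qed
    also have "\<dots> = (d, M, N)"
    proof -
      have "{e \<in> {e \<in> P. R e} \<union> {e \<in> Q. \<not> R e}. R e} \<union> {e \<in> {e \<in> Q. R e} \<union> {e \<in> P. \<not> R e}. \<not> R e} = P"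
        for P Q :: "complex set set" and R by auto
      from this[of M "\<lambda>e. e \<inter> V \<inter> K = {}" N] this[of N "\<lambda>e. e \<inter> V \<inter> K = {}" M]
      show ?thesis unfolding M'_def N'_def by (simp only:)
    qed
    finally have inv: "\<Phi> (\<Phi> y) = y" by simp
    have iK: "us ! i \<in> K \<longleftrightarrow> i = d \<or> i = ?d" if "i \<in> D" for i
    proof -
      have "us ! i \<in> K \<longleftrightarrow> us ! i \<in> {us ! d, us ! ?d}" using pp(3) that unfolding K_def by blast
      moreover have "i < length us" "d < length us" "?d < length us" using that l(7) pp(1) Dn by auto
      ultimately show ?thesis using inj[of i d] inj[of i ?d] by auto
    qed
    \<comment> \<open>The component contains exactly two of the nodes indexed by \<open>D\<close>,
      those of \<open>d\<close> and \<open>?d\<close>. Taking over the status of the other matching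
      toggles both, which replaces the index \<open>d\<close> by \<open>?d\<close>.\<close>
    have XK: "(?X A d - K) \<union> (?X B d \<inter> K) = ?X A ?d" "(?X B d - K) \<union> (?X A d \<inter> K) = ?X B ?d"
    proof -
      have gen: "(?X S d - K) \<union> (?X T d \<inter> K) = ?X S ?d"
        if S: "S \<subseteq> {..<length us}" and T: "T \<subseteq> {..<length us}" and DST: "D = sym_diff S T" for S T
      proof -
        have key: "us ! i \<in> (?X S d - K) \<union> (?X T d \<inter> K) \<longleftrightarrow> us ! i \<in> ?X S ?d" if i: "i < length us" for i
        proof -
          have m: "us ! i \<in> ?X S d \<longleftrightarrow> i \<in> sym_diff S {d}" "us ! i \<in> ?X T d \<longleftrightarrow> i \<in> sym_diff T {d}"
            "us ! i \<in> ?X S ?d \<longleftrightarrow> i \<in> sym_diff S {?d}"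
            using mem[OF i] XV(2) S T l(7) pp(1) by auto
          show ?thesis
          proof (cases "i \<in> D")
            case True
            then have "i \<in> S \<longleftrightarrow> i \<notin> T" using DST by blast
            then show ?thesis unfolding Un_iff[of "us ! i"] Diff_iff[of "us ! i"] Int_iff[of "us ! i"] m iK[OF True]
              using pp(2) by (cases "i = d"; cases "i = ?d") simp_all
          next
            case False
            then have "i \<in> S \<longleftrightarrow> i \<in> T" "i \<noteq> d" "i \<noteq> ?d" using DST l(7) pp(1) by auto
            then show ?thesis unfolding Un_iff[of "us ! i"] Diff_iff[of "us ! i"] Int_iff[of "us ! i"] m by auto
          qed
        qed
        have out: "z \<in> set us" if "z \<in> (!) us ` Q" "Q \<subseteq> {..<length us}" for z Q
        proof -
          from that(1) obtain i where "z = us ! i" "i \<in> Q" by (rule imageE)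
          then show ?thesis using that(2) by auto
        qed
        show ?thesis
        proof (rule set_eqI)
          fix z
          show "z \<in> (?X S d - K) \<union> (?X T d \<inter> K) \<longleftrightarrow> z \<in> ?X S ?d"
          proof (cases "z \<in> set us")
            case True
            then obtain i where "i < length us" "z = us ! i" unfolding in_set_conv_nth by auto
            then show ?thesis using key[of i] by (simp only:)
          next
            case False
            then have nin: "z \<notin> (!) us ` Q" if "Q \<subseteq> {..<length us}" for Q
              using out[OF _ that] by blast
            show ?thesis
              unfolding Un_iff[of z] Diff_iff[of z] Int_iff[of z]
              using nin[OF XV(2)[OF l(7) S]] nin[OF XV(2)[OF l(7) T]] nin[OF XV(2)[OF pp(1) S]] by (simp only: simp_thms)
          qed
        qed
      qed
      show "(?X A d - K) \<union> (?X B d \<inter> K) = ?X A ?d" using gen[OF A B D] .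
      show "(?X B d - K) \<union> (?X A d \<inter> K) = ?X B ?d" using gen[OF B A] D by auto
    qed
    have "covers_exactly ?en V M' (?X A ?d)"
      using covers_exactly_swap[OF l(5,6) cl] unfolding M'_def XK by blast
    moreover have "covers_exactly ?en V N' (?X B ?d)"
      using covers_exactly_swap[OF l(6,5), of K] cl unfolding N'_def XK by (simp add: Un_commute)
    moreover have "M' \<subseteq> E" "N' \<subseteq> E" using l M'_def N'_def by auto
    ultimately have "\<Phi> y \<in> \<Omega>"
      unfolding \<Phi>y \<Omega>_def using exposed_pm_iff[OF pg usV XV(2)] A B pp(1) by auto
    moreover have "f (\<Phi> y) + f y = 0"
    proof -
      have "prod w M' * prod w N' = prod w M * prod w N"
        unfolding M'_def N'_def using prod_swap_sets[OF l(3,4), of w "\<lambda>e. e \<inter> V \<inter> K \<noteq> {}"] by simp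
      moreover have "(-1::complex) ^ card {x \<in> D. x < ?d} = - ((-1) ^ card {x \<in> D. x < d})"
        by (rule noncrossing_pairing_parity[OF finD]) (use p[OF o] nc[OF o] l(7) in auto)
      ultimately show ?thesis unfolding \<Phi>y by (simp add: f_def)
    qed
    moreover have "\<Phi> y \<noteq> y" using \<Phi>y pp(2) by simp
    ultimately show ?thesis using inv by blast
  qed
  have "(\<Sum>y\<in>\<Omega>. f y) = 0"
    by (rule sum_involution_eq_0[where h = \<Phi>]) (use \<Phi> in auto)
  also have "(\<Sum>y\<in>\<Omega>. f y) = (\<Sum>d\<in>D. \<Sum>(M,N)\<in>exposed_pm V E us (sym_diff A {d}) \<times> exposed_pm V E us (sym_diff B {d}).
      (-1) ^ card {x \<in> D. x < d} * (prod w M * prod w N))"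
    unfolding \<Omega>_def f_def by (subst sum.Sigma[symmetric]) (use finD finPM in \<open>auto simp: split_beta\<close>)
  also have "\<dots> = (\<Sum>d\<in>D. (-1) ^ card {x \<in> D. x < d} *
           (exposed_val V E w us (sym_diff A {d}) * exposed_val V E w us (sym_diff B {d})))"
    unfolding exposed_val_eq sum_product unfolding sum.cartesian_product
    by (simp add: split_beta sum_distrib_left)
  finally show ?thesis .
qed

section \<open>Permutable matchgate signatures\<close>

definition set_val :: "signature \<Rightarrow> nat set \<Rightarrow> complex" where
  "set_val F A = sigval F (map (\<lambda>i. i \<in> A) [0..<arity F])"

lemma sigval_set_val:
  assumes "length x = arity F" shows "sigval F x = set_val F {i. i < arity F \<and> x ! i}"
proof -
  have "map (\<lambda>i. i \<in> {i. i < arity F \<and> x ! i}) [0..<arity F] = x"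
    using assms by (intro nth_equalityI) auto
  then show ?thesis unfolding set_val_def by simp
qed

lemma matchgate_sig_exposed:
  assumes "f \<in> matchgate_sigs"
  shows "\<exists>V E w us. matchgate V E us \<and> arity f = length us \<and>
    (\<forall>A. A \<subseteq> {..<arity f} \<longrightarrow> set_val f A = exposed_val V E w us A)"
proof -
  obtain V E w us where m: "matchgate V E us" "arity f = length us"
    "\<And>\<alpha>. length \<alpha> = arity f \<Longrightarrow> sigval f \<alpha> = matchgate_val V E w us \<alpha>"
    using assms unfolding matchgate_sigs_def by auto
  have "set_val f A = exposed_val V E w us A" if "A \<subseteq> {..<arity f}" for A
  proof -
    let ?x = "map (\<lambda>i. i \<in> A) [0..<arity f]"
    have "set_val f A = matchgate_val V E w us ?x" using m(3)[of ?x] by (simp add: set_val_def)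
    also have "\<dots> = exposed_val V E w us {i. i < length us \<and> ?x ! i}"
      using m(2) by (intro matchgate_val_exposed) simp
    also have "{i. i < length us \<and> ?x ! i} = A" using that m(2) by auto
    finally show ?thesis .
  qed
  then show ?thesis using m(1,2) by metis
qed

lemma matchgate_parity:
  assumes "f \<in> matchgate_sigs" "A \<subseteq> {..<arity f}" "B \<subseteq> {..<arity f}" "set_val f A \<noteq> 0" "set_val f B \<noteq> 0"
  shows "even (card A + card B)"
proof -
  obtain V E w us where m: "matchgate V E us" "arity f = length us"
    "\<And>A. A \<subseteq> {..<arity f} \<Longrightarrow> set_val f A = exposed_val V E w us A"
    using matchgate_sig_exposed[OF assms(1)] by metis
  have pg: "plane_graph V E" "distinct us" "set us \<subseteq> V" using m(1) unfolding matchgate_def by auto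
  have "even (card V + card A)" "even (card V + card B)"
    using exposed_val_parity[OF pg(1,3) _ pg(2)] m assms by metis+
  then show ?thesis by auto
qed

lemma permute_sig_transpose:
  assumes "p < arity F" "q < arity F"
  shows "set_val (permute_sig (Transposition.transpose p q) F) A = set_val F (Transposition.transpose p q ` A)"
proof -
  let ?\<pi> = "Transposition.transpose p q"
  have pe: "?\<pi> permutes {..<arity F}" using assms by (simp add: permutes_swap_id)
  have "permute_list ?\<pi> (map (\<lambda>i. i \<in> A) [0..<arity F]) = map (\<lambda>i. i \<in> ?\<pi> ` A) [0..<arity F]"
  proof (rule nth_equalityI)
    fix i assume "i < length (permute_list ?\<pi> (map (\<lambda>i. i \<in> A) [0..<arity F]))"
    then have i: "i < arity F" by simp
    then have "?\<pi> i < arity F" using permutes_in_image[OF pe, of i] by simp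
    moreover have "?\<pi> i \<in> A \<longleftrightarrow> i \<in> ?\<pi> ` A"
      by (metis imageE image_eqI Transposition.transpose_involutory)
    ultimately show "permute_list ?\<pi> (map (\<lambda>i. i \<in> A) [0..<arity F]) ! i = map (\<lambda>i. i \<in> ?\<pi> ` A) [0..<arity F] ! i"
      using i by (simp add: permute_list_def)
  qed simp
  then show ?thesis unfolding set_val_def permute_sig_def by simp
qed

text \<open>Transposing two variables whose positions in \<open>D\<close> have opposite parity changes the signs of
  exactly two terms of the matchgate identity, so these two terms agree.\<close>

lemma permutable_exchange_aux:
  assumes F: "F \<in> permutable_matchgate_sigs" and A: "A \<subseteq> {..<arity F}" and B: "B \<subseteq> {..<arity F}"
    and D: "D = sym_diff A B" and p: "p \<in> D" and q: "q \<in> D"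
  defines "T \<equiv> \<lambda>d. set_val F (sym_diff A {d}) * set_val F (sym_diff B {d})"
  shows "T p = T q"
proof -
  let ?s = "\<lambda>d. (-1::complex) ^ card {x \<in> D. x < d}"
  have Dn: "D \<subseteq> {..<arity F}" using A B D by auto
  have fD: "finite D" using Dn finite_subset by blast
  have id: "(\<Sum>d\<in>sym_diff A B. (-1) ^ card {x \<in> sym_diff A B. x < d} * (set_val f (sym_diff A {d}) * set_val f (sym_diff B {d}))) = 0"
    if f: "f \<in> matchgate_sigs" and A: "A \<subseteq> {..<arity f}" and B: "B \<subseteq> {..<arity f}" for f A B
  proof -
    obtain V E w us where m: "matchgate V E us" "arity f = length us"
      "\<And>A. A \<subseteq> {..<arity f} \<Longrightarrow> set_val f A = exposed_val V E w us A"
      using matchgate_sig_exposed[OF f] by metis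
    have "(\<Sum>d\<in>sym_diff A B. (-1) ^ card {x \<in> sym_diff A B. x < d} * (set_val f (sym_diff A {d}) * set_val f (sym_diff B {d})))
      = (\<Sum>d\<in>sym_diff A B. (-1) ^ card {x \<in> sym_diff A B. x < d} * (exposed_val V E w us (sym_diff A {d}) * exposed_val V E w us (sym_diff B {d})))"
    proof (rule sum.cong[OF refl])
      fix d assume "d \<in> sym_diff A B"
      then have "sym_diff A {d} \<subseteq> {..<arity f}" "sym_diff B {d} \<subseteq> {..<arity f}" using A B by auto
      then show "(-1) ^ card {x \<in> sym_diff A B. x < d} * (set_val f (sym_diff A {d}) * set_val f (sym_diff B {d})) =
        (-1) ^ card {x \<in> sym_diff A B. x < d} * (exposed_val V E w us (sym_diff A {d}) * exposed_val V E w us (sym_diff B {d}))"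
        using m(3) by simp
    qed
    also have "\<dots> = 0" using matchgate_identity[OF m(1), of A B] A B m(2) by simp
    finally show ?thesis .
  qed
  have perm: "permute_sig \<pi> F \<in> matchgate_sigs" if "\<pi> permutes {..<arity F}" for \<pi>
    using F that unfolding permutable_matchgate_sigs_def by blast
  have "permute_sig id F = F" unfolding permute_sig_def by simp
  then have FM: "F \<in> matchgate_sigs" using perm[of id] permutes_id by metis
  have base: "(\<Sum>d\<in>D. ?s d * T d) = 0" using id[OF FM A B] unfolding D T_def .
  have opp: "T p = T q" if pq: "p \<in> D" "q \<in> D" "?s p \<noteq> ?s q" for p q
  proof -
    let ?\<pi> = "Transposition.transpose p q"
    have lt: "p < arity F" "q < arity F" using pq Dn by auto
    have pe: "?\<pi> permutes {..<arity F}" using lt by (simp add: permutes_swap_id)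
    have inj: "inj ?\<pi>" by (simp add: inj_transpose)
    have isd: "?\<pi> ` sym_diff S T = sym_diff (?\<pi> ` S) (?\<pi> ` T)" for S T
      by (simp add: image_Un image_set_diff[OF inj])
    have inv: "?\<pi> ` ?\<pi> ` S = S" for S by (simp add: image_comp)
    have \<pi>D: "?\<pi> ` D = D" using pq by (simp add: transpose_image_eq)
    have sub: "?\<pi> ` A \<subseteq> {..<arity F}" "?\<pi> ` B \<subseteq> {..<arity F}"
      using A B permutes_image[OF pe] by blast+
    have sd: "sym_diff (?\<pi> ` A) (?\<pi> ` B) = D" using isd[of A B] \<pi>D D by simp
    have "(\<Sum>d\<in>D. ?s d * T (?\<pi> d)) = 0"
    proof -
      have ar: "arity (permute_sig ?\<pi> F) = arity F" by (simp add: permute_sig_def)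
      have v: "set_val (permute_sig ?\<pi> F) (sym_diff (?\<pi> ` S) {d}) = set_val F (sym_diff S {?\<pi> d})" for S d
        unfolding permute_sig_transpose[OF lt] isd inv by simp
      show ?thesis
        using id[OF perm[OF pe], unfolded ar, OF sub] unfolding sd v T_def .
    qed
    then have "(\<Sum>d\<in>D. ?s d * (T d - T (?\<pi> d))) = 0" using base by (simp add: right_diff_distrib sum_subtractf)
    also have "(\<Sum>d\<in>D. ?s d * (T d - T (?\<pi> d))) = (\<Sum>d\<in>{p, q}. ?s d * (T d - T (?\<pi> d)))"
    proof (rule sum.mono_neutral_right[OF fD])
      show "\<forall>i\<in>D - {p, q}. ?s i * (T i - T (?\<pi> i)) = 0" by (auto simp: Transposition.transpose_def)
    qed (use pq in auto)
    also have "\<dots> = (?s p - ?s q) * (T p - T q)"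
    proof -
      have "p \<noteq> q" using pq by auto
      then show ?thesis by (simp add: algebra_simps)
    qed
    finally show ?thesis using pq by simp
  qed
  have main: "T p = T q" if pq: "p \<in> D" "q \<in> D" "p < q" for p q
  proof (cases "?s p = ?s q")
    case False then show ?thesis using opp pq by blast
  next
    case True
    \<comment> \<open>With equal signs at \<open>p\<close> and \<open>q\<close>, the successor of
      \<open>p\<close> in \<open>D\<close> has the opposite sign, so both terms agree with the term
      at \<open>r\<close>.\<close>
    define r where "r = Min {x \<in> D. p < x}"
    have r: "r \<in> D" "p < r" "\<And>x. x \<in> D \<Longrightarrow> p < x \<Longrightarrow> r \<le> x"
    proof -
      have fin: "finite {x \<in> D. p < x}" "{x \<in> D. p < x} \<noteq> {}" using fD pq by auto
      have "r \<in> {x \<in> D. p < x}" unfolding r_def by (rule Min_in[OF fin])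
      then show "r \<in> D" "p < r" by auto
      show "\<And>x. x \<in> D \<Longrightarrow> p < x \<Longrightarrow> r \<le> x" unfolding r_def using fin by auto
    qed
    have "{x \<in> D. x < r} = insert p {x \<in> D. x < p}"
    proof (rule set_eqI)
      fix x
      have "x = p \<or> x < p" if "x \<in> D" "x < r" using r(3)[OF that(1)] that(2) by linarith
      moreover have "x < r" if "x = p \<or> x < p" using r(2) that by linarith
      ultimately show "x \<in> {x \<in> D. x < r} \<longleftrightarrow> x \<in> insert p {x \<in> D. x < p}" using pq(1)
        unfolding mem_Collect_eq insert_iff by metis
    qed
    then have s: "?s r = - ?s p" using fD by simp
    have "- ?s p \<noteq> ?s p" unfolding neg_equal_zero by simp
    then have "?s r \<noteq> ?s p" "?s r \<noteq> ?s q" unfolding s True[symmetric] by assumption+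
    then show ?thesis using opp[of r p] opp[of r q] r(1) pq by metis
  qed
  show ?thesis using main[OF p q] main[OF q p] by (metis nat_neq_iff)
qed

text \<open>The single-index identity is taken at \<open>A\<close> and \<open>B\<close> with
  \<open>i\<close> toggled. Toggling \<open>i\<close> once more restores \<open>A\<close> and
  \<open>B\<close>, so the term of \<open>i\<close> is the left-hand side and the term of
  \<open>j\<close> the right-hand side.\<close>

lemma permutable_exchange:
  assumes F: "F \<in> permutable_matchgate_sigs" and A: "A \<subseteq> {..<arity F}" and B: "B \<subseteq> {..<arity F}"
    and ij: "i \<in> sym_diff A B" "j \<in> sym_diff A B" "i \<noteq> j"
  shows "set_val F A * set_val F B = set_val F (sym_diff A {i, j}) * set_val F (sym_diff B {i, j})"
proof -
  let ?A = "sym_diff A {i}" and ?B = "sym_diff B {i}"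
  have i: "i < arity F" using A B ij by auto
  have sd: "sym_diff ?A ?B = sym_diff A B" by auto
  have "set_val F (sym_diff ?A {i}) * set_val F (sym_diff ?B {i}) = set_val F (sym_diff ?A {j}) * set_val F (sym_diff ?B {j})"
    by (rule permutable_exchange_aux[OF F _ _ sd[symmetric] ij(1,2)]) (use A B i in auto)
  moreover have "sym_diff (sym_diff S {i}) {i} = S" "sym_diff (sym_diff S {i}) {j} = sym_diff S {i, j}" for S
    using ij by auto
  ultimately show ?thesis by simp
qed

section \<open>Affine signatures\<close>

lemma fourth_root_of_unity:
  fixes b :: complex assumes "b ^ 4 = 1"
  shows "\<exists>k\<in>{0,1,2,3}. b = \<i> ^ k"
proof -
  have "(b - 1) * (b + 1) * (b - \<i>) * (b + \<i>) = b ^ 4 - 1"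
    by (simp add: algebra_simps power4_eq_xxxx)
  then have "(b - 1) * (b + 1) * (b - \<i>) * (b + \<i>) = 0" using assms by simp
  then have "b = 1 \<or> b = - 1 \<or> b = \<i> \<or> b = - \<i>"
    by (simp add: eq_neg_iff_add_eq_0 disj_assoc)
  moreover have "\<i> ^ 3 = - \<i>" by (simp add: power3_eq_cube)
  ultimately show ?thesis by auto
qed

lemma even_card_sym_diff:
  assumes "finite A" "finite B"
  shows "even (card (sym_diff A B)) \<longleftrightarrow> even (card A + card B)"
proof -
  have "card (sym_diff A B) = card (A - B) + card (B - A)" by (intro card_Un_disjoint) (use assms in auto)
  moreover have "card A = card (A - B) + card (A \<inter> B)"
    using assms by (metis card_Diff_subset_Int card_mono finite_Int inf_le1 le_add_diff_inverse2)
  moreover have "card B = card (B - A) + card (A \<inter> B)"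
    using assms by (metis card_Diff_subset_Int card_mono finite_Int inf_commute inf_le1 le_add_diff_inverse2)
  ultimately have "card A + card B = card (sym_diff A B) + 2 * card (A \<inter> B)" by linarith
  then show ?thesis by simp
qed

text \<open>The support is cut out by linear equations: the variables outside \<open>S\<close> are
  frozen as in \<open>X\<close>, and those in \<open>S\<close> have a prescribed parity. The shift
  by \<open>X\<close> is absorbed into the leading constant and the exponents.\<close>

lemma affine_sigI:
  assumes n: "arity F \<ge> 1" and S: "S \<subseteq> {..<arity F}" and X: "X \<subseteq> {..<arity F}" and k: "\<And>i. k i \<in> {0,1,2,3::nat}"
    and F: "\<And>A. A \<subseteq> {..<arity F} \<Longrightarrow> set_val F A =
       l * of_bool (sym_diff A X \<subseteq> S \<and> even (card (sym_diff A X))) * (\<Prod>i\<in>sym_diff A X. \<i> ^ k i)"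
  shows "F \<in> affine_sigs"
proof -
  define n where "n = arity F"
  \<comment> \<open>A variable of \<open>X\<close> contributes \<open>\<i> ^ k i\<close> when its
    bit is 0. This factor is moved into the constant, so setting the bit to 1 has to cancel it,
    which takes the exponent -k, that is, 3k modulo 4.\<close>
  define a where "a i = (if i \<in> S then (if i \<in> X then (3 * k i) mod 4 else k i) else 0)" for i
  define m where "m = Suc n"
  \<comment> \<open>Rows below \<open>n\<close> freeze the variables outside \<open>S\<close>; row
    \<open>n\<close> is the parity equation on \<open>S\<close>.\<close>
  define M where "M r j = (if r < n then of_bool (r = j \<and> j \<notin> S) else of_bool (j \<in> S) :: bit)" for r j :: nat
  define c where "c r = (if r < n then of_bool (r \<notin> S \<and> r \<in> X) else of_bool (odd (card (X \<inter> S))) :: bit)" for r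
  have a_range: "a i \<in> {0,1,2,3}" for i
  proof -
    have "k i = 0 \<or> k i = 1 \<or> k i = 2 \<or> k i = 3" using k[of i] by simp
    then show ?thesis unfolding a_def by (elim disjE) simp_all
  qed
  have pw: "\<i> ^ (3 * q mod 4) = \<i> ^ (3 * q)" for q
  proof -
    have "\<i> ^ (3 * q) = \<i> ^ (4 * (3 * q div 4) + 3 * q mod 4)" by simp
    also have "\<dots> = (\<i> ^ 4) ^ (3 * q div 4) * \<i> ^ (3 * q mod 4)" by (simp only: power_add power_mult)
    finally show ?thesis by (simp add: power4_eq_xxxx)
  qed
  have i4: "\<i> ^ q * \<i> ^ (3 * q) = 1" for q
  proof -
    have "\<i> ^ q * \<i> ^ (3 * q) = (\<i> ^ 4) ^ q" by (simp flip: power_add power_mult)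
    then show ?thesis by (simp add: power4_eq_xxxx)
  qed
  have val: "sigval F x = (l * (\<Prod>i\<in>X \<inter> S. \<i> ^ k i)) * of_bool (\<forall>r<m. (\<Sum>j<arity F. M r j * of_bool (x ! j)) = c r)
                 * \<i> ^ ((\<Sum>i<arity F. a i * (of_bool (x ! i))\<^sup>2)
                        + 2 * (\<Sum>j<arity F. \<Sum>i<j. 0 * of_bool (x ! i) * of_bool (x ! j)))"
    if lx: "length x = arity F" for x
  proof -
    define A where "A = {i. i < n \<and> x ! i}"
    have An: "A \<subseteq> {..<n}" by (auto simp: A_def)
    have fin: "finite A" "finite X" "finite S" using An X S finite_subset n_def by blast+
    have xA: "x ! i \<longleftrightarrow> i \<in> A" if "i < n" for i using that by (simp add: A_def)
    let ?Z = "sym_diff A X"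
    have r1: "(\<Sum>j<n. M r j * of_bool (x ! j)) = (of_bool (r \<notin> S \<and> r \<in> A) :: bit)" if "r < n" for r
    proof -
      have "(\<Sum>j<n. M r j * of_bool (x ! j)) = (\<Sum>j<n. if j = r then of_bool (r \<notin> S \<and> r \<in> A) else (0::bit))"
        by (rule sum.cong[OF refl]) (use that xA in \<open>auto simp: M_def\<close>)
      then show ?thesis using that by simp
    qed
    have bit_of_nat: "(of_nat q :: bit) = of_bool (odd q)" for q by (induction q) auto
    have r2: "(\<Sum>j<n. M n j * of_bool (x ! j)) = (of_bool (odd (card (A \<inter> S))) :: bit)"
    proof -
      have "(\<Sum>j<n. M n j * of_bool (x ! j)) = (\<Sum>j<n. if j \<in> A \<inter> S then 1 else (0::bit))"
        by (rule sum.cong[OF refl]) (use xA in \<open>auto simp: M_def\<close>)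
      also have "\<dots> = (\<Sum>j\<in>{..<n} \<inter> (A \<inter> S). 1)" by (rule sum.inter_restrict[symmetric]) simp
      also have "{..<n} \<inter> (A \<inter> S) = A \<inter> S" using An by auto
      finally show ?thesis by (simp add: bit_of_nat)
    qed
    have "(\<forall>r<m. (\<Sum>j<n. M r j * of_bool (x ! j)) = c r) \<longleftrightarrow>
       (\<forall>r<n. (\<Sum>j<n. M r j * of_bool (x ! j)) = c r) \<and> (\<Sum>j<n. M n j * of_bool (x ! j)) = c n"
      unfolding m_def by (auto simp: less_Suc_eq)
    also have "(\<forall>r<n. (\<Sum>j<n. M r j * of_bool (x ! j)) = c r) \<longleftrightarrow> (\<forall>r<n. (r \<notin> S \<and> r \<in> A) = (r \<notin> S \<and> r \<in> X))"
      using r1 by (auto simp: c_def)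
    also have "\<dots> \<longleftrightarrow> ?Z \<subseteq> S" using An X n_def by auto
    also have "(\<Sum>j<n. M n j * of_bool (x ! j)) = c n \<longleftrightarrow> even (card (A \<inter> S) + card (X \<inter> S))"
      unfolding r2 by (auto simp: c_def)
    also have "\<dots> \<longleftrightarrow> even (card (sym_diff (A \<inter> S) (X \<inter> S)))"
      using even_card_sym_diff[of "A \<inter> S" "X \<inter> S"] fin by simp
    also have "?Z \<subseteq> S \<and> even (card (sym_diff (A \<inter> S) (X \<inter> S))) \<longleftrightarrow> ?Z \<subseteq> S \<and> even (card ?Z)"
    proof -
      have "sym_diff (A \<inter> S) (X \<inter> S) = ?Z" if "?Z \<subseteq> S" using that by auto
      then show ?thesis by auto
    qed
    finally have supp: "(\<forall>r<m. (\<Sum>j<n. M r j * of_bool (x ! j)) = c r) \<longleftrightarrow> ?Z \<subseteq> S \<and> even (card ?Z)" .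
    have vals: "(\<Prod>i\<in>?Z. \<i> ^ k i) = (\<Prod>i\<in>X \<inter> S. \<i> ^ k i) * \<i> ^ (\<Sum>i<n. a i * (of_bool (x ! i))\<^sup>2)" if Z: "?Z \<subseteq> S"
    proof -
      have restr: "(\<Prod>i\<in>Y. \<i> ^ k i) = (\<Prod>i<n. if i \<in> Y then \<i> ^ k i else 1)" if "Y \<subseteq> {..<n}" for Y
        using that by (simp add: prod.inter_restrict[symmetric] Int_absorb1)
      have "(\<Prod>i\<in>X \<inter> S. \<i> ^ k i) * \<i> ^ (\<Sum>i<n. a i * (of_bool (x ! i))\<^sup>2) =
        (\<Prod>i<n. (if i \<in> X \<inter> S then \<i> ^ k i else 1) * \<i> ^ (a i * (of_bool (x ! i))\<^sup>2))"
        using X n_def by (subst restr) (auto simp: power_sum prod.distrib)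
      also have "\<dots> = (\<Prod>i<n. if i \<in> ?Z then \<i> ^ k i else 1)"
      proof (rule prod.cong[OF refl])
        fix i assume "i \<in> {..<n}"
        then show "(if i \<in> X \<inter> S then \<i> ^ k i else 1) * \<i> ^ (a i * (of_bool (x ! i))\<^sup>2) = (if i \<in> ?Z then \<i> ^ k i else 1)"
          using Z xA[of i] by (cases "i \<in> A"; cases "i \<in> X"; cases "i \<in> S") (auto simp: a_def pw i4)
      qed
      also have "\<dots> = (\<Prod>i\<in>?Z. \<i> ^ k i)" using An X n_def by (subst restr) auto
      finally show ?thesis by simp
    qed
    have "sigval F x = set_val F A" using sigval_set_val[OF lx] by (simp add: A_def n_def)
    also have "\<dots> = l * of_bool (?Z \<subseteq> S \<and> even (card ?Z)) * (\<Prod>i\<in>?Z. \<i> ^ k i)"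
      by (rule F) (use An n_def in simp)
    also have "\<dots> = (l * (\<Prod>i\<in>X \<inter> S. \<i> ^ k i)) * of_bool (?Z \<subseteq> S \<and> even (card ?Z)) * \<i> ^ (\<Sum>i<n. a i * (of_bool (x ! i))\<^sup>2)"
      using vals by simp
    finally show ?thesis using supp by (simp add: n_def)
  qed
  show ?thesis
    unfolding affine_sigs_def mem_Collect_eq
    apply (intro conjI n)
    apply (rule exI[of _ "l * (\<Prod>i\<in>X \<inter> S. \<i> ^ k i)"], rule exI[of _ m], rule exI[of _ M], rule exI[of _ c],
        rule exI[of _ a], rule exI[of _ "\<lambda>i j. 0"])
    using a_range val by simp
qed

text \<open>If there is no witness, then the pairs with \<open>a i j \<noteq> 0\<close> form a complete graph on some set \<open>S\<close>, and
  there \<open>a i j = b i * b j\<close> with fourth roots of unity \<open>b i\<close>.\<close>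

lemma nonaffine_witness:
  assumes n1: "arity F \<ge> 1" and na: "F \<notin> affine_sigs"
    and exch: "\<And>A B i j. A \<subseteq> {..<arity F} \<Longrightarrow> B \<subseteq> {..<arity F} \<Longrightarrow> i \<in> sym_diff A B \<Longrightarrow> j \<in> sym_diff A B \<Longrightarrow> i \<noteq> j \<Longrightarrow>
      set_val F A * set_val F B = set_val F (sym_diff A {i, j}) * set_val F (sym_diff B {i, j})"
    and par: "\<And>A B. A \<subseteq> {..<arity F} \<Longrightarrow> B \<subseteq> {..<arity F} \<Longrightarrow> set_val F A \<noteq> 0 \<Longrightarrow> set_val F B \<noteq> 0 \<Longrightarrow> even (card A + card B)"
    and X: "X \<subseteq> {..<arity F}" "set_val F X \<noteq> 0"
  defines "a \<equiv> \<lambda>i j. set_val F (sym_diff X {i, j}) / set_val F X"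
  obtains (star) i j k where "{i, j, k} \<subseteq> {..<arity F}" "i \<noteq> j" "i \<noteq> k" "j \<noteq> k" "a i j \<noteq> 0" "a i k \<noteq> 0" "a j k = 0"
    | (pair) i j where "{i, j} \<subseteq> {..<arity F}" "i \<noteq> j" "a i j \<noteq> 0" "a i j ^ 4 \<noteq> 1"
    | (triple) i j k where "{i, j, k} \<subseteq> {..<arity F}" "i \<noteq> j" "i \<noteq> k" "j \<noteq> k" "a i j \<noteq> 0" "a i k \<noteq> 0" "a j k \<noteq> 0"
        "(a i j * a i k / a j k)\<^sup>2 \<noteq> 1"
proof (rule ccontr)
  assume "\<not> thesis"
  note neg = this star pair triple
  let ?N = "{..<arity F}"
  have asym: "a i j = a j i" for i j by (simp add: a_def insert_commute)
  have st: "a j k \<noteq> 0" if "i \<in> ?N" "j \<in> ?N" "k \<in> ?N" "i \<noteq> j" "i \<noteq> k" "j \<noteq> k" "a i j \<noteq> 0" "a i k \<noteq> 0" for i j k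
    using neg(1) star[of i j k] that by auto
  have pr: "a i j ^ 4 = 1" if "i \<in> ?N" "j \<in> ?N" "i \<noteq> j" "a i j \<noteq> 0" for i j
    using neg(1) pair[of i j] that by auto
  have tr: "(a i j * a i k / a j k)\<^sup>2 = 1"
    if "i \<in> ?N" "j \<in> ?N" "k \<in> ?N" "i \<noteq> j" "i \<noteq> k" "j \<noteq> k" "a i j \<noteq> 0" "a i k \<noteq> 0" "a j k \<noteq> 0" for i j k
    using neg(1) triple[of i j k] that by auto
  define h where "h Z = set_val F (sym_diff X Z) / set_val F X" for Z
  have hpair: "h {i, j} = a i j" for i j by (simp add: h_def a_def)
  have h0: "h {} = 1" using X by (simp add: h_def)
  \<comment> \<open>The exchange identity for \<open>X\<close> and its translate by
    \<open>Z\<close>, whose symmetric difference is \<open>Z\<close>. It reduces all values to those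
    of pairs.\<close>
  have hrec: "h Z = a i j * h (Z - {i, j})" if "Z \<subseteq> ?N" "i \<in> Z" "j \<in> Z" "i \<noteq> j" for Z i j
  proof -
    have e1: "sym_diff X (sym_diff X Z) = Z" by auto
    have e2: "sym_diff (sym_diff X Z) {i, j} = sym_diff X (Z - {i, j})" using that by auto
    have "set_val F X * set_val F (sym_diff X Z) = set_val F (sym_diff X {i, j}) * set_val F (sym_diff X (Z - {i, j}))"
      using exch[of X "sym_diff X Z" i j] that X(1) unfolding e1 e2 by blast
    then show ?thesis using X(2) by (simp add: h_def a_def field_simps)
  qed
  have hodd: "h Z = 0" if "Z \<subseteq> ?N" "odd (card Z)" for Z
  proof (rule ccontr)
    assume "h Z \<noteq> 0"
    then have "set_val F (sym_diff X Z) \<noteq> 0" by (auto simp: h_def)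
    moreover have "sym_diff X Z \<subseteq> ?N" using X that by auto
    ultimately have "even (card X + card (sym_diff X Z))" using par[of X "sym_diff X Z"] X by blast
    moreover have "finite X" "finite Z" using X that finite_subset by blast+
    ultimately show False using even_card_sym_diff[of X Z] that by auto
  qed
  have quad: "a i j * a k l = a i k * a j l"
    if "{i, j, k, l} \<subseteq> ?N" "distinct [i, j, k, l]" for i j k l
  proof -
    have e: "{i, j, k, l} - {i, j} = {k, l}" "{i, j, k, l} - {i, k} = {j, l}" using that(2) by auto
    show ?thesis using hrec[of "{i,j,k,l}" i j] hrec[of "{i,j,k,l}" i k] that unfolding e hpair by simp
  qed
  have "\<exists>S b. S \<subseteq> ?N \<and> (\<forall>i\<in>S. b i ^ 4 = 1) \<and>
     (\<forall>i\<in>?N. \<forall>j\<in>?N. i \<noteq> j \<longrightarrow> a i j = (if i \<in> S \<and> j \<in> S then b i * b j else 0))"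
  proof (cases "\<exists>s\<in>?N. \<exists>t\<in>?N. s \<noteq> t \<and> a s t \<noteq> 0")
    case False
    then show ?thesis by (intro exI[of _ "{}"]) auto
  next
    case True
    then obtain s t where s: "s \<in> ?N" "t \<in> ?N" "s \<noteq> t" "a s t \<noteq> 0" by blast
    \<comment> \<open>In the graph of nonzero pairs, two neighbours of a vertex are adjacent, since
      there is no star witness. So \<open>S\<close> is the component of \<open>s\<close> and a
      clique; \<open>quad\<close> rules out an edge disjoint from it.\<close>
    define S where "S = insert s {j \<in> ?N. j \<noteq> s \<and> a s j \<noteq> 0}"
    have SN: "S \<subseteq> ?N" using s by (auto simp: S_def)
    have Snz: "a i j \<noteq> 0" if "i \<in> S" "j \<in> S" "i \<noteq> j" for i j
      using that st[of s i j] s asym[of i j] asym[of i s] unfolding S_def by (cases "i = s"; cases "j = s") auto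
    have Sz: "i \<in> S \<and> j \<in> S" if ij: "i \<in> ?N" "j \<in> ?N" "i \<noteq> j" "a i j \<noteq> 0" for i j
    proof -
      have one: "j \<in> S" if "i \<in> ?N" "j \<in> ?N" "i \<noteq> j" "a i j \<noteq> 0" "i \<in> S" for i j
      proof (cases "i = s \<or> j = s")
        case True then show ?thesis using that by (auto simp: S_def)
      next
        case False
        then have "a i s \<noteq> 0" using that Snz[of i s] by (auto simp: S_def)
        then have "a s j \<noteq> 0" using st[of i s j] that False s by auto
        then show ?thesis using that False by (auto simp: S_def)
      qed
      have "i \<in> S \<or> j \<in> S"
      proof (rule ccontr)
        assume no: "\<not> (i \<in> S \<or> j \<in> S)"
        have "s \<in> S" "t \<in> S" using s by (auto simp: S_def)
        then have "distinct [s, t, i, j]" using no ij s by auto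
        then have "a s t * a i j = a s i * a t j" using quad[of s t i j] ij s by simp
        then have "a s i \<noteq> 0" using s ij by auto
        then show False using no ij by (auto simp: S_def)
      qed
      then show ?thesis using one[of i j] one[of j i] ij asym[of i j] by auto
    qed
    define T where "T = S - {s}"
    \<comment> \<open>If \<open>a i j = b i * b j\<close>, this ratio is the same for all pairs,
      namely the inverse square of \<open>b s\<close>. Its constancy on \<open>T\<close> follows
      from \<open>quad\<close>, and the absence of a triple witness makes it a square root of
      1.\<close>
    define e where "e i j = a i j / (a s i * a s j)" for i j
    have TN: "i \<in> ?N" "i \<noteq> s" "a s i \<noteq> 0" if "i \<in> T" for i using that SN by (auto simp: T_def S_def)
    have esym: "e i j = e j i" for i j by (simp add: e_def asym[of i j] mult.commute)
    have e_shift: "e i j = e i k" if "i \<in> T" "j \<in> T" "k \<in> T" "i \<noteq> j" "i \<noteq> k" for i j k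
    proof (cases "j = k")
      case False
      have "a j s * a i k = a j i * a s k"
        using quad[of j s i k] TN(1,2)[OF that(1)] TN(1,2)[OF that(2)] TN(1,2)[OF that(3)] that False s by simp
      then show ?thesis using TN(3)[OF that(1)] TN(3)[OF that(2)] TN(3)[OF that(3)]
        by (simp add: e_def field_simps asym[of j])
    qed simp
    have e2: "(e i j)\<^sup>2 = 1" if "i \<in> T" "j \<in> T" "i \<noteq> j" for i j
    proof -
      have nz: "a i j \<noteq> 0" using that Snz[of i j] by (auto simp: T_def)
      have "(a s i * a s j / a i j)\<^sup>2 = 1" using tr[of s i j] TN[OF that(1)] TN[OF that(2)] that nz s by auto
      then have "(a s i * a s j)\<^sup>2 = (a i j)\<^sup>2" using nz by (simp add: power_divide)
      then show ?thesis unfolding e_def power_divide using TN(3)[OF that(1)] TN(3)[OF that(2)] nz by simp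
    qed
    have "\<exists>r. (r = 1 \<or> r = -1) \<and> (\<forall>i\<in>T. \<forall>j\<in>T. i \<noteq> j \<longrightarrow> e i j = r)"
    proof (cases "\<exists>p\<in>T. \<exists>q\<in>T. p \<noteq> q")
      case True
      then obtain p q where pq: "p \<in> T" "q \<in> T" "p \<noteq> q" by blast
      have "e i j = e p q" if ij: "i \<in> T" "j \<in> T" "i \<noteq> j" for i j
      proof (cases "i = p")
        case True then show ?thesis using e_shift[of p j q] ij pq by auto
      next
        case False
        have "e i j = e i p" using e_shift[of i j p] ij pq False by auto
        also have "\<dots> = e p i" by (rule esym)
        also have "\<dots> = e p q" using e_shift[of p i q] ij pq False by auto
        finally show ?thesis .
      qed
      then show ?thesis using e2[OF pq] power2_eq_1_iff by blast
    qed auto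
    then obtain r where r: "r = 1 \<or> r = -1" "\<And>i j. i \<in> T \<Longrightarrow> j \<in> T \<Longrightarrow> i \<noteq> j \<Longrightarrow> e i j = r" by blast
    \<comment> \<open>A square root of \<open>r\<close>: with \<open>b s = 1 / c\<close> the inverse
      square of \<open>b s\<close> is \<open>r\<close>, and all \<open>b i\<close> remain fourth
      roots of unity.\<close>
    define c where "c = (if r = 1 then 1 else \<i>)"
    have c: "c\<^sup>2 = r" "c \<noteq> 0" "c ^ 4 = 1" using r(1) by (auto simp: c_def power4_eq_xxxx)
    define b where "b i = (if i = s then 1 / c else c * a s i)" for i
    have "b i ^ 4 = 1" if "i \<in> S" for i
    proof (cases "i = s")
      case False
      then have "a s i ^ 4 = 1" using pr[of s i] TN[of i] that s by (auto simp: T_def)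
      then show ?thesis using c False by (simp add: b_def power_mult_distrib)
    qed (use c in \<open>simp add: b_def power_divide\<close>)
    moreover have "a i j = (if i \<in> S \<and> j \<in> S then b i * b j else 0)" if ij: "i \<in> ?N" "j \<in> ?N" "i \<noteq> j" for i j
    proof (cases "i \<in> S \<and> j \<in> S")
      case False then show ?thesis using Sz[of i j] ij by auto
    next
      case True
      have "a i j = b i * b j"
      proof (cases "i = s \<or> j = s")
        case True then show ?thesis using ij c(2) asym[of i j] by (auto simp: b_def)
      next
        case False
        then have T: "i \<in> T" "j \<in> T" using True by (auto simp: T_def)
        have "a i j = r * (a s i * a s j)" using r(2)[OF T ij(3)] TN(3)[OF T(1)] TN(3)[OF T(2)] by (simp add: e_def field_simps)
        also have "\<dots> = b i * b j" using False c(1) by (simp add: b_def power2_eq_square flip: c(1))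
        finally show ?thesis .
      qed
      then show ?thesis using True by simp
    qed
    ultimately show ?thesis using SN by blast
  qed
  then obtain S b where S: "S \<subseteq> ?N" "\<And>i. i \<in> S \<Longrightarrow> b i ^ 4 = 1"
    and ab: "\<And>i j. i \<in> ?N \<Longrightarrow> j \<in> ?N \<Longrightarrow> i \<noteq> j \<Longrightarrow> a i j = (if i \<in> S \<and> j \<in> S then b i * b j else 0)" by blast
  have "\<forall>i. \<exists>k\<in>{0,1,2,3::nat}. i \<in> S \<longrightarrow> b i = \<i> ^ k" using S(2) fourth_root_of_unity by blast
  then obtain k where k: "\<And>i. k i \<in> {0,1,2,3}" "\<And>i. i \<in> S \<Longrightarrow> b i = \<i> ^ k i" by metis
  have hval: "h Z = of_bool (Z \<subseteq> S \<and> even (card Z)) * (\<Prod>i\<in>Z. \<i> ^ k i)" if "Z \<subseteq> ?N" for Z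
    using that
  proof (induction "card Z" arbitrary: Z rule: less_induct)
    case less
    have finZ: "finite Z" using less.prems finite_subset by blast
    show ?case
    proof (cases "odd (card Z)")
      case True then show ?thesis using hodd less.prems by simp
    next
      case ev: False
      show ?thesis
      proof (cases "Z = {}")
        case True then show ?thesis using h0 by simp
      next
        case False
        then have "card Z > 0" using finZ by (simp add: card_gt_0_iff)
        then have c2: "card Z \<ge> 2" using ev by presburger
        \<comment> \<open>If \<open>Z\<close> is not contained in \<open>S\<close>, an element
          outside \<open>S\<close> is split off, so that the factor \<open>a i j\<close>
          vanishes.\<close>
        obtain i where i: "i \<in> Z" "\<not> Z \<subseteq> S \<longrightarrow> i \<notin> S" using False by blast
        obtain j where j: "j \<in> Z" "j \<noteq> i"
          using c2 finZ i(1) by (metis One_nat_def Suc_1 card_1_singleton_iff card_le_Suc0_iff_eq not_less_eq_eq)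
        have sub: "Z - {i, j} \<subseteq> ?N" using less.prems by auto
        have cd: "card Z = card (Z - {i, j}) + 2"
          using i j finZ c2 by (simp add: card_Diff_subset)
        have IH: "h (Z - {i, j}) = of_bool (Z - {i, j} \<subseteq> S \<and> even (card (Z - {i, j}))) * (\<Prod>i\<in>Z - {i, j}. \<i> ^ k i)"
          using less.hyps[OF _ sub] cd by simp
        have hz: "h Z = a i j * h (Z - {i, j})" using hrec[OF less.prems i(1) j(1)] j by auto
        show ?thesis
        proof (cases "Z \<subseteq> S")
          case False
          then have "a i j = 0" using ab[of i j] i j less.prems by auto
          then show ?thesis using hz False by simp
        next
          case True
          have "(\<Prod>i\<in>Z. \<i> ^ k i) = (\<Prod>i\<in>{i, j}. \<i> ^ k i) * (\<Prod>i\<in>Z - {i, j}. \<i> ^ k i)"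
            using i j finZ by (subst prod.subset_diff[of "{i, j}"]) (auto simp: mult.commute)
          also have "(\<Prod>i\<in>{i, j}. \<i> ^ k i) = a i j"
          proof -
            have "i \<in> S" "j \<in> S" "i \<in> ?N" "j \<in> ?N" using i j less.prems True by auto
            then show ?thesis using ab[of i j] j(2) k(2) by auto
          qed
          finally have "(\<Prod>i\<in>Z. \<i> ^ k i) = a i j * (\<Prod>i\<in>Z - {i, j}. \<i> ^ k i)" .
          moreover have "Z - {i, j} \<subseteq> S" "even (card (Z - {i, j}))" using True cd ev by auto
          ultimately show ?thesis unfolding hz IH using True ev by simp
        qed
      qed
    qed
  qed
  have "F \<in> affine_sigs"
  proof (rule affine_sigI[OF n1 S(1) X(1) k(1), where l = "set_val F X"])
    fix A assume A: "A \<subseteq> ?N"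
    have "sym_diff X (sym_diff A X) = A" by auto
    moreover have "sym_diff A X \<subseteq> ?N" using A X by auto
    ultimately show "set_val F A = set_val F X * of_bool (sym_diff A X \<subseteq> S \<and> even (card (sym_diff A X))) * (\<Prod>i\<in>sym_diff A X. \<i> ^ k i)"
      using hval[of "sym_diff A X"] X(2) by (simp add: h_def field_simps)
  qed
  then show False using na by simp
qed

section \<open>Small matchgates\<close>

lemma Complex_segment_points:
  assumes "z \<in> closed_segment (Complex a b) (Complex a' b')"
  shows "\<exists>t. 0 \<le> t \<and> t \<le> 1 \<and> Re z = a + t * (a' - a) \<and> Im z = b + t * (b' - b)"
proof -
  from assms obtain t where "0 \<le> t" "t \<le> 1" and z: "z = (1 - t) *\<^sub>R Complex a b + t *\<^sub>R Complex a' b'"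
    unfolding closed_segment_def by auto
  moreover from this have "Re z = a + t * (a' - a)" "Im z = b + t * (b' - b)"
    by (subst z, simp add: algebra_simps)+
  ultimately show ?thesis by blast
qed

text \<open>Suits drawings in the closed unit disc that touch the circle in their external nodes
  only. Reversing the counterclockwise circle path supplies the required orientation.\<close>

lemma clockwise_unit_circle:
  assumes S: "S \<subseteq> cball 0 1" "S \<inter> sphere 0 1 = set us"
    and ts: "sorted_wrt (<) ts" "set ts \<subseteq> {0..<1}" "us = map (\<lambda>t. cis (- 2 * pi * t)) ts"
  shows "clockwise_on_outer_face S us"
proof -
  let ?c = "reversepath (circlepath 0 1)"
  have "simple_path ?c" by (simp add: simple_path_reversepath simple_path_circlepath)
  moreover have "pathfinish ?c = pathstart ?c" by simp
  moreover have pi: "path_image ?c = sphere 0 1" by simp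
  have ins: "inside (sphere 0 1 :: complex set) = ball 0 1"
    using inside_frontier_eq_interior[of "cball 0 1 :: complex set"] by simp
  have "\<forall>z\<in>inside (path_image ?c). winding_number ?c z = -1"
  proof
    fix z assume "z \<in> inside (path_image ?c)"
    then have z: "norm (z - 0) < 1" unfolding pi ins by simp
    then have "winding_number (circlepath 0 1) z = 1" by (rule winding_number_circlepath)
    moreover have "z \<notin> path_image (circlepath 0 1)" using z by simp
    ultimately show "winding_number ?c z = -1" by (simp add: winding_number_reversepath)
  qed
  moreover have "S \<subseteq> path_image ?c \<union> inside (path_image ?c)"
    unfolding pi ins using S(1) by auto
  moreover have "S \<inter> path_image ?c = set us" unfolding pi using S(2) .
  moreover have "us = map ?c ts"
  proof -
    have "?c t = cis (- 2 * pi * t)" for t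
    proof -
      have "?c t = cis (2 * pi * (1 - t))"
        by (simp add: reversepath_def circlepath_def part_circlepath_def linepath_def cis_conv_exp algebra_simps)
      also have "\<dots> = cis (2 * pi) * cis (- 2 * pi * t)" by (simp add: cis_mult algebra_simps)
      also have "cis (2 * pi) = 1" by (simp add: complex_eq_iff)
      finally show ?thesis by simp
    qed
    then show ?thesis using ts(3) by simp
  qed
  ultimately show ?thesis unfolding clockwise_on_outer_face_def using ts by blast
qed

lemma plane_graph_segments:
  assumes "finite V" "finite EE"
    and "\<And>a b. (a, b) \<in> EE \<Longrightarrow> a \<noteq> b \<and> closed_segment a b \<inter> V = {a, b}"
    and "\<And>a b a' b'. (a, b) \<in> EE \<Longrightarrow> (a', b') \<in> EE \<Longrightarrow> (a, b) \<noteq> (a', b') \<Longrightarrow>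
      {a, b} \<noteq> {a', b'} \<and> closed_segment a b \<inter> closed_segment a' b' \<subseteq> V"
  shows "plane_graph V ((\<lambda>(a, b). closed_segment a b) ` EE)"
  unfolding plane_graph_def
proof (intro conjI ballI impI)
  fix e assume "e \<in> (\<lambda>(a, b). closed_segment a b) ` EE"
  then obtain a b where ab: "(a, b) \<in> EE" "e = closed_segment a b" by auto
  then show "\<exists>c. arc c \<and> e = path_image c \<and> e \<inter> V = {pathstart c, pathfinish c}"
    using assms(3)[OF ab(1)] by (intro exI[of _ "linepath a b"]) auto
  fix e' assume "e' \<in> (\<lambda>(a, b). closed_segment a b) ` EE" "e \<noteq> e'"
  then obtain a' b' where ab': "(a', b') \<in> EE" "e' = closed_segment a' b'" by auto
  then show "e \<inter> e' \<subseteq> V" using assms(4)[OF ab(1) ab'(1)] ab \<open>e \<noteq> e'\<close> by auto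
next
  show "inj_on (\<lambda>e. e \<inter> V) ((\<lambda>(a, b). closed_segment a b) ` EE)"
  proof (rule inj_onI)
    fix e e' assume "e \<in> (\<lambda>(a, b). closed_segment a b) ` EE" "e' \<in> (\<lambda>(a, b). closed_segment a b) ` EE" "e \<inter> V = e' \<inter> V"
    then obtain a b a' b' where "(a, b) \<in> EE" "e = closed_segment a b" "(a', b') \<in> EE" "e' = closed_segment a' b'" by auto
    moreover from this have "{a, b} = {a', b'}" using assms(3) \<open>e \<inter> V = e' \<inter> V\<close> by metis
    ultimately show "e = e'" using assms(4)[of a b a' b'] by auto
  qed
qed (use assms in auto)

lemma PM_single:
  assumes "perfect_matchings V E = {M}" shows "PM V E w = (\<Prod>e\<in>M. w e)"
  using assms by (simp add: PM_def)

lemma in_perfect_matchings: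
  "M \<in> perfect_matchings V E \<longleftrightarrow> M \<subseteq> E \<and> (\<forall>v\<in>V. \<exists>!e. e \<in> M \<and> v \<in> e)"
  by (simp add: perfect_matchings_def)

lemma single_edge_matching:
  assumes "u \<in> e" "v \<in> e" shows "perfect_matchings {u, v} {e} = {{e}}"
  using assms by (auto simp: in_perfect_matchings)

lemma two_edge_matching:
  assumes "{e, f} \<subseteq> E" "u1 \<in> e" "u2 \<in> e" "u3 \<in> f" "u4 \<in> f" "u1 \<notin> f" "u2 \<notin> f" "u3 \<notin> e" "u4 \<notin> e"
  shows "{e, f} \<in> perfect_matchings {u1, u2, u3, u4} E"
  using assms by (auto simp: in_perfect_matchings)

lemma exposed_val_empty: "exposed_val V E w us {} = PM V E w"
  by (simp add: exposed_val_def)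

lemma symsig_val [simp]: "arity (symsig fs) = length fs - 1" "sigval (symsig fs) x = fs ! hamming_weight x"
  by (simp_all add: symsig_def)

text \<open>The matchgate is a path of four vertices with external ends and edge weights a, b, 1.
  With both ends present, the two outer edges form the only matching; with both removed, only the
  middle edge is left.\<close>

lemma binary_even_matchgate: "symsig [a, 0, b] \<in> matchgate_sigs"
proof -
  define p1 p2 p3 p4 where "p1 = Complex 1 0" and "p2 = Complex (1/3) 0" and "p3 = Complex (-1/3) 0" and "p4 = Complex (-1) 0"
  note pd = p1_def p2_def p3_def p4_def
  define V where "V = {p1, p2, p3, p4}"
  define EE where "EE = {(p1, p2), (p2, p3), (p3, p4)}"
  define e1 e2 e3 where "e1 = closed_segment p1 p2" and "e2 = closed_segment p2 p3" and "e3 = closed_segment p3 p4"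
  note ed = e1_def e2_def e3_def
  have pt1: "z \<in> e1 \<Longrightarrow> 1/3 \<le> Re z \<and> Re z \<le> 1 \<and> Im z = 0" for z
    unfolding ed pd by (drule Complex_segment_points) auto
  have pt2: "z \<in> e2 \<Longrightarrow> -1/3 \<le> Re z \<and> Re z \<le> 1/3 \<and> Im z = 0" for z
    unfolding ed pd by (drule Complex_segment_points) auto
  have pt3: "z \<in> e3 \<Longrightarrow> -1 \<le> Re z \<and> Re z \<le> -1/3 \<and> Im z = 0" for z
    unfolding ed pd by (drule Complex_segment_points) auto
  have ends: "p1 \<in> e1" "p2 \<in> e1" "p2 \<in> e2" "p3 \<in> e2" "p3 \<in> e3" "p4 \<in> e3" by (auto simp: ed)
  have nin: "p3 \<notin> e1" "p4 \<notin> e1" "p1 \<notin> e2" "p4 \<notin> e2" "p1 \<notin> e3" "p2 \<notin> e3"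
    using pt1[of p3] pt1[of p4] pt2[of p1] pt2[of p4] pt3[of p1] pt3[of p2] by (auto simp: pd)
  have di: "p1 \<noteq> p2" "p1 \<noteq> p3" "p1 \<noteq> p4" "p2 \<noteq> p3" "p2 \<noteq> p4" "p3 \<noteq> p4" by (auto simp: pd)
  have E: "(\<lambda>(a, b). closed_segment a b) ` EE = {e1, e2, e3}" by (simp add: EE_def ed)
  have i12: "z = p2" if "z \<in> e1" "z \<in> e2" for z using pt1[OF that(1)] pt2[OF that(2)] by (auto simp: pd complex_eq_iff)
  have i13: False if "z \<in> e1" "z \<in> e3" for z using pt1[OF that(1)] pt3[OF that(2)] by auto
  have i23: "z = p3" if "z \<in> e2" "z \<in> e3" for z using pt2[OF that(1)] pt3[OF that(2)] by (auto simp: pd complex_eq_iff)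
  have pg: "plane_graph V {e1, e2, e3}"
    unfolding E[symmetric]
  proof (rule plane_graph_segments)
    show "finite V" "finite EE" by (auto simp: V_def EE_def)
    show "\<And>a b. (a, b) \<in> EE \<Longrightarrow> a \<noteq> b \<and> closed_segment a b \<inter> V = {a, b}"
      unfolding EE_def using ends nin di by (auto simp: V_def simp flip: ed)
    show "\<And>a b a' b'. (a, b) \<in> EE \<Longrightarrow> (a', b') \<in> EE \<Longrightarrow> (a, b) \<noteq> (a', b') \<Longrightarrow>
      {a, b} \<noteq> {a', b'} \<and> closed_segment a b \<inter> closed_segment a' b' \<subseteq> V"
      unfolding EE_def using i12 i23 di by (auto simp: V_def doubleton_eq_iff dest: i13 simp flip: ed)
  qed
  let ?us = "[p1, p4]"
  have "clockwise_on_outer_face (V \<union> \<Union>{e1, e2, e3}) ?us"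
  proof (rule clockwise_unit_circle)
    have S: "z \<in> V \<union> \<Union>{e1, e2, e3} \<Longrightarrow> Im z = 0 \<and> -1 \<le> Re z \<and> Re z \<le> 1" for z
      using pt1[of z] pt2[of z] pt3[of z] by (auto simp: V_def pd)
    have nrm: "norm z = \<bar>Re z\<bar>" if "Im z = 0" for z using that by (simp add: cmod_def)
    show "V \<union> \<Union>{e1, e2, e3} \<subseteq> cball 0 1" using S nrm by fastforce
    show "(V \<union> \<Union>{e1, e2, e3}) \<inter> sphere 0 1 = set ?us"
    proof
      show "(V \<union> \<Union>{e1, e2, e3}) \<inter> sphere 0 1 \<subseteq> set ?us"
      proof
        fix z assume z: "z \<in> (V \<union> \<Union>{e1, e2, e3}) \<inter> sphere 0 1"
        then have "Im z = 0" "\<bar>Re z\<bar> = 1" using S[of z] nrm[of z] by auto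
        then show "z \<in> set ?us" by (auto simp: pd complex_eq_iff abs_if split: if_splits)
      qed
      show "set ?us \<subseteq> (V \<union> \<Union>{e1, e2, e3}) \<inter> sphere 0 1" by (auto simp: V_def pd cmod_def)
    qed
    show "?us = map (\<lambda>t. cis (- 2 * pi * t)) [0, 1/2]" by (simp add: pd complex_eq_iff)
  qed auto
  then have mg: "matchgate V {e1, e2, e3} ?us"
    unfolding matchgate_def using pg di by (simp add: V_def)
  have ne: "e1 \<noteq> e2" "e1 \<noteq> e3" "e2 \<noteq> e3" using ends nin by auto
  define w where "w e = (if e = e1 then a else if e = e2 then b else 1)" for e
  have v0: "exposed_val V {e1, e2, e3} w ?us {} = a"
  proof -
    have "perfect_matchings V {e1, e2, e3} = {{e1, e3}}"
    proof (intro set_eqI iffI)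
      fix M assume M: "M \<in> perfect_matchings V {e1, e2, e3}"
      then have sub: "M \<subseteq> {e1, e2, e3}" and m: "\<And>v. v \<in> V \<Longrightarrow> \<exists>!e. e \<in> M \<and> v \<in> e" unfolding in_perfect_matchings by auto
      have "e1 \<in> M" using m[of p1] sub nin by (auto simp: V_def)
      moreover have "e3 \<in> M" using m[of p4] sub nin by (auto simp: V_def)
      moreover have "e2 \<notin> M" using m[of p2] \<open>e1 \<in> M\<close> ends ne by (auto simp: V_def)
      ultimately show "M \<in> {{e1, e3}}" using sub by auto
    next
      fix M assume "M \<in> {{e1, e3}}"
      then have "M = {e1, e3}" by simp
      moreover have "{e1, e3} \<in> perfect_matchings {p1, p2, p3, p4} {e1, e2, e3}"
        by (rule two_edge_matching) (use ends nin in auto)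
      ultimately show "M \<in> perfect_matchings V {e1, e2, e3}" by (simp only: V_def)
    qed
    from PM_single[OF this, of w] show ?thesis unfolding exposed_val_empty using ne by (simp add: w_def)
  qed
  have v2: "exposed_val V {e1, e2, e3} w ?us {0, 1} = b"
  proof -
    have 0: "(!) ?us ` {0, 1} = {p1, p4}" by simp
    have 1: "V - {p1, p4} = {p2, p3}" using di by (auto simp: V_def)
    have 2: "{e \<in> {e1, e2, e3}. e \<inter> {p1, p4} = {}} = {e2}" using ends nin by auto
    have "perfect_matchings {p2, p3} {e2} = {{e2}}" by (rule single_edge_matching) (use ends in auto)
    from PM_single[OF this, of w] show ?thesis unfolding exposed_val_def 0 1 2 using ne by (simp add: w_def)
  qed
  have cV: "card V = 4" using di by (simp add: V_def)
  have usV: "set ?us \<subseteq> V" "distinct ?us" using di by (simp_all add: V_def)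
  have v1: "exposed_val V {e1, e2, e3} w ?us {i} = 0" if "i < 2" for i
  proof (rule ccontr)
    assume "exposed_val V {e1, e2, e3} w ?us {i} \<noteq> 0"
    then have "even (card V + card {i})" by (rule exposed_val_parity[OF pg usV(1) _ usV(2), rotated]) (use that in simp)
    then show False using cV by simp
  qed
  have "sigval (symsig [a, 0, b]) \<alpha> = matchgate_val V {e1, e2, e3} w ?us \<alpha>" if len: "length \<alpha> = 2" for \<alpha>
  proof -
    obtain x y where \<alpha>: "\<alpha> = [x, y]" using len by (auto simp: numeral_2_eq_2 length_Suc_conv)
    have "{i. i < length ?us \<and> \<alpha> ! i} = (if x then {0} else {}) \<union> (if y then {1} else {})"
    proof (rule set_eqI)
      fix i show "i \<in> {i. i < length ?us \<and> \<alpha> ! i} \<longleftrightarrow> i \<in> (if x then {0} else {}) \<union> (if y then {1} else {})"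
        by (cases "i = 0"; cases "i = 1") (simp_all add: \<alpha>)
    qed
    then have "matchgate_val V {e1, e2, e3} w ?us \<alpha> = exposed_val V {e1, e2, e3} w ?us ((if x then {0} else {}) \<union> (if y then {1} else {}))"
      using matchgate_val_exposed[of \<alpha> ?us V "{e1, e2, e3}" w] len by simp
    also have "\<dots> = sigval (symsig [a, 0, b]) \<alpha>"
      using v0 v1[of 0] v1[of 1] v2 by (cases x; cases y) (auto simp: \<alpha> numeral_2_eq_2 insert_commute)
    finally show ?thesis by simp
  qed
  then show ?thesis unfolding matchgate_sigs_def mem_Collect_eq
    by (intro exI[of _ V] exI[of _ "{e1, e2, e3}"] exI[of _ w] exI[of _ ?us]) (use mg in auto)
qed


text \<open>The matchgate is a star with three external leaves and spokes of weight b, plus a chord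
  of weight a / b between two leaves. With all leaves present, the chord and the third spoke form
  the only matching; with two leaves removed, the remaining spoke does.\<close>

lemma ternary_even_matchgate:
  assumes "b \<noteq> 0" shows "symsig [a, 0, b, 0] \<in> matchgate_sigs"
proof -
  define o' u1 u2 u3 where "o' = Complex 0 0" and "u1 = Complex 1 0" and "u2 = Complex 0 (-1)" and "u3 = Complex (-1) 0"
  note pd = o'_def u1_def u2_def u3_def
  define V where "V = {o', u1, u2, u3}"
  define EE where "EE = {(o', u1), (o', u2), (o', u3), (u1, u2)}"
  define s1 s2 s3 ch where "s1 = closed_segment o' u1" and "s2 = closed_segment o' u2" and "s3 = closed_segment o' u3"
    and "ch = closed_segment u1 u2"
  note ed = s1_def s2_def s3_def ch_def
  have pt1: "z \<in> s1 \<Longrightarrow> 0 \<le> Re z \<and> Re z \<le> 1 \<and> Im z = 0" for z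
    unfolding ed pd by (drule Complex_segment_points) auto
  have pt2: "z \<in> s2 \<Longrightarrow> Re z = 0 \<and> -1 \<le> Im z \<and> Im z \<le> 0" for z
    unfolding ed pd by (drule Complex_segment_points) auto
  have pt3: "z \<in> s3 \<Longrightarrow> -1 \<le> Re z \<and> Re z \<le> 0 \<and> Im z = 0" for z
    unfolding ed pd by (drule Complex_segment_points) auto
  have pt4: "z \<in> ch \<Longrightarrow> 0 \<le> Re z \<and> Re z \<le> 1 \<and> Im z = Re z - 1" for z
    unfolding ed pd by (drule Complex_segment_points) auto
  have ends: "o' \<in> s1" "u1 \<in> s1" "o' \<in> s2" "u2 \<in> s2" "o' \<in> s3" "u3 \<in> s3" "u1 \<in> ch" "u2 \<in> ch" by (auto simp: ed)
  have nin: "u2 \<notin> s1" "u3 \<notin> s1" "u1 \<notin> s2" "u3 \<notin> s2" "u1 \<notin> s3" "u2 \<notin> s3" "o' \<notin> ch" "u3 \<notin> ch"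
    using pt1[of u2] pt1[of u3] pt2[of u1] pt2[of u3] pt3[of u1] pt3[of u2] pt4[of o'] pt4[of u3] by (auto simp: pd)
  have di: "o' \<noteq> u1" "o' \<noteq> u2" "o' \<noteq> u3" "u1 \<noteq> u2" "u1 \<noteq> u3" "u2 \<noteq> u3" by (auto simp: pd)
  let ?E = "{s1, s2, s3, ch}"
  have E: "(\<lambda>(a, b). closed_segment a b) ` EE = ?E" by (simp add: EE_def ed)
  have i12: "z = o'" if "z \<in> s1" "z \<in> s2" for z using pt1[OF that(1)] pt2[OF that(2)] by (auto simp: pd complex_eq_iff)
  have i13: "z = o'" if "z \<in> s1" "z \<in> s3" for z using pt1[OF that(1)] pt3[OF that(2)] by (auto simp: pd complex_eq_iff)
  have i23: "z = o'" if "z \<in> s2" "z \<in> s3" for z using pt2[OF that(1)] pt3[OF that(2)] by (auto simp: pd complex_eq_iff)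
  have i14: "z = u1" if "z \<in> s1" "z \<in> ch" for z using pt1[OF that(1)] pt4[OF that(2)] by (auto simp: pd complex_eq_iff)
  have i24: "z = u2" if "z \<in> s2" "z \<in> ch" for z using pt2[OF that(1)] pt4[OF that(2)] by (auto simp: pd complex_eq_iff)
  have i34: False if "z \<in> s3" "z \<in> ch" for z using pt3[OF that(1)] pt4[OF that(2)] by auto
  have pg: "plane_graph V ?E"
    unfolding E[symmetric]
  proof (rule plane_graph_segments)
    show "finite V" "finite EE" by (auto simp: V_def EE_def)
    show "\<And>a b. (a, b) \<in> EE \<Longrightarrow> a \<noteq> b \<and> closed_segment a b \<inter> V = {a, b}"
      unfolding EE_def using ends nin di by (auto simp: V_def simp flip: ed)
    show "\<And>a b a' b'. (a, b) \<in> EE \<Longrightarrow> (a', b') \<in> EE \<Longrightarrow> (a, b) \<noteq> (a', b') \<Longrightarrow>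
      {a, b} \<noteq> {a', b'} \<and> closed_segment a b \<inter> closed_segment a' b' \<subseteq> V"
      unfolding EE_def using di
      by (auto simp: V_def doubleton_eq_iff dest: i12 i13 i23 i14 i24 i34 simp flip: ed)
  qed
  let ?us = "[u1, u2, u3]"
  have "clockwise_on_outer_face (V \<union> \<Union>?E) ?us"
  proof (rule clockwise_unit_circle)
    \<comment> \<open>The drawing lies in the lower half of the unit ball of the l1 norm, which
      touches the unit circle only on the axes; the half-plane excludes the fourth point
      \<open>\<i>\<close>.\<close>
    have S: "Im z \<le> 0 \<and> \<bar>Re z\<bar> + \<bar>Im z\<bar> \<le> 1" if "z \<in> V \<union> \<Union>?E" for z
      using that pt1[of z] pt2[of z] pt3[of z] pt4[of z] by (auto simp: V_def pd)
    show "V \<union> \<Union>?E \<subseteq> cball 0 1"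
    proof
      fix z assume "z \<in> V \<union> \<Union>?E"
      then have "norm z \<le> 1" using S[of z] cmod_le[of z] by linarith
      then show "z \<in> cball 0 1" by simp
    qed
    show "(V \<union> \<Union>?E) \<inter> sphere 0 1 = set ?us"
    proof
      show "(V \<union> \<Union>?E) \<inter> sphere 0 1 \<subseteq> set ?us"
      proof
        fix z assume z: "z \<in> (V \<union> \<Union>?E) \<inter> sphere 0 1"
        then have s: "Im z \<le> 0" "\<bar>Re z\<bar> + \<bar>Im z\<bar> \<le> 1" using S[of z] by auto
        have n: "\<bar>Re z\<bar>\<^sup>2 + \<bar>Im z\<bar>\<^sup>2 = 1" using z by (simp add: cmod_def)
        have "(\<bar>Re z\<bar> + \<bar>Im z\<bar>)\<^sup>2 \<le> 1" using s(2) by (simp add: abs_square_le_1)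
        moreover have "(\<bar>Re z\<bar> + \<bar>Im z\<bar>)\<^sup>2 = 1 + 2 * (\<bar>Re z\<bar> * \<bar>Im z\<bar>)" using n by (simp only: power2_sum)
        moreover have "0 \<le> \<bar>Re z\<bar> * \<bar>Im z\<bar>" by simp
        ultimately have "\<bar>Re z\<bar> * \<bar>Im z\<bar> = 0" by linarith
        then have "Re z = 0 \<or> Im z = 0" by simp
        then show "z \<in> set ?us"
        proof
          assume 0: "Re z = 0"
          then have "(Im z)\<^sup>2 = 1" using n by simp
          then have "Im z = -1" using s(1) by (simp add: power2_eq_1_iff)
          then show ?thesis using 0 by (simp add: pd complex_eq_iff)
        next
          assume 0: "Im z = 0"
          then have "(Re z)\<^sup>2 = 1" using n by simp
          then have "Re z = 1 \<or> Re z = -1" by (simp add: power2_eq_1_iff)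
          then show ?thesis using 0 by (auto simp: pd complex_eq_iff)
        qed
      qed
      show "set ?us \<subseteq> (V \<union> \<Union>?E) \<inter> sphere 0 1" by (auto simp: V_def pd cmod_def)
    qed
    have "cis (- 2 * pi * (1/4)) = u2"
    proof -
      have "- 2 * pi * (1/4) = - (pi / 2)" by simp
      then show ?thesis by (simp only: pd) (simp add: complex_eq_iff)
    qed
    moreover have "cis (- 2 * pi * (1/2)) = u3" "cis (- 2 * pi * 0) = u1" by (simp_all add: pd complex_eq_iff)
    ultimately show "?us = map (\<lambda>t. cis (- 2 * pi * t)) [0, 1/4, 1/2]" by (simp only: list.map)
  qed auto
  then have mg: "matchgate V ?E ?us"
    unfolding matchgate_def using pg di by (simp add: V_def)
  have ne: "s1 \<noteq> s2" "s1 \<noteq> s3" "s1 \<noteq> ch" "s2 \<noteq> s3" "s2 \<noteq> ch" "s3 \<noteq> ch" using ends nin by auto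
  define w where "w e = (if e = ch then a / b else b)" for e
  have v0: "exposed_val V ?E w ?us {} = a"
  proof -
    have "perfect_matchings V ?E = {{ch, s3}}"
    proof (intro set_eqI iffI)
      fix M assume M: "M \<in> perfect_matchings V ?E"
      then have sub: "M \<subseteq> ?E" and m: "\<And>v. v \<in> V \<Longrightarrow> \<exists>!e. e \<in> M \<and> v \<in> e" unfolding in_perfect_matchings by auto
      have s3: "s3 \<in> M" using m[of u3] sub nin by (auto simp: V_def)
      have "s1 \<notin> M" "s2 \<notin> M" using m[of o'] s3 ends ne by (auto simp: V_def)
      moreover from this have "ch \<in> M" using m[of u1] sub nin by (auto simp: V_def)
      ultimately show "M \<in> {{ch, s3}}" using sub s3 by auto
    next
      fix M assume "M \<in> {{ch, s3}}"
      then have "M = {ch, s3}" by simp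
      moreover have "{ch, s3} \<in> perfect_matchings {u1, u2, o', u3} ?E"
        by (rule two_edge_matching) (use ends nin in auto)
      moreover have "V = {u1, u2, o', u3}" by (auto simp: V_def)
      ultimately show "M \<in> perfect_matchings V ?E" by (simp only:)
    qed
    from PM_single[OF this, of w] show ?thesis unfolding exposed_val_empty using ne assms by (simp add: w_def)
  qed
  have v2: "exposed_val V ?E w ?us {0, 1} = b" "exposed_val V ?E w ?us {0, 2} = b" "exposed_val V ?E w ?us {1, 2} = b"
  proof -
    have 0: "(!) ?us ` {0, 1} = {u1, u2}" by simp
    have 1: "V - {u1, u2} = {o', u3}" using di by (auto simp: V_def)
    have 2: "{e \<in> ?E. e \<inter> {u1, u2} = {}} = {s3}" using ends nin by auto
    have "perfect_matchings {o', u3} {s3} = {{s3}}" by (rule single_edge_matching) (use ends in auto)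
    from PM_single[OF this, of w] show "exposed_val V ?E w ?us {0, 1} = b"
      unfolding exposed_val_def 0 1 2 using ne by (simp add: w_def)
    have 0: "(!) ?us ` {0, 2} = {u1, u3}" by simp
    have 1: "V - {u1, u3} = {o', u2}" using di by (auto simp: V_def)
    have 2: "{e \<in> ?E. e \<inter> {u1, u3} = {}} = {s2}" using ends nin by auto
    have "perfect_matchings {o', u2} {s2} = {{s2}}" by (rule single_edge_matching) (use ends in auto)
    from PM_single[OF this, of w] show "exposed_val V ?E w ?us {0, 2} = b"
      unfolding exposed_val_def 0 1 2 using ne by (simp add: w_def)
    have 0: "(!) ?us ` {1, 2} = {u2, u3}" by simp
    have 1: "V - {u2, u3} = {o', u1}" using di by (auto simp: V_def)
    have 2: "{e \<in> ?E. e \<inter> {u2, u3} = {}} = {s1}" using ends nin by auto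
    have "perfect_matchings {o', u1} {s1} = {{s1}}" by (rule single_edge_matching) (use ends in auto)
    from PM_single[OF this, of w] show "exposed_val V ?E w ?us {1, 2} = b"
      unfolding exposed_val_def 0 1 2 using ne by (simp add: w_def)
  qed
  have cV: "card V = 4" using di by (simp add: V_def)
  have usV: "set ?us \<subseteq> V" "distinct ?us" using di by (simp_all add: V_def)
  have v1: "exposed_val V ?E w ?us A = 0" if "A \<subseteq> {..<3}" "odd (card A)" for A
  proof (rule ccontr)
    assume "exposed_val V ?E w ?us A \<noteq> 0"
    then have "even (card V + card A)" by (rule exposed_val_parity[OF pg usV(1) _ usV(2), rotated]) (use that in \<open>simp add: numeral_3_eq_3\<close>)
    then show False using cV that by simp
  qed
  have "sigval (symsig [a, 0, b, 0]) \<alpha> = matchgate_val V ?E w ?us \<alpha>" if len: "length \<alpha> = 3" for \<alpha>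
  proof -
    obtain x y z where \<alpha>: "\<alpha> = [x, y, z]" using len by (auto simp: numeral_3_eq_3 length_Suc_conv)
    let ?A = "(if x then {0} else {}) \<union> (if y then {1} else {}) \<union> (if z then {2} else {}) :: nat set"
    have "{i. i < length ?us \<and> \<alpha> ! i} = ?A"
    proof (rule set_eqI)
      fix i show "i \<in> {i. i < length ?us \<and> \<alpha> ! i} \<longleftrightarrow> i \<in> ?A"
        by (cases "i = 0"; cases "i = 1"; cases "i = 2") (simp_all add: \<alpha>)
    qed
    then have "matchgate_val V ?E w ?us \<alpha> = exposed_val V ?E w ?us ?A"
      using matchgate_val_exposed[of \<alpha> ?us V ?E w] len by simp
    also have "\<dots> = sigval (symsig [a, 0, b, 0]) \<alpha>"
    proof -
      have v3: "exposed_val V ?E w ?us {0, 1, 2} = 0" by (rule v1) auto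
      show ?thesis
        using v0 v1[of "{0}"] v1[of "{1}"] v1[of "{2}"] v3 v2
        by (cases x; cases y; cases z) (auto simp: \<alpha> numeral_2_eq_2 numeral_3_eq_3 insert_commute)
    qed
    finally show ?thesis by simp
  qed
  then show ?thesis unfolding matchgate_sigs_def mem_Collect_eq
    by (intro exI[of _ V] exI[of _ "?E"] exI[of _ w] exI[of _ ?us]) (use mg in auto)
qed

lemma symmetric_symsig: "symmetric_sig (symsig fs)"
  by (simp add: symmetric_sig_def symsig_def)

section \<open>Obstructions to being affine\<close>

lemma i_pow_4_mult: "\<i> ^ (4 * q) = 1"
  by (simp add: power_mult power4_eq_xxxx)

text \<open>The linear system is hidden in \<open>P\<close>: the obstructions below only compare
  nonzero values, and these are the constant \<open>l\<close> times powers of \<open>\<i>\<close>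
  with quadratic exponents.\<close>

lemma affine_sigE:
  assumes "F \<in> affine_sigs"
  obtains l :: complex and P :: "bool list \<Rightarrow> bool" and k :: "nat \<Rightarrow> nat" and b :: "nat \<Rightarrow> nat \<Rightarrow> nat"
  where "\<And>x. length x = arity F \<Longrightarrow> sigval F x = l * of_bool (P x)
     * \<i> ^ ((\<Sum>i<arity F. k i * (of_bool (x ! i))\<^sup>2)
            + 2 * (\<Sum>j<arity F. \<Sum>i<j. b i j * of_bool (x ! i) * of_bool (x ! j)))"
proof -
  from assms obtain l :: complex and m :: nat and A :: "nat \<Rightarrow> nat \<Rightarrow> bit" and c :: "nat \<Rightarrow> bit" and k :: "nat \<Rightarrow> nat" and b :: "nat \<Rightarrow> nat \<Rightarrow> nat"
    where f: "\<forall>x. length x = arity F \<longrightarrow> sigval F x =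
               l * of_bool (\<forall>r<m. (\<Sum>j<arity F. A r j * of_bool (x ! j)) = c r)
                 * \<i> ^ ((\<Sum>i<arity F. k i * (of_bool (x ! i))\<^sup>2)
                        + 2 * (\<Sum>j<arity F. \<Sum>i<j. b i j * of_bool (x ! i) * of_bool (x ! j)))"
    unfolding affine_sigs_def mem_Collect_eq by (elim conjE exE)
  show thesis
    by (rule that[where P = "\<lambda>x. \<forall>r<m. (\<Sum>j<arity F. A r j * of_bool (x ! j)) = c r"], rule f[rule_format])
qed

text \<open>All nonzero values of an affine signature have the same fourth power.\<close>

lemma binary_even_nonaffine:
  assumes "a \<noteq> 0" "b \<noteq> 0" "(b / a) ^ 4 \<noteq> 1"
  shows "symsig [a, 0, b] \<notin> affine_sigs"
proof
  assume "symsig [a, 0, b] \<in> affine_sigs"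
  then obtain l :: complex and P :: "bool list \<Rightarrow> bool" and k :: "nat \<Rightarrow> nat" and b' :: "nat \<Rightarrow> nat \<Rightarrow> nat"
    where f: "\<And>x. length x = arity (symsig [a, 0, b]) \<Longrightarrow> sigval (symsig [a, 0, b]) x = l * of_bool (P x)
     * \<i> ^ ((\<Sum>i<arity (symsig [a, 0, b]). k i * (of_bool (x ! i))\<^sup>2)
            + 2 * (\<Sum>j<arity (symsig [a, 0, b]). \<Sum>i<j. b' i j * of_bool (x ! i) * of_bool (x ! j)))"
    by (rule affine_sigE) blast
  define q where "q x = ((\<Sum>i<arity (symsig [a, 0, b]). k i * (of_bool (x ! i))\<^sup>2)
            + 2 * (\<Sum>j<arity (symsig [a, 0, b]). \<Sum>i<j. b' i j * of_bool (x ! i) * of_bool (x ! j)))" for x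
  have 4: "(\<i> ^ n) ^ 4 = 1" for n using i_pow_4_mult[of n] by (simp add: mult.commute flip: power_mult)
  have "a = l * of_bool (P [False, False]) * \<i> ^ q [False, False]" "b = l * of_bool (P [True, True]) * \<i> ^ q [True, True]"
    using f[of "[False, False]"] f[of "[True, True]"] unfolding q_def[symmetric] by (simp_all add: numeral_2_eq_2)
  then have "a = l * \<i> ^ q [False, False]" "b = l * \<i> ^ q [True, True]" using assms by (auto split: if_splits)
  then have "a ^ 4 = l ^ 4" "b ^ 4 = l ^ 4" using 4 by (simp_all add: power_mult_distrib)
  then have "b ^ 4 = a ^ 4" by simp
  then show False using assms by (simp add: power_divide)
qed

text \<open>The value at the zero input gives l = a. Multiplying the equations for the two inputs of
  weight 2 that involve variable 0 and squaring removes \<open>k 0\<close> and the mixed terms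
  modulo 4, so b^4 = a^4 \<open>\<i> ^ (2 * (k 1 + k 2))\<close>. The square of the third equation
  is b^2 = a^2 \<open>\<i> ^ (2 * (k 1 + k 2))\<close>. Together they give b^2 = a^2.\<close>

lemma ternary_even_nonaffine:
  assumes "a \<noteq> 0" "b \<noteq> 0" "(b / a)\<^sup>2 \<noteq> 1"
  shows "symsig [a, 0, b, 0] \<notin> affine_sigs"
proof
  assume "symsig [a, 0, b, 0] \<in> affine_sigs"
  then obtain l :: complex and P :: "bool list \<Rightarrow> bool" and k :: "nat \<Rightarrow> nat" and b' :: "nat \<Rightarrow> nat \<Rightarrow> nat"
    where f: "\<And>x. length x = arity (symsig [a, 0, b, 0]) \<Longrightarrow> sigval (symsig [a, 0, b, 0]) x = l * of_bool (P x)
     * \<i> ^ ((\<Sum>i<arity (symsig [a, 0, b, 0]). k i * (of_bool (x ! i))\<^sup>2)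
            + 2 * (\<Sum>j<arity (symsig [a, 0, b, 0]). \<Sum>i<j. b' i j * of_bool (x ! i) * of_bool (x ! j)))"
    by (rule affine_sigE) blast
  have v1: "a = l * of_bool (P [False,False,False])"
    using f[of "[False,False,False]"] by (simp add: numeral_3_eq_3 numeral_2_eq_2 lessThan_Suc ac_simps)
  have v2: "b = l * of_bool (P [True,True,False]) * \<i> ^ (k 0 + k 1 + 2 * b' 0 1)"
    using f[of "[True,True,False]"] by (simp add: numeral_3_eq_3 numeral_2_eq_2 lessThan_Suc ac_simps)
  have v3: "b = l * of_bool (P [True,False,True]) * \<i> ^ (k 0 + k 2 + 2 * b' 0 2)"
    using f[of "[True,False,True]"] by (simp add: numeral_3_eq_3 numeral_2_eq_2 lessThan_Suc ac_simps)
  have v4: "b = l * of_bool (P [False,True,True]) * \<i> ^ (k 1 + k 2 + 2 * b' 1 2)"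
    using f[of "[False,True,True]"] by (simp add: numeral_3_eq_3 numeral_2_eq_2 lessThan_Suc ac_simps)
  have "P [False,False,False]" "P [True,True,False]" "P [True,False,True]" "P [False,True,True]"
    using assms v1 v2 v3 v4 by (metis mult_zero_left mult_zero_right of_bool_eq(1))+
  then have v: "a = l" "b = l * \<i> ^ (k 0 + k 1 + 2 * b' 0 1)" "b = l * \<i> ^ (k 0 + k 2 + 2 * b' 0 2)"
    "b = l * \<i> ^ (k 1 + k 2 + 2 * b' 1 2)"
    using v1 v2 v3 v4 by (simp_all only: of_bool_eq mult_1_right)
  have "b * b = (l * \<i> ^ (k 0 + k 1 + 2 * b' 0 1)) * (l * \<i> ^ (k 0 + k 2 + 2 * b' 0 2))"
    by (rule arg_cong2[where f = "(*)", OF v(2,3)])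
  then have "b * b = l * l * \<i> ^ ((k 0 + k 1 + 2 * b' 0 1) + (k 0 + k 2 + 2 * b' 0 2))"
    by (simp only: power_add mult_ac)
  then have "b * b * (b * b) = l * l * (l * l) * (\<i> ^ ((k 0 + k 1 + 2 * b' 0 1) + (k 0 + k 2 + 2 * b' 0 2)))\<^sup>2"
    by (simp add: power2_eq_square)
  also have "(\<i> ^ ((k 0 + k 1 + 2 * b' 0 1) + (k 0 + k 2 + 2 * b' 0 2)))\<^sup>2 =
     \<i> ^ (4 * (k 0 + b' 0 1 + b' 0 2) + 2 * (k 1 + k 2))"
    by (simp flip: power_mult add: algebra_simps)
  also have "\<dots> = \<i> ^ (2 * (k 1 + k 2))" by (simp only: power_add i_pow_4_mult) simp
  finally have 1: "b * b * (b * b) = l * l * (l * l) * \<i> ^ (2 * (k 1 + k 2))" .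
  have "b * b = (l * \<i> ^ (k 1 + k 2 + 2 * b' 1 2)) * (l * \<i> ^ (k 1 + k 2 + 2 * b' 1 2))"
    by (rule arg_cong2[where f = "(*)", OF v(4,4)])
  also have "\<dots> = l * l * \<i> ^ ((k 1 + k 2 + 2 * b' 1 2) + (k 1 + k 2 + 2 * b' 1 2))"
    by (simp only: power_add mult_ac)
  also have "(k 1 + k 2 + 2 * b' 1 2) + (k 1 + k 2 + 2 * b' 1 2) = 4 * b' 1 2 + 2 * (k 1 + k 2)" by simp
  finally have "b * b = l * l * \<i> ^ (4 * b' 1 2 + 2 * (k 1 + k 2))" .
  then have "b * b = l * l * \<i> ^ (2 * (k 1 + k 2))" by (simp only: power_add i_pow_4_mult) simp
  then have "b * b * (b * b) = l * l * (b * b)" using 1 by (simp add: mult_ac)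
  then have "b\<^sup>2 = a\<^sup>2" using v(1) assms(2) by (simp add: power2_eq_square)
  then show False using assms by (simp add: power_divide)
qed

section \<open>Drawings of gadgets\<close>

abbreviation caps :: "signature set" where
  "caps \<equiv> {symsig [1,0], symsig [1,0,1], symsig [1,0,1,0]}"

text \<open>Tensors of the planar left-side gadgets that can be drawn above a horizontal line with all
  dangling edges ending on the line, in the order of the variables.\<close>

inductive planar_tensor :: "signature \<Rightarrow> nat \<Rightarrow> (bool list \<Rightarrow> complex) \<Rightarrow> bool" for F where
  empty: "planar_tensor F 0 (\<lambda>_. 1)"
| vertex: "planar_tensor F a f \<Longrightarrow> \<sigma> permutes {..<arity F} \<Longrightarrow>
    planar_tensor F (a + arity F) (\<lambda>\<alpha>. f (take a \<alpha>) * sigval F (permute_list \<sigma> (drop a \<alpha>)))"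
| cap: "planar_tensor F (a + arity g + b) f \<Longrightarrow> g \<in> caps \<Longrightarrow>
    planar_tensor F (a + b) (\<lambda>\<alpha>. \<Sum>\<beta> | length \<beta> = arity g. f (take a \<alpha> @ \<beta> @ drop a \<alpha>) * sigval g \<beta>)"
| ext: "planar_tensor F k f \<Longrightarrow> (\<And>\<alpha>. length \<alpha> = k \<Longrightarrow> f \<alpha> = f' \<alpha>) \<Longrightarrow> planar_tensor F k f'"

section \<open>Attaching a vertex or a cap to a gadget\<close>

definition add_vertex :: "signature \<Rightarrow> (nat \<Rightarrow> nat) \<Rightarrow> nat \<Rightarrow> nat list \<Rightarrow> gadget \<Rightarrow> gadget" where
  "add_vertex F \<sigma> u es G = G\<lparr>gU := insert u (gU G), gD := gD G @ es,
     gfst := (\<lambda>e. if e \<in> set es then u else gfst G e),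
     gsig := (gsig G)(u := F), gargs := (gargs G)(u := permute_list \<sigma> es)\<rparr>"

definition add_cap :: "signature \<Rightarrow> nat \<Rightarrow> nat list \<Rightarrow> nat list \<Rightarrow> nat list \<Rightarrow> gadget \<Rightarrow> gadget" where
  "add_cap g v D1 C D2 G = G\<lparr>gV := insert v (gV G), gE := gE G \<union> set C, gD := D1 @ D2,
     gsnd := (\<lambda>e. if e \<in> set C then v else gsnd G e),
     gsig := (gsig G)(v := g), gargs := (gargs G)(v := C)\<rparr>"

lemma left_gadgetD:
  assumes "left_gadget F1 F2 G"
  shows "finite (gU G)" "finite (gV G)" "gU G \<inter> gV G = {}" "finite (gE G)" "distinct (gD G)" "gE G \<inter> set (gD G) = {}"
    "\<And>e. e \<in> gE G \<Longrightarrow> gfst G e \<in> gU G" "\<And>e. e \<in> gE G \<Longrightarrow> gsnd G e \<in> gV G"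
    "\<And>e. e \<in> set (gD G) \<Longrightarrow> gfst G e \<in> gU G"
    "\<And>v. v \<in> gU G \<Longrightarrow> gsig G v \<in> F1" "\<And>v. v \<in> gV G \<Longrightarrow> gsig G v \<in> F2"
    "\<And>v. v \<in> gU G \<union> gV G \<Longrightarrow> distinct (gargs G v)" "\<And>v. v \<in> gU G \<union> gV G \<Longrightarrow> set (gargs G v) = edges_at G v"
    "\<And>v. v \<in> gU G \<union> gV G \<Longrightarrow> length (gargs G v) = arity (gsig G v)"
  using assms unfolding left_gadget_def by simp_all

lemma edges_at_subset: "edges_at G v \<subseteq> gE G \<union> set (gD G)"
  by (auto simp: edges_at_def)

lemma left_gadget_add_vertex:
  assumes G: "left_gadget {F} F2 G" and \<sigma>: "\<sigma> permutes {..<arity F}"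
    and u: "u \<notin> gU G \<union> gV G" and es: "distinct es" "length es = arity F" "set es \<inter> (gE G \<union> set (gD G)) = {}"
  shows "left_gadget {F} F2 (add_vertex F \<sigma> u es G)" (is "left_gadget _ _ ?G")
proof -
  note g = left_gadgetD[OF G]
  have sel: "gU ?G = insert u (gU G)" "gV ?G = gV G" "gE ?G = gE G" "gD ?G = gD G @ es" "gsnd ?G = gsnd G"
    "gfst ?G = (\<lambda>e. if e \<in> set es then u else gfst G e)" "gsig ?G = (gsig G)(u := F)"
    "gargs ?G = (gargs G)(u := permute_list \<sigma> es)"
    by (simp_all add: add_vertex_def)
  have "edges_at ?G u = set es"
    using g(7,9) u es(3) unfolding edges_at_def sel by auto
  moreover have "edges_at ?G v = edges_at G v" if "v \<in> gU G \<union> gV G" for v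
    using that u es(3) unfolding edges_at_def sel by auto
  moreover have "distinct (permute_list \<sigma> es)" "set (permute_list \<sigma> es) = set es"
    using \<sigma> es by simp_all
  ultimately show ?thesis
    unfolding left_gadget_def sel using g es u by auto
qed

lemma left_gadget_add_cap:
  assumes G: "left_gadget F1 F2 G" and gF: "g \<in> F2"
    and v: "v \<notin> gU G \<union> gV G" and D: "gD G = D1 @ C @ D2" "length C = arity g"
  shows "left_gadget F1 F2 (add_cap g v D1 C D2 G)" (is "left_gadget _ _ ?G")
proof -
  note g = left_gadgetD[OF G]
  have sel: "gU ?G = gU G" "gV ?G = insert v (gV G)" "gE ?G = gE G \<union> set C" "gD ?G = D1 @ D2" "gfst ?G = gfst G"
    "gsnd ?G = (\<lambda>e. if e \<in> set C then v else gsnd G e)" "gsig ?G = (gsig G)(v := g)"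
    "gargs ?G = (gargs G)(v := C)"
    by (simp_all add: add_cap_def)
  have C: "set C \<inter> gE G = {}" "set C \<subseteq> set (gD G)" "distinct C" "set C \<inter> (set D1 \<union> set D2) = {}" "distinct (D1 @ D2)"
    using g(5,6) D by auto
  have "edges_at ?G v = set C"
    using g(8) v C unfolding edges_at_def sel by auto
  moreover have "edges_at ?G x = edges_at G x" if "x \<in> gU G \<union> gV G" for x
    using that v C D(1) unfolding edges_at_def sel by auto
  ultimately show ?thesis
    unfolding left_gadget_def sel using g D C v gF by auto
qed

lemma gadget_val_add_vertex:
  assumes G: "left_gadget {F} F2 G" and \<sigma>: "\<sigma> permutes {..<arity F}"
    and u: "u \<notin> gU G \<union> gV G" and es: "distinct es" "length es = arity F" "set es \<inter> (gE G \<union> set (gD G)) = {}"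
    and \<alpha>: "length \<alpha> = length (gD G) + arity F"
  shows "gadget_val (add_vertex F \<sigma> u es G) \<alpha> =
    gadget_val G (take (length (gD G)) \<alpha>) * sigval F (permute_list \<sigma> (drop (length (gD G)) \<alpha>))"
    (is "gadget_val ?G \<alpha> = _")
proof -
  note g = left_gadgetD[OF G]
  have sel: "gU ?G = insert u (gU G)" "gV ?G = gV G" "gE ?G = gE G" "gD ?G = gD G @ es"
    "gsig ?G = (gsig G)(u := F)" "gargs ?G = (gargs G)(u := permute_list \<sigma> es)"
    by (simp_all add: add_vertex_def)
  define a where "a = length (gD G)"
  define A where "A = gE G \<union> set (gD G)"
  define \<beta> where "\<beta> = drop a \<alpha>"
  have len\<beta>: "length \<beta> = length es" using \<alpha> es by (simp add: \<beta>_def a_def)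
  have dis: "e \<notin> A" if "e \<in> set es" for e using es(3) that by (auto simp: A_def)
  \<comment> \<open>Restricting an assignment to the old edges loses nothing, since the values on
    the new dangling edges are prescribed by \<open>\<alpha>\<close>; \<open>ex\<close> puts them
    back.\<close>
  define ex where "ex \<tau> e = (case map_of (zip es \<beta>) e of Some b \<Rightarrow> b | None \<Rightarrow> \<tau> e)" for \<tau> :: "nat \<Rightarrow> bool" and e
  have ex_es: "map (ex \<tau>) es = \<beta>" for \<tau>
    using len\<beta> es(1) by (intro nth_equalityI) (auto simp: ex_def map_of_zip_nth)
  have ex_out: "ex \<tau> e = \<tau> e" if "e \<notin> set es" for \<tau> e
  proof -
    have "map_of (zip es \<beta>) e = None" using that len\<beta> by (simp add: map_of_zip_is_None)
    then show ?thesis by (simp add: ex_def)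
  qed
  have ex_A: "map (ex \<tau>) xs = map \<tau> xs" if "set xs \<subseteq> A" for \<tau> xs
    using that dis ex_out by (intro map_cong) auto
  have DA: "set (gD G) \<subseteq> A" by (simp add: A_def)
  let ?S = "{\<tau> \<in> A \<rightarrow>\<^sub>E (UNIV :: bool set). map \<tau> (gD G) = take a \<alpha>}"
  let ?T = "{\<tau> \<in> (A \<union> set es) \<rightarrow>\<^sub>E (UNIV :: bool set). map \<tau> (gD G @ es) = \<alpha>}"
  have split\<alpha>: "map \<tau> (gD G @ es) = \<alpha> \<longleftrightarrow> map \<tau> (gD G) = take a \<alpha> \<and> map \<tau> es = \<beta>" for \<tau>
    unfolding \<beta>_def a_def using append_eq_conv_conj[of "map \<tau> (gD G)" "map \<tau> es" \<alpha>] by auto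
  have w: "(\<Sum>\<tau>\<in>?T. \<Prod>v\<in>insert u (gU G \<union> gV G). sigval (gsig ?G v) (map \<tau> (gargs ?G v))) =
    (\<Sum>\<tau>\<in>?S. sigval F (permute_list \<sigma> \<beta>) * (\<Prod>v\<in>gU G \<union> gV G. sigval (gsig G v) (map \<tau> (gargs G v))))"
  proof (rule sum.reindex_bij_witness[where i = "\<lambda>\<tau>. ex \<tau>" and j = "\<lambda>\<tau>. restrict \<tau> A"])
    fix \<tau> assume t: "\<tau> \<in> ?T"
    then have te: "map \<tau> es = \<beta>" and tD: "map \<tau> (gD G) = take a \<alpha>" using split\<alpha> by auto
    show "ex (restrict \<tau> A) = \<tau>"
    proof
      fix e show "ex (restrict \<tau> A) e = \<tau> e"
      proof (cases "e \<in> set es")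
        case True
        then show ?thesis using ex_es[of "restrict \<tau> A"] te by (metis map_eq_conv)
      next
        case False
        then show ?thesis using t ex_out[OF False] by (auto simp: PiE_def extensional_def restrict_def)
      qed
    qed
    have rA: "map (restrict \<tau> A) xs = map \<tau> xs" if "set xs \<subseteq> A" for xs
      using that by (intro map_cong) auto
    show "restrict \<tau> A \<in> ?S" using tD rA[OF DA] by auto
    have "(\<Prod>v\<in>insert u (gU G \<union> gV G). sigval (gsig ?G v) (map \<tau> (gargs ?G v))) =
      sigval F (map \<tau> (permute_list \<sigma> es)) * (\<Prod>v\<in>gU G \<union> gV G. sigval (gsig ?G v) (map \<tau> (gargs ?G v)))"
      using g(1,2) u by (simp add: sel)
    also have "map \<tau> (permute_list \<sigma> es) = permute_list \<sigma> \<beta>"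
      using \<sigma> es(2) by (simp flip: te add: permute_list_map)
    also have "(\<Prod>v\<in>gU G \<union> gV G. sigval (gsig ?G v) (map \<tau> (gargs ?G v))) =
       (\<Prod>v\<in>gU G \<union> gV G. sigval (gsig G v) (map (restrict \<tau> A) (gargs G v)))"
    proof (rule prod.cong[OF refl])
      fix v assume v: "v \<in> gU G \<union> gV G"
      then have "set (gargs G v) \<subseteq> A" using g(13) edges_at_subset unfolding A_def by metis
      moreover have "v \<noteq> u" using v u by auto
      ultimately show "sigval (gsig ?G v) (map \<tau> (gargs ?G v)) = sigval (gsig G v) (map (restrict \<tau> A) (gargs G v))"
        using rA[of "gargs G v"] by (simp only: sel fun_upd_apply if_False)
    qed
    finally show "sigval F (permute_list \<sigma> \<beta>) * (\<Prod>v\<in>gU G \<union> gV G. sigval (gsig G v) (map (restrict \<tau> A) (gargs G v))) =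
      (\<Prod>v\<in>insert u (gU G \<union> gV G). sigval (gsig ?G v) (map \<tau> (gargs ?G v)))" by simp
  next
    fix \<tau> assume t: "\<tau> \<in> ?S"
    show "restrict (ex \<tau>) A = \<tau>"
    proof
      fix e show "restrict (ex \<tau>) A e = \<tau> e"
        using t dis ex_out[of e \<tau>] by (cases "e \<in> A") (auto simp: PiE_def extensional_def)
    qed
    have "ex \<tau> \<in> (A \<union> set es) \<rightarrow>\<^sub>E UNIV"
      using t ex_out[of _ \<tau>] by (auto simp: PiE_def extensional_def)
    moreover have "map (ex \<tau>) (gD G @ es) = \<alpha>"
      unfolding split\<alpha> using t ex_A[OF DA, of \<tau>] ex_es[of \<tau>] by simp
    ultimately show "ex \<tau> \<in> ?T" by simp
  qed
  show ?thesis
    unfolding gadget_val_def sel(1-4) sum_distrib_right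
    using w unfolding A_def a_def \<beta>_def by (simp add: Un_assoc mult.commute sel)
qed

lemma finite_bool_lists: "finite {\<beta> :: bool list. length \<beta> = k}"
  using finite_lists_length_eq[of "UNIV :: bool set" k] by simp

text \<open>A cap adds no edge; the edges in \<open>C\<close> merely cease to be fixed by
  \<open>\<alpha>\<close>. Grouping the assignments by their values on \<open>C\<close> gives the
  sum.\<close>

lemma gadget_val_add_cap:
  assumes G: "left_gadget F1 F2 G"
    and v: "v \<notin> gU G \<union> gV G" and D: "gD G = D1 @ C @ D2" "length C = arity g"
    and \<alpha>: "length \<alpha> = length D1 + length D2"
  shows "gadget_val (add_cap g v D1 C D2 G) \<alpha> =
    (\<Sum>\<beta> | length \<beta> = arity g. gadget_val G (take (length D1) \<alpha> @ \<beta> @ drop (length D1) \<alpha>) * sigval g \<beta>)"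
    (is "gadget_val ?G \<alpha> = _")
proof -
  note g = left_gadgetD[OF G]
  have sel: "gU ?G = gU G" "gV ?G = insert v (gV G)" "gE ?G = gE G \<union> set C" "gD ?G = D1 @ D2"
    "gsig ?G = (gsig G)(v := g)" "gargs ?G = (gargs G)(v := C)"
    by (simp_all add: add_cap_def)
  define A where "A = gE G \<union> set (gD G)"
  have finA: "finite A" using g(4) by (simp add: A_def)
  have A': "(gE G \<union> set C) \<union> set (D1 @ D2) = A" using D by (auto simp: A_def)
  let ?S = "{\<tau> \<in> A \<rightarrow>\<^sub>E (UNIV :: bool set). map \<tau> (D1 @ D2) = \<alpha>}"
  let ?T = "{\<beta> :: bool list. length \<beta> = arity g}"
  let ?P = "\<lambda>\<tau>. \<Prod>v\<in>gU G \<union> gV G. sigval (gsig G v) (map \<tau> (gargs G v))"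
  have "finite (A \<rightarrow>\<^sub>E (UNIV :: bool set))" using finA by (intro finite_PiE) auto
  then have finS: "finite ?S" by simp
  have "gadget_val ?G \<alpha> = (\<Sum>\<tau>\<in>?S. sigval g (map \<tau> C) * ?P \<tau>)"
  proof -
    have "(\<Prod>x\<in>gU G \<union> insert v (gV G). sigval (gsig ?G x) (map \<tau> (gargs ?G x))) = sigval g (map \<tau> C) * ?P \<tau>" for \<tau>
    proof -
      have "(\<Prod>x\<in>gU G \<union> insert v (gV G). sigval (gsig ?G x) (map \<tau> (gargs ?G x))) =
        (\<Prod>x\<in>insert v (gU G \<union> gV G). sigval (gsig ?G x) (map \<tau> (gargs ?G x)))" by simp
      also have "\<dots> = sigval g (map \<tau> C) * (\<Prod>x\<in>gU G \<union> gV G. sigval (gsig ?G x) (map \<tau> (gargs ?G x)))"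
        using g(1,2) v by (simp add: sel)
      also have "(\<Prod>x\<in>gU G \<union> gV G. sigval (gsig ?G x) (map \<tau> (gargs ?G x))) = ?P \<tau>"
        using v by (intro prod.cong) (auto simp: sel)
      finally show ?thesis .
    qed
    then show ?thesis unfolding gadget_val_def sel(1-4) A' by simp
  qed
  also have "\<dots> = (\<Sum>\<beta>\<in>?T. \<Sum>\<tau>\<in>{\<tau> \<in> ?S. map \<tau> C = \<beta>}. sigval g (map \<tau> C) * ?P \<tau>)"
    by (rule sum.group[OF finS finite_bool_lists, symmetric]) (use D in auto)
  also have "\<dots> = (\<Sum>\<beta>\<in>?T. gadget_val G (take (length D1) \<alpha> @ \<beta> @ drop (length D1) \<alpha>) * sigval g \<beta>)"
  proof (rule sum.cong[OF refl])
    fix \<beta> :: "bool list" assume b: "\<beta> \<in> ?T"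
    have seteq: "{\<tau> \<in> ?S. map \<tau> C = \<beta>} = {\<tau> \<in> A \<rightarrow>\<^sub>E UNIV. map \<tau> (gD G) = take (length D1) \<alpha> @ \<beta> @ drop (length D1) \<alpha>}"
    proof -
      have "map \<tau> (D1 @ D2) = \<alpha> \<and> map \<tau> C = \<beta> \<longleftrightarrow> map \<tau> (gD G) = take (length D1) \<alpha> @ \<beta> @ drop (length D1) \<alpha>" for \<tau>
        using \<alpha> b D append_eq_conv_conj[of "map \<tau> D1" "map \<tau> D2" \<alpha>] by (auto simp: append_eq_append_conv)
      then show ?thesis by auto
    qed
    then have "(\<Sum>\<tau>\<in>{\<tau> \<in> ?S. map \<tau> C = \<beta>}. sigval g (map \<tau> C) * ?P \<tau>) =
       (\<Sum>\<tau>\<in>{\<tau> \<in> ?S. map \<tau> C = \<beta>}. ?P \<tau> * sigval g \<beta>)"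
      by (intro sum.cong) auto
    also have "\<dots> = gadget_val G (take (length D1) \<alpha> @ \<beta> @ drop (length D1) \<alpha>) * sigval g \<beta>"
      unfolding seteq unfolding gadget_val_def A_def sum_distrib_right ..
    finally show "(\<Sum>\<tau>\<in>{\<tau> \<in> ?S. map \<tau> C = \<beta>}. sigval g (map \<tau> C) * ?P \<tau>) =
      gadget_val G (take (length D1) \<alpha> @ \<beta> @ drop (length D1) \<alpha>) * sigval g \<beta>" .
  qed
  finally show ?thesis .
qed

section \<open>Drawings above a horizontal line\<close>

abbreviation normal_edge_drawn :: "complex set \<Rightarrow> real \<Rightarrow> complex \<Rightarrow> complex \<Rightarrow> (real \<Rightarrow> complex) \<Rightarrow> bool" where
  "normal_edge_drawn P L a b c \<equiv> arc c \<and> pathstart c = a \<and> pathfinish c = b \<and>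
     path_image c \<inter> P = {a, b} \<and> path_image c \<subseteq> {z. L < Im z}"

text \<open>The arc reaches the line only in its free end, so whatever is appended below the line
  can meet it there only.\<close>

abbreviation dangling_edge_drawn :: "complex set \<Rightarrow> real \<Rightarrow> complex \<Rightarrow> (real \<Rightarrow> complex) \<Rightarrow> bool" where
  "dangling_edge_drawn P L a c \<equiv> arc c \<and> pathstart c = a \<and> path_image c \<inter> P = {a} \<and>
     path_image c \<subseteq> {z. L \<le> Im z} \<and> path_image c \<inter> {z. Im z = L} = {pathfinish c}"

text \<open>The part of the plane below height \<open>L\<close> is free for the next step of the construction.\<close>

definition drawn :: "gadget \<Rightarrow> (nat \<Rightarrow> complex) \<Rightarrow> (nat \<Rightarrow> real \<Rightarrow> complex) \<Rightarrow> real \<Rightarrow> bool" where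
  "drawn G p c L \<longleftrightarrow>
     inj_on p (gU G \<union> gV G) \<and> (\<forall>v\<in>gU G \<union> gV G. L < Im (p v)) \<and>
     (\<forall>e\<in>gE G. normal_edge_drawn (p ` (gU G \<union> gV G)) L (p (gfst G e)) (p (gsnd G e)) (c e)) \<and>
     (\<forall>e\<in>set (gD G). dangling_edge_drawn (p ` (gU G \<union> gV G)) L (p (gfst G e)) (c e)) \<and>
     sorted_wrt (\<lambda>e e'. Re (pathfinish (c e)) < Re (pathfinish (c e'))) (gD G) \<and>
     (\<forall>e\<in>gE G \<union> set (gD G). \<forall>e'\<in>gE G \<union> set (gD G).
        e \<noteq> e' \<longrightarrow> path_image (c e) \<inter> path_image (c e') \<subseteq> p ` (gU G \<union> gV G))"

lemma drawnD:
  assumes "drawn G p c L"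
  shows "inj_on p (gU G \<union> gV G)" "\<And>v. v \<in> gU G \<union> gV G \<Longrightarrow> L < Im (p v)"
    "\<And>e. e \<in> gE G \<union> set (gD G) \<Longrightarrow> arc (c e)" "\<And>e. e \<in> gE G \<union> set (gD G) \<Longrightarrow> pathstart (c e) = p (gfst G e)"
    "\<And>e. e \<in> gE G \<Longrightarrow> pathfinish (c e) = p (gsnd G e)"
    "\<And>e. e \<in> gE G \<Longrightarrow> path_image (c e) \<inter> p ` (gU G \<union> gV G) = {p (gfst G e), p (gsnd G e)}"
    "\<And>e. e \<in> gE G \<Longrightarrow> path_image (c e) \<subseteq> {z. L < Im z}"
    "\<And>e. e \<in> set (gD G) \<Longrightarrow> path_image (c e) \<inter> p ` (gU G \<union> gV G) = {p (gfst G e)}"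
    "\<And>e. e \<in> set (gD G) \<Longrightarrow> path_image (c e) \<subseteq> {z. L \<le> Im z}"
    "\<And>e. e \<in> set (gD G) \<Longrightarrow> path_image (c e) \<inter> {z. Im z = L} = {pathfinish (c e)}"
    "sorted_wrt (\<lambda>e e'. Re (pathfinish (c e)) < Re (pathfinish (c e'))) (gD G)"
    "\<And>e e'. e \<in> gE G \<union> set (gD G) \<Longrightarrow> e' \<in> gE G \<union> set (gD G) \<Longrightarrow> e \<noteq> e' \<Longrightarrow>
      path_image (c e) \<inter> path_image (c e') \<subseteq> p ` (gU G \<union> gV G)"
proof -
  note dd = assms[unfolded drawn_def]
  have a1: "(\<forall>v\<in>gU G \<union> gV G. L < Im (p v))" using dd by (elim conjE)
  have a2: "(\<forall>e\<in>gE G. normal_edge_drawn (p ` (gU G \<union> gV G)) L (p (gfst G e)) (p (gsnd G e)) (c e))" using dd by (elim conjE)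
  have a3: "(\<forall>e\<in>set (gD G). dangling_edge_drawn (p ` (gU G \<union> gV G)) L (p (gfst G e)) (c e))" using dd by (elim conjE)
  have a4: "(\<forall>e\<in>gE G \<union> set (gD G). \<forall>e'\<in>gE G \<union> set (gD G).
        e \<noteq> e' \<longrightarrow> path_image (c e) \<inter> path_image (c e') \<subseteq> p ` (gU G \<union> gV G))" using dd by (elim conjE)
  show "inj_on p (gU G \<union> gV G)" using dd by (elim conjE)
  show "sorted_wrt (\<lambda>e e'. Re (pathfinish (c e)) < Re (pathfinish (c e'))) (gD G)" using dd by (elim conjE)
  show "\<And>v. v \<in> gU G \<union> gV G \<Longrightarrow> L < Im (p v)" using a1 by (rule bspec)
  show "\<And>e. e \<in> gE G \<union> set (gD G) \<Longrightarrow> arc (c e)" "\<And>e. e \<in> gE G \<union> set (gD G) \<Longrightarrow> pathstart (c e) = p (gfst G e)"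
    using a2 a3 by auto
  show "\<And>e e'. e \<in> gE G \<union> set (gD G) \<Longrightarrow> e' \<in> gE G \<union> set (gD G) \<Longrightarrow> e \<noteq> e' \<Longrightarrow>
      path_image (c e) \<inter> path_image (c e') \<subseteq> p ` (gU G \<union> gV G)"
    using a4 by metis
  show "\<And>e. e \<in> gE G \<Longrightarrow> pathfinish (c e) = p (gsnd G e)"
    "\<And>e. e \<in> gE G \<Longrightarrow> path_image (c e) \<inter> p ` (gU G \<union> gV G) = {p (gfst G e), p (gsnd G e)}"
    "\<And>e. e \<in> gE G \<Longrightarrow> path_image (c e) \<subseteq> {z. L < Im z}"
    using a2 by simp_all
  show "\<And>e. e \<in> set (gD G) \<Longrightarrow> path_image (c e) \<inter> p ` (gU G \<union> gV G) = {p (gfst G e)}"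
    "\<And>e. e \<in> set (gD G) \<Longrightarrow> path_image (c e) \<subseteq> {z. L \<le> Im z}"
    "\<And>e. e \<in> set (gD G) \<Longrightarrow> path_image (c e) \<inter> {z. Im z = L} = {pathfinish (c e)}"
    using a3 by simp_all
qed

text \<open>Vertices and normal edges lie in an open half-plane. As this is convex, its complement,
  which contains all free ends, belongs to the outside.\<close>

lemma drawn_planar_gadget:
  assumes "drawn G p c L" shows "planar_gadget G"
proof -
  note d = drawnD[OF assms]
  let ?P = "p ` (gU G \<union> gV G)"
  let ?S = "?P \<union> (\<Union>e\<in>gE G. path_image (c e))"
  have S: "?S \<subseteq> {z. L < Im z}" using d(2,7) by blast
  have "- {z. L < Im z} \<subseteq> outside ?S"
    by (rule outside_subset_convex[OF _ S]) (rule convex_halfspace_Im_gt)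
  moreover have "pathfinish (c e) \<in> - {z. L < Im z}" if "e \<in> set (gD G)" for e
    using d(10)[OF that] by auto
  ultimately have out: "pathfinish (c e) \<in> outside ?S" if "e \<in> set (gD G)" for e using that by blast
  show ?thesis
    unfolding planar_gadget_def Let_def
    by (intro exI[of _ p] exI[of _ c] conjI ballI impI d out) auto
qed

text \<open>Secures room to the right of the drawing for the next vertex.\<close>

lemma drawn_bounded:
  assumes G: "left_gadget F1 F2 G" and dr: "drawn G p c L"
  shows "\<exists>M. (\<forall>v\<in>gU G \<union> gV G. Re (p v) < M) \<and> (\<forall>e\<in>gE G \<union> set (gD G). \<forall>z\<in>path_image (c e). Re z < M)"
proof -
  note g = left_gadgetD[OF G] and d = drawnD[OF dr]
  let ?S = "p ` (gU G \<union> gV G) \<union> (\<Union>e\<in>gE G \<union> set (gD G). path_image (c e))"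
  have "bounded (p ` (gU G \<union> gV G))" using g(1,2) by (intro finite_imp_bounded) simp
  moreover have "bounded (\<Union>e\<in>gE G \<union> set (gD G). path_image (c e))"
  proof (rule bounded_UN)
    show "\<forall>e\<in>gE G \<union> set (gD G). bounded (path_image (c e))"
      using d(3) bounded_path_image arc_imp_path by metis
  qed (use g(4) in simp)
  ultimately have "bounded ?S" by simp
  then obtain B where B: "\<And>z. z \<in> ?S \<Longrightarrow> norm z \<le> B" unfolding bounded_iff by blast
  have "Re z < B + 1" if "z \<in> ?S" for z
    using B[OF that] complex_Re_le_cmod[of z] by linarith
  then show ?thesis by (intro exI[of _ "B + 1"]) blast
qed

text \<open>The new vertex is placed to the right of all edges and vertices, with a fan of segments
  down to the line. Edge number \<open>e\<close> ends at abscissa \<open>M + 1 + real e\<close>, so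
  consecutive numbers arrive from left to right, in the order of the dangling edges.\<close>

lemma drawn_add_vertex:
  assumes G: "left_gadget {F} F2 G" and dr: "drawn G p c L"
    and u: "u \<notin> gU G \<union> gV G" and es: "set [N..<N + k] \<inter> (gE G \<union> set (gD G)) = {}"
  shows "\<exists>p c. drawn (add_vertex F \<sigma> u [N..<N + k] G) p c L"
proof -
  let ?es = "[N..<N + k]"
  let ?G = "add_vertex F \<sigma> u ?es G"
  note g = left_gadgetD[OF G] and d = drawnD[OF dr]
  have sel: "gU ?G = insert u (gU G)" "gV ?G = gV G" "gE ?G = gE G" "gD ?G = gD G @ ?es" "gsnd ?G = gsnd G"
    "gfst ?G = (\<lambda>e. if e \<in> set ?es then u else gfst G e)"
    by (simp_all add: add_vertex_def)
  obtain M where M: "\<And>v. v \<in> gU G \<union> gV G \<Longrightarrow> Re (p v) < M"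
    "\<And>e z. e \<in> gE G \<union> set (gD G) \<Longrightarrow> z \<in> path_image (c e) \<Longrightarrow> Re z < M"
    using drawn_bounded[OF G dr] by blast
  define q where "q = Complex M (L + 1)"
  define p' where "p' = p(u := q)"
  define c' where "c' e = (if e \<in> set ?es then linepath q (Complex (M + 1 + real e) L) else c e)" for e
  let ?V = "gU G \<union> gV G" and ?E = "gE G \<union> set (gD G)"
  have pP: "p' ` (insert u (gU G) \<union> gV G) = insert q (p ` ?V)"
    using u by (auto simp: p'_def)
  have p'u: "p' u = q" and p'o: "\<And>v. v \<in> ?V \<Longrightarrow> p' v = p v" using u by (auto simp: p'_def)
  have qo: "q \<notin> p ` ?V"
  proof
    assume "q \<in> p ` ?V"
    then obtain v where "v \<in> ?V" "q = p v" by (rule imageE) simp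
    then show False using M(1)[of v] by (simp flip: \<open>q = p v\<close> add: q_def)
  qed
  have co: "c' e = c e" "e \<notin> set ?es" if "e \<in> ?E" for e using that es by (auto simp: c'_def)
  have seg: "M \<le> Re z" "L \<le> Im z" "Im z = L \<Longrightarrow> z = Complex (M + 1 + real e) L"
      "Im z = L + 1 - (Re z - M) / (1 + real e)"
    if "e \<in> set ?es" "z \<in> path_image (c' e)" for e z
  proof -
    have "z \<in> closed_segment (Complex M (L + 1)) (Complex (M + 1 + real e) L)"
      using that by (simp add: c'_def q_def)
    then obtain t where t0: "0 \<le> t" "t \<le> 1" "Re z = M + t * (M + 1 + real e - M)" "Im z = L + 1 + t * (L - (L + 1))"
      using Complex_segment_points by blast
    then have t: "0 \<le> t" "t \<le> 1" "Re z = M + t * (1 + real e)" "Im z = L + 1 - t" by (simp_all add: algebra_simps)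
    show "M \<le> Re z" "L \<le> Im z" "Im z = L + 1 - (Re z - M) / (1 + real e)" using t by auto
    show "z = Complex (M + 1 + real e) L" if "Im z = L" using t that by (simp add: complex_eq_iff)
  qed
  have qn: "q \<notin> path_image (c e)" if "e \<in> ?E" for e using M(2)[OF that, of q] by (auto simp: q_def)
  have fin: "pathfinish (c' e) = Complex (M + 1 + real e) L" "pathstart (c' e) = q" "arc (c' e)" if "e \<in> set ?es" for e
    using that by (auto simp: c'_def q_def complex_eq_iff intro!: arc_linepath)
  have inj: "inj_on p' (insert u (gU G) \<union> gV G)"
  proof -
    have "inj_on p' ?V" using d(1) p'o by (simp add: inj_on_def)
    moreover have "p' u \<notin> p' ` ?V" using qo p'o p'u by auto
    ultimately show ?thesis using u by (simp add: inj_on_insert)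
  qed
  have E1: "normal_edge_drawn (insert q (p ` ?V)) L (p' (gfst ?G e)) (p' (gsnd ?G e)) (c' e)"
    if "e \<in> gE G" for e
    using that co[of e] d(3)[of e] d(4)[of e] d(5,6,7)[of e] g(7,8)[of e] p'o qn[of e] by (auto simp: sel)
  have D1: "dangling_edge_drawn (insert q (p ` ?V)) L (p' (gfst ?G e)) (c' e)"
    if "e \<in> set (gD G)" for e
    using that co[of e] d(3)[of e] d(4)[of e] d(8,9,10)[of e] g(9)[of e] p'o qn[of e] by (auto simp: sel)
  have D2: "dangling_edge_drawn (insert q (p ` ?V)) L (p' (gfst ?G e)) (c' e)"
    if "e \<in> set ?es" for e
  proof -
    have 1: "gfst ?G e = u" using that by (simp add: sel)
    have "z \<notin> p ` ?V" if "z \<in> path_image (c' e)" for z using seg(1)[OF \<open>e \<in> set ?es\<close> that] M(1) by force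
    moreover have "q \<in> path_image (c' e)" using fin(2)[OF that] pathstart_in_path_image by metis
    ultimately have 2: "path_image (c' e) \<inter> insert q (p ` ?V) = {q}" by blast
    have "pathfinish (c' e) \<in> path_image (c' e)" by (rule pathfinish_in_path_image)
    moreover have "Im (pathfinish (c' e)) = L" using fin(1)[OF that] by simp
    moreover have "z = pathfinish (c' e)" if "z \<in> path_image (c' e)" "Im z = L" for z
      using seg(3)[OF \<open>e \<in> set ?es\<close> that] fin(1)[OF \<open>e \<in> set ?es\<close>] by (simp only:)
    ultimately have 3: "path_image (c' e) \<inter> {z. Im z = L} = {pathfinish (c' e)}" by blast
    have 4: "path_image (c' e) \<subseteq> {z. L \<le> Im z}" using seg(2)[OF that] by blast
    show ?thesis using fin[OF that] 1 2 3 4 p'u by simp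
  qed
  have new_new: "path_image (c' e) \<inter> path_image (c' e') \<subseteq> {q}" if "e \<in> set ?es" "e' \<in> set ?es" "e \<noteq> e'" for e e'
  proof
    fix z assume z: "z \<in> path_image (c' e) \<inter> path_image (c' e')"
    then have zi: "z \<in> path_image (c' e)" "z \<in> path_image (c' e')" by auto
    have "(Re z - M) / (1 + real e) = (Re z - M) / (1 + real e')"
      using seg(4)[OF that(1) zi(1)] seg(4)[OF that(2) zi(2)] by linarith
    then have "Re z = M" using that(3) by (auto simp: field_simps)
    moreover from this have "Im z = L + 1" using seg(4)[OF that(1), of z] z by simp
    ultimately show "z \<in> {q}" by (simp add: q_def complex_eq_iff)
  qed
  have new_old: "path_image (c' e) \<inter> path_image (c' e') = {}" if "e \<in> set ?es" "e' \<in> ?E" for e e'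
    using seg(1)[OF that(1)] M(2)[OF that(2)] co[OF that(2)] by force
  have pw: "path_image (c' e) \<inter> path_image (c' e') \<subseteq> insert q (p ` ?V)"
    if "e \<in> gE G \<union> set (gD G @ ?es)" "e' \<in> gE G \<union> set (gD G @ ?es)" "e \<noteq> e'" for e e'
  proof -
    have pre: "e \<in> ?E \<or> e \<in> set ?es" "e' \<in> ?E \<or> e' \<in> set ?es" using that by auto
    consider "e \<in> ?E" "e' \<in> ?E" | "e \<in> ?E" "e' \<in> set ?es" | "e \<in> set ?es" "e' \<in> ?E" | "e \<in> set ?es" "e' \<in> set ?es"
      using pre by argo
    then show ?thesis
    proof cases
      case 1 then show ?thesis using d(12)[OF 1 that(3)] co(1)[OF 1(1)] co(1)[OF 1(2)] by auto
    next
      case 2 then show ?thesis using new_old[OF 2(2,1)] by auto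
    next
      case 3 then show ?thesis using new_old[OF 3] by auto
    next
      case 4 then show ?thesis using new_new[OF 4 that(3)] by auto
    qed
  qed
  have srt: "sorted_wrt (\<lambda>e e'. Re (pathfinish (c' e)) < Re (pathfinish (c' e'))) (gD G @ ?es)"
  proof -
    have "sorted_wrt (\<lambda>e e'. Re (pathfinish (c' e)) < Re (pathfinish (c' e'))) (gD G)"
      by (rule sorted_wrt_mono_rel[OF _ d(11)]) (use co(1) in auto)
    moreover have "sorted_wrt (\<lambda>e e'. Re (pathfinish (c' e)) < Re (pathfinish (c' e'))) ?es"
      by (rule sorted_wrt_mono_rel[OF _ sorted_wrt_upt]) (use fin(1) in auto)
    moreover have "Re (pathfinish (c' e)) < Re (pathfinish (c' e'))" if "e \<in> set (gD G)" "e' \<in> set ?es" for e e'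
    proof -
      have "Re (pathfinish (c e)) < M" using M(2)[of e "pathfinish (c e)"] that pathfinish_in_path_image[of "c e"] by simp
      then show ?thesis using co(1)[of e] fin(1)[OF that(2)] that by simp
    qed
    ultimately show ?thesis unfolding sorted_wrt_append by blast
  qed
  have Imv: "L < Im (p' v)" if "v \<in> insert u (gU G) \<union> gV G" for v
    using that d(2) p'o p'u by (auto simp: q_def)
  have EE: "\<forall>e\<in>gE G. normal_edge_drawn (insert q (p ` ?V)) L (p' (gfst ?G e)) (p' (gsnd ?G e)) (c' e)"
    by (rule ballI) (erule E1)
  have DD: "\<forall>e\<in>set (gD G @ ?es). dangling_edge_drawn (insert q (p ` ?V)) L (p' (gfst ?G e)) (c' e)"
    unfolding set_append ball_Un by (rule conjI; rule ballI) (erule D1, erule D2)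
  have "drawn ?G p' c' L"
    unfolding drawn_def sel(1-4) pP
    by (intro conjI inj EE DD srt) (intro ballI Imv, assumption, intro ballI impI pw, assumption+)
  then show ?thesis by blast
qed


text \<open>The edges in \<open>C\<close> are led by segments to a new vertex half a unit below the
  leftmost of their ends, all other dangling edges vertically down to the new line one unit below.
  No vertical segment enters the fan, because the ends of \<open>C\<close> are consecutive on the
  old line.\<close>

lemma drawn_add_cap:
  assumes G: "left_gadget F1 F2 G" and dr: "drawn G p c L"
    and v: "v \<notin> gU G \<union> gV G" and D: "gD G = D1 @ C @ D2" "C \<noteq> []"
  shows "\<exists>p c. drawn (add_cap g v D1 C D2 G) p c (L - 1)"
proof -
  let ?G = "add_cap g v D1 C D2 G"
  note g = left_gadgetD[OF G] and d = drawnD[OF dr]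
  have sel: "gU ?G = gU G" "gV ?G = insert v (gV G)" "gE ?G = gE G \<union> set C" "gD ?G = D1 @ D2" "gfst ?G = gfst G"
    "gsnd ?G = (\<lambda>e. if e \<in> set C then v else gsnd G e)"
    by (simp_all add: add_cap_def)
  let ?V = "gU G \<union> gV G" and ?D = "set (gD G)"
  have setD: "?D = set D1 \<union> set C \<union> set D2" using D by auto
  have dist: "set C \<inter> (set D1 \<union> set D2) = {}" "set C \<inter> gE G = {}" "?D \<inter> gE G = {}"
    using g(5,6) D by auto
  define X where "X e = Re (pathfinish (c e))" for e
  define c0 where "c0 = hd C"
  have c0: "c0 \<in> set C" using D(2) by (simp add: c0_def)
  define q where "q = Complex (X c0) (L - 1/2)"
  define tgt where "tgt e = (if e \<in> set C then q else Complex (X e) (L - 1))" for e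
  define c' where "c' e = (if e \<in> ?D then c e +++ linepath (pathfinish (c e)) (tgt e) else c e)" for e
  define p' where "p' = p(v := q)"
  have p'v: "p' v = q" and p'o: "\<And>x. x \<in> ?V \<Longrightarrow> p' x = p x" using v by (auto simp: p'_def)
  have pP: "p' ` (gU G \<union> insert v (gV G)) = insert q (p ` ?V)" using v by (auto simp: p'_def)
  have fin: "pathfinish (c e) = Complex (X e) L" if "e \<in> ?D" for e
    using d(10)[OF that] by (auto simp: X_def complex_eq_iff)
  have srt: "sorted_wrt (\<lambda>e e'. X e < X e') (D1 @ C @ D2)" using d(11) D(1) by (simp add: X_def)
  have Xinj: "e = e'" if "e \<in> ?D" "e' \<in> ?D" "X e = X e'" for e e'
  proof -
    obtain i j where ij: "i < length (gD G)" "gD G ! i = e" "j < length (gD G)" "gD G ! j = e'"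
      using \<open>e \<in> ?D\<close> \<open>e' \<in> ?D\<close> by (metis in_set_conv_nth)
    have "\<not> i < j" "\<not> j < i" using sorted_wrt_nth_less[OF srt[folded D(1)], of i j] sorted_wrt_nth_less[OF srt[folded D(1)], of j i] ij that by auto
    then show ?thesis using ij by auto
  qed
  have Xc0: "X c0 \<le> X e" if "e \<in> set C" for e
  proof -
    have "sorted_wrt (\<lambda>e e'. X e < X e') (hd C # tl C)" using srt D(2) by (simp add: sorted_wrt_append)
    moreover have "e = hd C \<or> e \<in> set (tl C)" using that D(2) by (metis list.collapse set_ConsD)
    ultimately show ?thesis unfolding c0_def by auto
  qed
  have Xout: "X e < X c0 \<or> (\<forall>e'\<in>set C. X e' < X e)" if "e \<in> set D1 \<union> set D2" for e
    using srt that c0 by (auto simp: sorted_wrt_append)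
  define seg where "seg e = closed_segment (Complex (X e) L) (tgt e)" for e
  have segC: "X c0 \<le> Re z" "Re z \<le> X e" "L - 1/2 \<le> Im z" "Im z \<le> L" "Re z = X e + 2 * (L - Im z) * (X c0 - X e)"
    if "e \<in> set C" "z \<in> seg e" for e z
  proof -
    have "z \<in> closed_segment (Complex (X e) L) (Complex (X c0) (L - 1/2))"
      using that by (simp add: seg_def tgt_def q_def)
    then obtain t where t: "0 \<le> t" "t \<le> 1" "Re z = X e + t * (X c0 - X e)" "Im z = L + t * (L - 1/2 - L)"
      using Complex_segment_points by blast
    have le: "X c0 - X e \<le> 0" using Xc0[OF that(1)] by simp
    have "t * (X c0 - X e) \<le> 0" using le t(1) by (simp add: mult_nonneg_nonpos)
    then show "Re z \<le> X e" using t by simp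
    have "1 * (X c0 - X e) \<le> t * (X c0 - X e)" using le t(2) by (intro mult_right_mono_neg)
    then show "X c0 \<le> Re z" using t by simp
    show "L - 1/2 \<le> Im z" "Im z \<le> L" using t by auto
    have "t = 2 * (L - Im z)" using t(4) by simp
    then show "Re z = X e + 2 * (L - Im z) * (X c0 - X e)" using t(3) by simp
  qed
  have segD: "Re z = X e" "L - 1 \<le> Im z" "Im z \<le> L" if "e \<notin> set C" "z \<in> seg e" for e z
  proof -
    have "z \<in> closed_segment (Complex (X e) L) (Complex (X e) (L - 1))"
      using that by (simp add: seg_def tgt_def)
    then obtain t where t: "0 \<le> t" "t \<le> 1" "Re z = X e + t * (X e - X e)" "Im z = L + t * (L - 1 - L)"
      using Complex_segment_points by blast
    then show "Re z = X e" "L - 1 \<le> Im z" "Im z \<le> L" by auto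
  qed
  have segL: "z = Complex (X e) L" if "z \<in> seg e" "Im z = L" for e z
    using segC(5)[of e z] segD(1)[of e z] that by (cases "e \<in> set C") (auto simp: complex_eq_iff)
  have segIm: "L - 1 \<le> Im z" "Im z \<le> L" if "z \<in> seg e" for e z
    using segC(3,4)[of e z] segD(2,3)[of e z] that by (cases "e \<in> set C"; simp)+
  have img: "path_image (c' e) = path_image (c e) \<union> seg e" if "e \<in> ?D" for e
    using that fin[OF that] by (simp add: c'_def path_image_join seg_def)
  have imgE: "c' e = c e" if "e \<in> gE G" for e using that dist by (auto simp: c'_def)
  have tgtI: "tgt e \<in> seg e" "Im (tgt e) < L" for e by (auto simp: seg_def tgt_def q_def)
  have old_seg: "e = e' \<and> z = Complex (X e) L"
    if "z \<in> path_image (c e)" "z \<in> seg e'" "e \<in> gE G \<union> ?D" "e' \<in> ?D" for z e e'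
  proof -
    have Imz: "Im z \<le> L" using segIm(2) that(2) by blast
    show ?thesis
    proof (cases "e \<in> ?D")
      case False
      then show ?thesis using d(7)[of e] that(1,3) Imz by auto
    next
      case True
      have iz: "Im z = L" using d(9)[OF True] that(1) Imz by auto
      then have "z = pathfinish (c e)" using d(10)[OF True] that(1) by auto
      then have "z = Complex (X e) L" using fin[OF True] by simp
      moreover have "z = Complex (X e') L" using segL[OF that(2) iz] .
      ultimately show ?thesis using Xinj[OF True that(4)] by simp
    qed
  qed
  have seg_seg: "z = q \<and> e \<in> set C \<and> e' \<in> set C" if "z \<in> seg e" "z \<in> seg e'" "e \<in> ?D" "e' \<in> ?D" "e \<noteq> e'" for z e e'
  proof -
    have mixed: False if "z \<in> seg a" "z \<in> seg b" "a \<in> set C" "b \<in> set D1 \<union> set D2" for a b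
      using segC(1,2)[OF that(3,1)] segD(1)[OF _ that(2)] Xout[OF that(4)] that(3,4) dist(1) by fastforce
    have "e \<in> set C \<or> e \<in> set D1 \<union> set D2" "e' \<in> set C \<or> e' \<in> set D1 \<union> set D2" using that setD by auto
    moreover have False if "e \<notin> set C" "e' \<notin> set C"
    proof -
      have "X e = X e'" using segD(1)[OF that(1) \<open>z \<in> seg e\<close>] segD(1)[OF that(2) \<open>z \<in> seg e'\<close>] by simp
      then show False using Xinj[OF \<open>e \<in> ?D\<close> \<open>e' \<in> ?D\<close>] \<open>e \<noteq> e'\<close> by blast
    qed
    ultimately have CC: "e \<in> set C" "e' \<in> set C" using mixed[OF that(1,2)] mixed[OF that(2,1)] by blast+
    have "X e + 2 * (L - Im z) * (X c0 - X e) = X e' + 2 * (L - Im z) * (X c0 - X e')"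
      using segC(5)[OF CC(1) that(1)] segC(5)[OF CC(2) that(2)] by simp
    then have "(X e - X e') * (1 - 2 * (L - Im z)) = 0" by (simp add: algebra_simps)
    moreover have "X e \<noteq> X e'" using Xinj[OF that(3,4)] that(5) by blast
    ultimately have "Im z = L - 1/2" by simp
    then show ?thesis using segC(5)[OF CC(1) that(1)] CC by (simp add: q_def complex_eq_iff)
  qed
  have q_old: "q \<notin> path_image (c e)" if "e \<in> gE G \<union> ?D" for e
  proof
    assume "q \<in> path_image (c e)"
    then have "L \<le> Im q" using d(7)[of e] d(9)[of e] that by fastforce
    then show False by (simp add: q_def)
  qed
  have q_seg: "q \<in> seg e \<longleftrightarrow> e \<in> set C" if "e \<in> ?D" for e
  proof
    assume "q \<in> seg e"
    show "e \<in> set C"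
    proof (rule ccontr)
      assume "e \<notin> set C"
      moreover have "q \<in> seg c0" using tgtI(1)[of c0] c0 by (simp add: tgt_def)
      ultimately show False using seg_seg[of q e c0] \<open>q \<in> seg e\<close> that c0 setD by blast
    qed
  next
    assume "e \<in> set C" then show "q \<in> seg e" using tgtI(1)[of e] by (simp add: tgt_def)
  qed
  have P_seg: "p ` ?V \<inter> seg e = {}" for e
    using d(2) segIm(2) by force
  have arc': "arc (c' e)" "pathstart (c' e) = p (gfst G e)" "pathfinish (c' e) = tgt e" if "e \<in> ?D" for e
  proof -
    have ne: "Complex (X e) L \<noteq> tgt e" using tgtI(2)[of e] by (metis complex.sel(2) less_irrefl)
    have "path_image (c e) \<inter> seg e \<subseteq> {Complex (X e) L}" using old_seg[of _ e e] that by auto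
    then show "arc (c' e)" using that d(3)[of e] fin[OF that] ne
      by (auto simp: c'_def seg_def intro!: arc_join arc_linepath)
    show "pathstart (c' e) = p (gfst G e)" "pathfinish (c' e) = tgt e" using that d(4)[of e] by (auto simp: c'_def)
  qed
  have inV: "gfst G e \<in> ?V" if "e \<in> gE G \<union> ?D" for e using g(7,9) that by auto
  have E1: "normal_edge_drawn (insert q (p ` ?V)) (L - 1) (p' (gfst G e)) (p' (gsnd ?G e)) (c' e)"
    if "e \<in> gE G" for e
  proof -
    have 1: "gsnd ?G e = gsnd G e" "gsnd G e \<in> ?V" using that dist(2) g(8) by (auto simp: sel)
    have "path_image (c e) \<subseteq> {z. L - 1 < Im z}" using d(7)[OF that] by auto
    then show ?thesis
      using that d(3)[of e] d(4)[of e] d(5,6)[OF that] imgE[OF that] q_old[of e] inV[of e] 1 p'o by auto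
  qed
  have E2: "normal_edge_drawn (insert q (p ` ?V)) (L - 1) (p' (gfst G e)) (p' (gsnd ?G e)) (c' e)"
    if e: "e \<in> set C" for e
  proof -
    have eD: "e \<in> ?D" using e setD by auto
    have 1: "gsnd ?G e = v" "tgt e = q" using e by (auto simp: sel tgt_def)
    have 2: "path_image (c' e) \<inter> insert q (p ` ?V) = {p (gfst G e), q}"
      unfolding img[OF eD] using q_seg[OF eD] e P_seg[of e] d(8)[OF eD] by blast
    have "path_image (c' e) \<subseteq> {z. L - 1 < Im z}"
      unfolding img[OF eD] using d(9)[OF eD] segC(3)[OF e] by force
    then show ?thesis using arc'[OF eD] 1 2 p'v p'o inV[of e] eD by simp
  qed
  have D1: "dangling_edge_drawn (insert q (p ` ?V)) (L - 1) (p' (gfst G e)) (c' e)"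
    if e: "e \<in> set D1 \<union> set D2" for e
  proof -
    have eD: "e \<in> ?D" and eC: "e \<notin> set C" using e setD dist by auto
    have t: "tgt e = Complex (X e) (L - 1)" using eC by (simp add: tgt_def)
    have 2: "path_image (c' e) \<inter> insert q (p ` ?V) = {p (gfst G e)}"
      unfolding img[OF eD] using q_seg[OF eD] eC P_seg[of e] d(8)[OF eD] q_old[of e] eD by blast
    have 3: "path_image (c' e) \<subseteq> {z. L - 1 \<le> Im z}"
      unfolding img[OF eD] using d(9)[OF eD] segIm(1)[of _ e] by force
    have "z = tgt e" if z: "z \<in> path_image (c' e)" "Im z = L - 1" for z
    proof -
      have "z \<in> seg e" using z d(9)[OF eD] unfolding img[OF eD] by auto
      then show ?thesis using segD(1)[OF eC, of z] z t by (simp add: complex_eq_iff)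
    qed
    moreover have "tgt e \<in> path_image (c' e)" "Im (tgt e) = L - 1" using tgtI(1)[of e] img[OF eD] t by auto
    ultimately have 4: "path_image (c' e) \<inter> {z. Im z = L - 1} = {tgt e}" by blast
    show ?thesis using arc'[OF eD] 2 3 4 p'o inV[of e] eD by simp
  qed
  have old_old: "path_image (c e) \<inter> path_image (c e') \<subseteq> p ` ?V" if "e \<in> gE G \<union> ?D" "e' \<in> gE G \<union> ?D" "e \<noteq> e'" for e e'
    using d(12) that by blast
  have pw: "path_image (c' e) \<inter> path_image (c' e') \<subseteq> insert q (p ` ?V)"
    if e: "e \<in> gE G \<union> set C \<union> set (D1 @ D2)" "e' \<in> gE G \<union> set C \<union> set (D1 @ D2)" "e \<noteq> e'" for e e'
  proof
    fix z assume z: "z \<in> path_image (c' e) \<inter> path_image (c' e')"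
    have ee: "e \<in> gE G \<union> ?D" "e' \<in> gE G \<union> ?D" using e setD by auto
    have im: "x \<in> gE G \<union> ?D \<Longrightarrow> z \<in> path_image (c' x) \<Longrightarrow> z \<in> path_image (c x) \<or> x \<in> ?D \<and> z \<in> seg x" for x
      using img[of x] imgE[of x] by (cases "x \<in> ?D") auto
    from im[OF ee(1)] im[OF ee(2)] z
    consider "z \<in> path_image (c e)" "z \<in> path_image (c e')" | "z \<in> path_image (c e)" "e' \<in> ?D" "z \<in> seg e'"
      | "z \<in> path_image (c e')" "e \<in> ?D" "z \<in> seg e" | "e \<in> ?D" "e' \<in> ?D" "z \<in> seg e" "z \<in> seg e'" by blast
    then show "z \<in> insert q (p ` ?V)"
    proof cases
      case 1 then show ?thesis using old_old[OF ee e(3)] by blast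
    next
      case 2 then show ?thesis using old_seg[OF 2(1,3) ee(1) 2(2)] e(3) by blast
    next
      case 3 then show ?thesis using old_seg[OF 3(1,3) ee(2) 3(2)] e(3) by blast
    next
      case 4 then show ?thesis using seg_seg[OF 4(3,4,1,2) e(3)] by blast
    qed
  qed
  have srt': "sorted_wrt (\<lambda>e e'. Re (pathfinish (c' e)) < Re (pathfinish (c' e'))) (D1 @ D2)"
  proof -
    have "sorted_wrt (\<lambda>e e'. X e < X e') (D1 @ D2)" using srt by (auto simp: sorted_wrt_append)
    moreover have "Re (pathfinish (c' e)) = X e" if "e \<in> set (D1 @ D2)" for e
      using arc'(3)[of e] that setD dist by (auto simp: tgt_def)
    ultimately show ?thesis by (auto intro: sorted_wrt_mono_rel[rotated])
  qed
  have inj: "inj_on p' (gU G \<union> insert v (gV G))"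
  proof -
    have "inj_on p' ?V" using d(1) p'o by (simp add: inj_on_def)
    moreover have "p' v \<notin> p' ` ?V"
    proof
      assume "p' v \<in> p' ` ?V"
      then obtain x where "x \<in> ?V" "q = p x" using p'v p'o by auto
      then have "L < Im q" using d(2) by simp
      then show False by (simp add: q_def)
    qed
    ultimately show ?thesis using v by (simp add: inj_on_insert)
  qed
  have Imv: "L - 1 < Im (p' x)" if "x \<in> gU G \<union> insert v (gV G)" for x
  proof (cases "x = v")
    case True then show ?thesis by (simp add: p'v q_def)
  next
    case False
    then have "x \<in> ?V" using that by auto
    then show ?thesis using d(2)[of x] p'o[of x] by simp
  qed
  have EE: "\<forall>e\<in>gE G \<union> set C. normal_edge_drawn (insert q (p ` ?V)) (L - 1) (p' (gfst G e)) (p' (gsnd ?G e)) (c' e)"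
    using E1 E2 by blast
  have DD: "\<forall>e\<in>set (D1 @ D2). dangling_edge_drawn (insert q (p ` ?V)) (L - 1) (p' (gfst G e)) (c' e)"
    using D1 by simp
  have "drawn ?G p' c' (L - 1)"
    unfolding drawn_def sel(1-5) pP
    by (intro conjI inj EE DD srt') (intro ballI Imv, assumption, intro ballI impI pw, assumption+)
  then show ?thesis by blast
qed


text \<open>The drawing with its ordered free ends is part of the induction claim: planarity alone
  would not place the edges of the next cap side by side.\<close>

lemma planar_tensor_gadget:
  assumes "planar_tensor F k f"
  shows "\<exists>G p c L. left_gadget {F} caps G \<and> drawn G p c L \<and> length (gD G) = k \<and>
    (\<forall>\<alpha>. length \<alpha> = k \<longrightarrow> gadget_val G \<alpha> = f \<alpha>)"
  using assms
proof induction
  case empty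
  let ?G = "\<lparr>gU = {}, gV = {}, gE = {}, gD = [], gfst = (\<lambda>_. 0), gsnd = (\<lambda>_. 0), gsig = (\<lambda>_. F), gargs = (\<lambda>_. [])\<rparr>"
  have "left_gadget {F} caps ?G" by (simp add: left_gadget_def)
  moreover have "drawn ?G (\<lambda>_. 0) (\<lambda>_ _. 0) 0" by (simp add: drawn_def)
  moreover have "gadget_val ?G \<alpha> = 1" if "length \<alpha> = 0" for \<alpha>
    using that by (simp add: gadget_val_def)
  ultimately show ?case by (intro exI[of _ ?G] exI conjI) auto
next
  case (vertex a f \<sigma>)
  then obtain G p c L where G: "left_gadget {F} caps G" and dr: "drawn G p c L" and k: "length (gD G) = a"
    and val: "\<And>\<alpha>. length \<alpha> = a \<Longrightarrow> gadget_val G \<alpha> = f \<alpha>" by blast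
  note g = left_gadgetD[OF G]
  obtain u where u: "u \<notin> gU G \<union> gV G" using g(1,2) ex_new_if_finite[of "gU G \<union> gV G"] infinite_UNIV_nat by auto
  obtain N where N: "\<forall>e\<in>gE G \<union> set (gD G). e < N"
    using g(4) finite_nat_set_iff_bounded[of "gE G \<union> set (gD G)"] by auto
  let ?es = "[N..<N + arity F]"
  have es: "set ?es \<inter> (gE G \<union> set (gD G)) = {}"
  proof -
    have "N \<le> e" if "e \<in> set ?es" for e using that by simp
    then show ?thesis using N by (meson disjoint_iff leD)
  qed
  let ?G = "add_vertex F \<sigma> u ?es G"
  have 1: "left_gadget {F} caps ?G" by (rule left_gadget_add_vertex[OF G vertex(2) u _ _ es]) auto
  obtain p' c' where 2: "drawn ?G p' c' L" using drawn_add_vertex[OF G dr u es] by blast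
  have 3: "length (gD ?G) = a + arity F" using k by (simp add: add_vertex_def)
  have 4: "gadget_val ?G \<alpha> = f (take a \<alpha>) * sigval F (permute_list \<sigma> (drop a \<alpha>))" if "length \<alpha> = a + arity F" for \<alpha>
    using gadget_val_add_vertex[OF G vertex(2) u _ _ es, of \<alpha>] val[of "take a \<alpha>"] that k by simp
  show ?case using 1 2 3 4 by blast
next
  case (cap a g b f)
  then obtain G p c L where G: "left_gadget {F} caps G" and dr: "drawn G p c L" and k: "length (gD G) = a + arity g + b"
    and val: "\<And>\<alpha>. length \<alpha> = a + arity g + b \<Longrightarrow> gadget_val G \<alpha> = f \<alpha>" by blast
  note gg = left_gadgetD[OF G]
  obtain v where v: "v \<notin> gU G \<union> gV G" using gg(1,2) ex_new_if_finite[of "gU G \<union> gV G"] infinite_UNIV_nat by auto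
  define D1 where "D1 = take a (gD G)"
  define C where "C = take (arity g) (drop a (gD G))"
  define D2 where "D2 = drop (arity g) (drop a (gD G))"
  have D: "gD G = D1 @ C @ D2" by (simp only: D1_def C_def D2_def append_take_drop_id)
  have len: "length D1 = a" "length C = arity g" "length D2 = b" using k by (auto simp: D1_def C_def D2_def)
  have "arity g > 0" using cap.hyps by (auto simp: symsig_def)
  then have Cne: "C \<noteq> []" using len(2) by auto
  let ?G = "add_cap g v D1 C D2 G"
  have 1: "left_gadget {F} caps ?G" by (rule left_gadget_add_cap[OF G cap.hyps(2) v D len(2)])
  obtain p' c' where 2: "drawn ?G p' c' (L - 1)" using drawn_add_cap[OF G dr v D Cne] by blast
  have 3: "length (gD ?G) = a + b" using len by (simp add: add_cap_def)
  have 4: "gadget_val ?G \<alpha> = (\<Sum>\<beta> | length \<beta> = arity g. f (take a \<alpha> @ \<beta> @ drop a \<alpha>) * sigval g \<beta>)"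
    if "length \<alpha> = a + b" for \<alpha>
  proof -
    have "gadget_val ?G \<alpha> = (\<Sum>\<beta> | length \<beta> = arity g. gadget_val G (take a \<alpha> @ \<beta> @ drop a \<alpha>) * sigval g \<beta>)"
      using gadget_val_add_cap[OF G v D len(2), of \<alpha>] that len by simp
    also have "\<dots> = (\<Sum>\<beta> | length \<beta> = arity g. f (take a \<alpha> @ \<beta> @ drop a \<alpha>) * sigval g \<beta>)"
      by (intro sum.cong refl arg_cong2[where f = "(*)"] val) (use that in auto)
    finally show ?thesis .
  qed
  show ?case using 1 2 3 4 by blast
next
  case (ext k f f')
  then show ?case by metis
qed

lemma planar_tensor_realizable:
  assumes "planar_tensor F k f"
  shows "planar_left_realizable {F} caps (k, f)"
proof -
  obtain G p c L where G: "left_gadget {F} caps G" "drawn G p c L" "length (gD G) = k"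
    "\<And>\<alpha>. length \<alpha> = k \<Longrightarrow> gadget_val G \<alpha> = f \<alpha>"
    using planar_tensor_gadget[OF assms] by blast
  then show ?thesis
    unfolding planar_left_realizable_def using drawn_planar_gadget[OF G(2)] by (intro exI[of _ G]) auto
qed

section \<open>Composition of planar tensors\<close>

lemma sum_bool_lists_Suc:
  fixes h :: "bool list \<Rightarrow> 'a :: comm_monoid_add"
  shows "(\<Sum>\<beta> | length \<beta> = Suc m. h \<beta>) = (\<Sum>\<beta> | length \<beta> = m. h (False # \<beta>)) + (\<Sum>\<beta> | length \<beta> = m. h (True # \<beta>))"
proof -
  have "{\<beta>. length \<beta> = Suc m} = (#) False ` {\<beta>. length \<beta> = m} \<union> (#) True ` {\<beta>. length \<beta> = m}"
    by (auto simp: length_Suc_conv image_iff)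
  moreover have "sum h ((#) False ` {\<beta>. length \<beta> = m} \<union> (#) True ` {\<beta>. length \<beta> = m}) =
      sum h ((#) False ` {\<beta>. length \<beta> = m}) + sum h ((#) True ` {\<beta>. length \<beta> = m})"
    using finite_bool_lists[of m] by (intro sum.union_disjoint) auto
  ultimately have "(\<Sum>\<beta> | length \<beta> = Suc m. h \<beta>) = sum h ((#) False ` {\<beta>. length \<beta> = m}) + sum h ((#) True ` {\<beta>. length \<beta> = m})"
    by simp
  then show ?thesis by (simp add: sum.reindex)
qed

lemma sum_bool_lists_snoc:
  fixes h :: "bool list \<Rightarrow> 'a :: comm_monoid_add"
  shows "(\<Sum>\<beta> | length \<beta> = Suc m. h \<beta>) = (\<Sum>\<beta> | length \<beta> = m. h (\<beta> @ [False]) + h (\<beta> @ [True]))"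
proof -
  have e: "{\<beta>. length \<beta> = Suc m} = (\<lambda>\<beta>. \<beta> @ [False]) ` {\<beta>. length \<beta> = m} \<union> (\<lambda>\<beta>. \<beta> @ [True]) ` {\<beta>. length \<beta> = m}"
    (is "_ = ?A \<union> ?B")
  proof (intro set_eqI iffI)
    fix \<beta> :: "bool list" assume "\<beta> \<in> {\<beta>. length \<beta> = Suc m}"
    then obtain \<gamma> b where "\<beta> = \<gamma> @ [b]" "length \<gamma> = m" by (auto simp: length_Suc_conv_rev)
    then show "\<beta> \<in> ?A \<union> ?B" by (cases b) auto
  qed auto
  have "sum h (?A \<union> ?B) = sum h ?A + sum h ?B"
    using finite_bool_lists[of m] by (intro sum.union_disjoint) auto
  also have "sum h ?A = (\<Sum>\<beta> | length \<beta> = m. h (\<beta> @ [False]))" by (subst sum.reindex) (auto simp: inj_on_def)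
  also have "sum h ?B = (\<Sum>\<beta> | length \<beta> = m. h (\<beta> @ [True]))" by (subst sum.reindex) (auto simp: inj_on_def)
  finally show ?thesis unfolding e by (simp add: sum.distrib)
qed

lemma sum_bool_lists_rev: "(\<Sum>\<beta> | length \<beta> = m. h (rev \<beta>)) = (\<Sum>\<beta> | length \<beta> = (m::nat). h (\<beta> :: bool list))"
  by (rule sum.reindex_bij_witness[where i = rev and j = rev]) auto

text \<open>By induction on the second tensor, whose building steps are repeated to the right of the
  first.\<close>

lemma planar_tensor_mult:
  assumes f: "planar_tensor F a f" and g: "planar_tensor F b g"
  shows "planar_tensor F (a + b) (\<lambda>\<alpha>. f (take a \<alpha>) * g (drop a \<alpha>))"
  using g
proof induction
  case empty
  show ?case by (rule planar_tensor.ext[of F _ f]) (use f in auto)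
next
  case (vertex b g \<sigma>)
  show ?case unfolding add.assoc[symmetric]
    by (rule planar_tensor.ext[OF planar_tensor.vertex[OF vertex.IH vertex.hyps(2)]])
      (simp add: drop_take add.commute min_def)
next
  case (cap a' g b' h)
  have 1: "planar_tensor F ((a + a') + arity g + b') (\<lambda>\<alpha>. f (take a \<alpha>) * h (drop a \<alpha>))"
    using cap.IH by (simp add: add.assoc)
  show ?case unfolding add.assoc[symmetric]
  proof (rule planar_tensor.ext[OF planar_tensor.cap[OF 1 cap.hyps(2)]])
    fix \<alpha> :: "bool list" assume "length \<alpha> = a + a' + b'"
    then have e: "take a (take (a + a') \<alpha> @ \<beta> @ drop (a + a') \<alpha>) = take a \<alpha>"
      "drop a (take (a + a') \<alpha> @ \<beta> @ drop (a + a') \<alpha>) = take a' (drop a \<alpha>) @ \<beta> @ drop a' (drop a \<alpha>)" for \<beta>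
      by (simp_all add: drop_take add.commute)
    then show "(\<Sum>\<beta> | length \<beta> = arity g. f (take a (take (a + a') \<alpha> @ \<beta> @ drop (a + a') \<alpha>)) *
        h (drop a (take (a + a') \<alpha> @ \<beta> @ drop (a + a') \<alpha>)) * sigval g \<beta>) =
      f (take a \<alpha>) * (\<Sum>\<beta> | length \<beta> = arity g. h (take a' (drop a \<alpha>) @ \<beta> @ drop a' (drop a \<alpha>)) * sigval g \<beta>)"
      by (simp only: e sum_distrib_left mult.assoc)
  qed
next
  case (ext k g g')
  show ?case by (rule planar_tensor.ext[OF ext.IH]) (use ext.hyps in simp)
qed

lemma caps_rev: "g \<in> caps \<Longrightarrow> sigval g (rev \<beta>) = sigval g \<beta>"
  by (auto simp: symsig_def)

text \<open>The mirror image. In the vertex step the mirrored vertex comes leftmost, whereas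
  vertices are added on the right; so the construction starts with this vertex and appends the
  mirrored rest as a product. Caps survive mirroring because they are symmetric.\<close>

lemma planar_tensor_rev:
  assumes "planar_tensor F k f" shows "planar_tensor F k (\<lambda>\<alpha>. f (rev \<alpha>))"
  using assms
proof induction
  case empty then show ?case by (rule planar_tensor.empty)
next
  case (vertex a f \<sigma>)
  let ?n = "arity F"
  define r where "r i = (if i < ?n then ?n - 1 - i else i)" for i
  have r: "r permutes {..<?n}"
  proof (rule bij_imp_permutes)
    have rr: "r i < ?n" "r (r i) = i" if "i < ?n" for i using that unfolding r_def by simp_all
    show "bij_betw r {..<?n} {..<?n}"
      by (rule bij_betw_byWitness[where f' = r]) (use rr in blast)+
  qed (simp add: r_def)
  have rp: "rev \<gamma> = permute_list r \<gamma>" if "length \<gamma> = ?n" for \<gamma> :: "bool list"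
    using that by (intro nth_equalityI) (auto simp: permute_list_def r_def rev_nth)
  have "planar_tensor F (0 + ?n) (\<lambda>\<alpha>. 1 * sigval F (permute_list (r \<circ> \<sigma>) (drop 0 \<alpha>)))"
    by (rule planar_tensor.vertex[OF planar_tensor.empty]) (rule permutes_compose[OF vertex.hyps(2) r])
  then have 1: "planar_tensor F ?n (\<lambda>\<alpha>. sigval F (permute_list (r \<circ> \<sigma>) \<alpha>))" by simp
  show ?case unfolding add.commute[of a]
  proof (rule planar_tensor.ext[OF planar_tensor_mult[OF 1 vertex.IH]])
    fix \<alpha> :: "bool list" assume l: "length \<alpha> = ?n + a"
    have "permute_list (r \<circ> \<sigma>) (take ?n \<alpha>) = permute_list \<sigma> (rev (take ?n \<alpha>))"
      using l vertex.hyps(2) by (subst permute_list_compose) (auto simp: rp)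
    also have "rev (take ?n \<alpha>) = drop a (rev \<alpha>)" using l by (simp add: drop_rev)
    moreover have "rev (drop ?n \<alpha>) = take a (rev \<alpha>)" using l by (simp add: take_rev)
    ultimately show "sigval F (permute_list (r \<circ> \<sigma>) (take ?n \<alpha>)) * f (rev (drop ?n \<alpha>)) =
       f (take a (rev \<alpha>)) * sigval F (permute_list \<sigma> (drop a (rev \<alpha>)))" by simp
  qed
next
  case (cap a g b f)
  have 1: "planar_tensor F (b + arity g + a) (\<lambda>\<alpha>. f (rev \<alpha>))" using cap.IH by (simp add: ac_simps)
  show ?case unfolding add.commute[of a]
  proof (rule planar_tensor.ext[OF planar_tensor.cap[OF 1 cap.hyps(2)]])
    fix \<alpha> :: "bool list" assume l: "length \<alpha> = b + a"
    have e: "rev (take b \<alpha>) = drop a (rev \<alpha>)" "rev (drop b \<alpha>) = take a (rev \<alpha>)"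
      using l by (simp_all add: drop_rev take_rev)
    have "(\<Sum>\<beta> | length \<beta> = arity g. f (rev (take b \<alpha> @ \<beta> @ drop b \<alpha>)) * sigval g \<beta>) =
       (\<Sum>\<beta> | length \<beta> = arity g. f (take a (rev \<alpha>) @ rev \<beta> @ drop a (rev \<alpha>)) * sigval g (rev \<beta>))"
      using caps_rev[OF cap.hyps(2)] by (simp add: e)
    also have "\<dots> = (\<Sum>\<beta> | length \<beta> = arity g. f (take a (rev \<alpha>) @ \<beta> @ drop a (rev \<alpha>)) * sigval g \<beta>)"
      by (rule sum_bool_lists_rev)
    finally show "(\<Sum>\<beta> | length \<beta> = arity g. f (rev (take b \<alpha> @ \<beta> @ drop b \<alpha>)) * sigval g \<beta>) =
       (\<Sum>\<beta> | length \<beta> = arity g. f (take a (rev \<alpha>) @ \<beta> @ drop a (rev \<alpha>)) * sigval g \<beta>)" .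
  qed
next
  case (ext k f f')
  show ?case by (rule planar_tensor.ext[OF ext.IH]) (use ext.hyps in simp)
qed

text \<open>Pinning leaves nonzero factors behind, such as a value of \<open>F\<close>. They
  multiply all values at once and cancel in the ratios that decide affinity, so they are hidden
  here.\<close>

definition scaled_tensor :: "signature \<Rightarrow> nat \<Rightarrow> (bool list \<Rightarrow> complex) \<Rightarrow> bool" where
  "scaled_tensor F k f \<longleftrightarrow> (\<exists>l. l \<noteq> 0 \<and> planar_tensor F k (\<lambda>\<alpha>. l * f \<alpha>))"

lemma scaled_ext:
  assumes "scaled_tensor F k f" "\<And>\<alpha>. length \<alpha> = k \<Longrightarrow> f \<alpha> = f' \<alpha>"
  shows "scaled_tensor F k f'"
proof -
  obtain l where l: "l \<noteq> 0" "planar_tensor F k (\<lambda>\<alpha>. l * f \<alpha>)" using assms(1) by (auto simp: scaled_tensor_def)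
  have "planar_tensor F k (\<lambda>\<alpha>. l * f' \<alpha>)"
    by (rule planar_tensor.ext[OF l(2)]) (use assms(2) in simp)
  then show ?thesis using l(1) by (auto simp: scaled_tensor_def)
qed

lemma scaled_const:
  assumes "scaled_tensor F k (\<lambda>\<alpha>. c * f \<alpha>)" "c \<noteq> 0" shows "scaled_tensor F k f"
proof -
  obtain l where "l \<noteq> 0" "planar_tensor F k (\<lambda>\<alpha>. l * (c * f \<alpha>))" using assms(1) by (auto simp: scaled_tensor_def)
  then show ?thesis using assms(2) unfolding scaled_tensor_def
    by (intro exI[of _ "l * c"]) (simp add: mult.assoc)
qed

lemma scaled_mult:
  assumes "scaled_tensor F a f" "scaled_tensor F b g"
  shows "scaled_tensor F (a + b) (\<lambda>\<alpha>. f (take a \<alpha>) * g (drop a \<alpha>))"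
proof -
  obtain l m where l: "l \<noteq> 0" "planar_tensor F a (\<lambda>\<alpha>. l * f \<alpha>)" and m: "m \<noteq> 0" "planar_tensor F b (\<lambda>\<alpha>. m * g \<alpha>)"
    using assms by (auto simp: scaled_tensor_def)
  have "planar_tensor F (a + b) (\<lambda>\<alpha>. (l * m) * (f (take a \<alpha>) * g (drop a \<alpha>)))"
    by (rule planar_tensor.ext[OF planar_tensor_mult[OF l(2) m(2)]]) (simp add: mult_ac)
  then show ?thesis unfolding scaled_tensor_def using l m by (intro exI[of _ "l * m"]) simp
qed

lemma scaled_rev: "scaled_tensor F k f \<Longrightarrow> scaled_tensor F k (\<lambda>\<alpha>. f (rev \<alpha>))"
  unfolding scaled_tensor_def using planar_tensor_rev by blast

lemma scaled_cap:
  assumes "scaled_tensor F (a + arity g + b) f" "g \<in> caps"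
  shows "scaled_tensor F (a + b) (\<lambda>\<alpha>. \<Sum>\<beta> | length \<beta> = arity g. f (take a \<alpha> @ \<beta> @ drop a \<alpha>) * sigval g \<beta>)"
proof -
  obtain l where l: "l \<noteq> 0" "planar_tensor F (a + arity g + b) (\<lambda>\<alpha>. l * f \<alpha>)" using assms(1) by (auto simp: scaled_tensor_def)
  have "planar_tensor F (a + b) (\<lambda>\<alpha>. l * (\<Sum>\<beta> | length \<beta> = arity g. f (take a \<alpha> @ \<beta> @ drop a \<alpha>) * sigval g \<beta>))"
    by (rule planar_tensor.ext[OF planar_tensor.cap[OF l(2) assms(2)]]) (simp add: sum_distrib_left mult.assoc)
  then show ?thesis unfolding scaled_tensor_def using l by blast
qed

lemma scaled_cap1:
  assumes "scaled_tensor F (a + 1 + b) f"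
  shows "scaled_tensor F (a + b) (\<lambda>\<alpha>. f (take a \<alpha> @ [False] @ drop a \<alpha>))"
proof -
  have "scaled_tensor F (a + arity (symsig [1,0]) + b) f" using assms by simp
  from scaled_cap[OF this] show ?thesis
    by (rule scaled_ext) (simp_all add: sum_bool_lists_Suc)
qed

lemma scaled_cap2:
  assumes "scaled_tensor F (a + 2 + b) f"
  shows "scaled_tensor F (a + b) (\<lambda>\<alpha>. f (take a \<alpha> @ [False, False] @ drop a \<alpha>) + f (take a \<alpha> @ [True, True] @ drop a \<alpha>))"
proof -
  have "scaled_tensor F (a + arity (symsig [1,0,1]) + b) f" using assms by (simp add: numeral_2_eq_2)
  from scaled_cap[OF this] show ?thesis
    by (rule scaled_ext) (simp_all add: sum_bool_lists_Suc)
qed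

lemma scaled_cap3:
  assumes "scaled_tensor F (a + 3 + b) f"
  shows "scaled_tensor F (a + b) (\<lambda>\<alpha>. f (take a \<alpha> @ [False, False, False] @ drop a \<alpha>) + f (take a \<alpha> @ [False, True, True] @ drop a \<alpha>)
    + f (take a \<alpha> @ [True, False, True] @ drop a \<alpha>) + f (take a \<alpha> @ [True, True, False] @ drop a \<alpha>))"
proof -
  have "scaled_tensor F (a + arity (symsig [1,0,1,0]) + b) f" using assms by (simp add: numeral_3_eq_3)
  from scaled_cap[OF this] show ?thesis
    by (rule scaled_ext) (simp_all add: sum_bool_lists_Suc)
qed

text \<open>Only neighbouring edges can be joined. The inner pairs are joined first, after which the
  outermost two edges are neighbours; this nesting is the origin of
  \<open>rev \<beta>\<close>.\<close>

lemma scaled_nested: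
  assumes "scaled_tensor F (a + 2 * j + b) h"
  shows "scaled_tensor F (a + b) (\<lambda>\<alpha>. \<Sum>\<beta> | length \<beta> = j. h (take a \<alpha> @ \<beta> @ rev \<beta> @ drop a \<alpha>))"
  using assms
proof (induction j arbitrary: a b)
  case 0
  then show ?case by simp
next
  case (Suc j)
  have "scaled_tensor F (Suc a + 2 * j + Suc b) h" using Suc.prems by simp
  from Suc.IH[OF this] have 1: "scaled_tensor F (a + 2 + b) (\<lambda>\<alpha>. \<Sum>\<beta> | length \<beta> = j. h (take (Suc a) \<alpha> @ \<beta> @ rev \<beta> @ drop (Suc a) \<alpha>))"
    by simp
  show ?case
  proof (rule scaled_ext[OF scaled_cap2[OF 1]])
    fix \<alpha> :: "bool list" assume l: "length \<alpha> = a + b"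
    have "take (Suc a) (take a \<alpha> @ [z, z] @ drop a \<alpha>) = take a \<alpha> @ [z]"
      "drop (Suc a) (take a \<alpha> @ [z, z] @ drop a \<alpha>) = z # drop a \<alpha>" for z
      using l by simp_all
    then show "(\<Sum>\<beta> | length \<beta> = j. h (take (Suc a) (take a \<alpha> @ [False, False] @ drop a \<alpha>) @ \<beta> @ rev \<beta> @ drop (Suc a) (take a \<alpha> @ [False, False] @ drop a \<alpha>))) +
      (\<Sum>\<beta> | length \<beta> = j. h (take (Suc a) (take a \<alpha> @ [True, True] @ drop a \<alpha>) @ \<beta> @ rev \<beta> @ drop (Suc a) (take a \<alpha> @ [True, True] @ drop a \<alpha>))) =
      (\<Sum>\<beta> | length \<beta> = Suc j. h (take a \<alpha> @ \<beta> @ rev \<beta> @ drop a \<alpha>))"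
      by (simp add: sum_bool_lists_Suc)
  qed
qed

text \<open>The tensors are placed side by side, and the last \<open>j\<close> edges of the first
  are joined, from the inside out, to the first \<open>j\<close> edges of the second.\<close>

lemma scaled_compose:
  assumes f: "scaled_tensor F (a + j) f" and g: "scaled_tensor F (j + b) g"
  shows "scaled_tensor F (a + b) (\<lambda>\<alpha>. \<Sum>\<beta> | length \<beta> = j. f (take a \<alpha> @ \<beta>) * g (rev \<beta> @ drop a \<alpha>))"
proof -
  have 1: "scaled_tensor F (a + 2 * j + b) (\<lambda>\<alpha>. f (take (a + j) \<alpha>) * g (drop (a + j) \<alpha>))"
  proof -
    have idx: "a + 2 * j + b = (a + j) + (j + b)" by simp
    show ?thesis unfolding idx by (rule scaled_mult[OF f g])
  qed
  show ?thesis by (rule scaled_ext[OF scaled_nested[OF 1]]) simp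
qed

section \<open>Restrictions to some of the variables\<close>

definition selected :: "nat list \<Rightarrow> bool list \<Rightarrow> nat set" where
  "selected is \<alpha> = set (map fst (filter snd (zip is \<alpha>)))"

lemma selected_Nil [simp]: "selected [] \<alpha> = {}" "selected is [] = {}"
  by (simp_all add: selected_def)

lemma selected_Cons [simp]: "selected (i # is) (b # \<alpha>) = (if b then {i} else {}) \<union> selected is \<alpha>"
  by (auto simp: selected_def)

lemma selected_append: "length is = length \<alpha> \<Longrightarrow> selected (is @ js) (\<alpha> @ \<beta>) = selected is \<alpha> \<union> selected js \<beta>"
  by (auto simp: selected_def)

lemma selected_replicate: "selected is (replicate m False) = {}" "length is = m \<Longrightarrow> selected is (replicate m True) = set is"
proof -
  show "selected is (replicate m False) = {}" by (auto simp: selected_def set_zip)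
  show "length is = m \<Longrightarrow> selected is (replicate m True) = set is"
    by (induction "is" arbitrary: m) auto
qed

lemma selected_subset: "selected is \<alpha> \<subseteq> set is"
  by (auto simp: selected_def dest: set_zip_leftD)

lemma selected_iff:
  assumes "distinct is" "length \<alpha> = length is" "p < length is"
  shows "is ! p \<in> selected is \<alpha> \<longleftrightarrow> \<alpha> ! p"
  using assms by (auto simp: selected_def in_set_zip image_iff nth_eq_iff_index_eq set_zip)

lemma scaled_vertex:
  assumes js: "distinct js" "set js = {..<arity F}"
  shows "scaled_tensor F (length js) (\<lambda>\<alpha>. set_val F (selected js \<alpha>))"
proof -
  let ?n = "arity F"
  have len: "length js = ?n" using js distinct_card[of js] by simp
  define \<pi> where "\<pi> i = (if i < ?n then js ! i else i)" for i
  have \<pi>: "\<pi> permutes {..<?n}"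
  proof (rule bij_imp_permutes)
    have "bij_betw ((!) js) {..<?n} {..<?n}" using bij_betw_nth[OF js(1)] js(2) len by simp
    then show "bij_betw \<pi> {..<?n} {..<?n}" by (rule bij_betw_cong[THEN iffD1, rotated]) (auto simp: \<pi>_def)
  qed (auto simp: \<pi>_def)
  \<comment> \<open>\<open>permute_list\<close> has to read entry i at the position where variable i
    occurs in \<open>js\<close>, hence the inverse of the map from positions to variables.\<close>
  have \<sigma>: "inv \<pi> permutes {..<?n}" by (rule permutes_inv[OF \<pi>])
  have "planar_tensor F (0 + ?n) (\<lambda>\<alpha>. 1 * sigval F (permute_list (inv \<pi>) (drop 0 \<alpha>)))"
    by (rule planar_tensor.vertex[OF planar_tensor.empty \<sigma>])
  then have "planar_tensor F (length js) (\<lambda>\<alpha>. 1 * set_val F (selected js \<alpha>))"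
    unfolding len add_0
  proof (rule planar_tensor.ext)
    fix \<alpha> :: "bool list" assume l: "length \<alpha> = ?n"
    have "permute_list (inv \<pi>) \<alpha> = map (\<lambda>i. i \<in> selected js \<alpha>) [0..<?n]"
    proof (rule nth_equalityI)
      fix i assume "i < length (permute_list (inv \<pi>) \<alpha>)"
      then have i: "i < ?n" using l by simp
      define p where "p = inv \<pi> i"
      have p: "p < ?n" using permutes_in_image[OF \<sigma>, of i] i by (simp add: p_def)
      have "\<pi> p = i" unfolding p_def using permutes_inverses(1)[OF \<pi>] .
      then have "js ! p = i" using p by (simp add: \<pi>_def)
      then have "i \<in> selected js \<alpha> \<longleftrightarrow> \<alpha> ! p" using selected_iff[OF js(1), of \<alpha> p] l len p by simp
      then show "permute_list (inv \<pi>) \<alpha> ! i = map (\<lambda>i. i \<in> selected js \<alpha>) [0..<?n] ! i"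
        using i l by (simp add: permute_list_def p_def)
    qed (simp add: l)
    then show "1 * sigval F (permute_list (inv \<pi>) (drop 0 \<alpha>)) = 1 * set_val F (selected js \<alpha>)"
      by (simp add: set_val_def)
  qed
  then show ?thesis unfolding scaled_tensor_def by (intro exI[of _ 1]) simp
qed

lemma scaled_pin_zeros:
  assumes "scaled_tensor F (k + m) f"
  shows "scaled_tensor F k (\<lambda>\<alpha>. f (\<alpha> @ replicate m False))"
  using assms
proof (induction m arbitrary: f)
  case 0 then show ?case by simp
next
  case (Suc m)
  have 1: "scaled_tensor F (k + m + 1 + 0) f" using Suc.prems by simp
  have "scaled_tensor F (k + m) (\<lambda>\<alpha>. f (\<alpha> @ [False]))"
    using scaled_ext[OF scaled_cap1[OF 1]] by simp
  from Suc.IH[OF this] show ?case by (simp add: replicate_append_same)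
qed

lemma scaled_restrict:
  assumes "distinct is" "set is \<subseteq> {..<arity F}"
  shows "scaled_tensor F (length is) (\<lambda>\<alpha>. set_val F (selected is \<alpha>))"
proof -
  define zs where "zs = filter (\<lambda>i. i \<notin> set is) [0..<arity F]"
  have "distinct (is @ zs)" "set (is @ zs) = {..<arity F}" using assms by (auto simp: zs_def)
  from scaled_vertex[OF this] have "scaled_tensor F (length is + length zs) (\<lambda>\<alpha>. set_val F (selected (is @ zs) \<alpha>))" by simp
  from scaled_pin_zeros[OF this] show ?thesis
    by (rule scaled_ext) (simp add: selected_append selected_replicate)
qed

section \<open>Pinning variables\<close>

lemma count_list_True_selected:
  assumes "distinct is" "length \<alpha> = length is"
  shows "card (selected is \<alpha>) = hamming_weight \<alpha>"
  using assms
proof (induction "is" arbitrary: \<alpha>)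
  case Nil then show ?case by simp
next
  case (Cons i "is")
  then obtain b \<alpha>' where [simp]: "\<alpha> = b # \<alpha>'" by (cases \<alpha>) auto
  have "i \<notin> selected is \<alpha>'" using Cons.prems selected_subset by fastforce
  moreover have "finite (selected is \<alpha>')" using selected_subset finite_subset by blast
  ultimately show ?case using Cons by auto
qed

text \<open>The tensor power of [0,1]. It is treated as a whole because it need not be a product of
  realizable factors: if \<open>F\<close> has even support, only an even number of ones can be
  realized.\<close>

definition all_ones :: "bool list \<Rightarrow> complex" where
  "all_ones \<alpha> = of_bool (\<alpha> = replicate (length \<alpha>) True)"

lemma all_ones_simps [simp]: "all_ones [] = 1" "all_ones (b # \<alpha>) = of_bool b * all_ones \<alpha>"
  by (simp_all add: all_ones_def)

lemma all_ones_append: "all_ones (\<alpha> @ \<beta>) = all_ones \<alpha> * all_ones \<beta>"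
  by (induction \<alpha>) (simp_all add: mult.assoc)

lemma all_ones_rev: "all_ones (rev \<alpha>) = all_ones \<alpha>"
  by (induction \<alpha>) (simp_all add: all_ones_append)

lemma sum_all_ones: "(\<Sum>\<beta> | length \<beta> = r. f \<beta> * all_ones \<beta>) = f (replicate r True)"
  by (induction r arbitrary: f) (simp_all add: sum_bool_lists_Suc)

text \<open>A tensor \<open>[0,1]\<close> on \<open>k\<close> edges: restrict \<open>F\<close> to the subcube below a support vector of minimal
  weight, and join its ones in pairs.\<close>

lemma scaled_all_ones:
  assumes par: "\<And>A B. A \<subseteq> {..<arity F} \<Longrightarrow> B \<subseteq> {..<arity F} \<Longrightarrow> set_val F A \<noteq> 0 \<Longrightarrow> set_val F B \<noteq> 0 \<Longrightarrow> even (card A + card B)"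
    and X: "X \<subseteq> {..<arity F}" "set_val F X \<noteq> 0" and F0: "set_val F {} = 0"
    and k: "k \<ge> 1" "even (k + card X)"
  shows "scaled_tensor F k all_ones"
proof -
  define Y where "Y = arg_min_on card {A. A \<subseteq> {..<arity F} \<and> set_val F A \<noteq> 0}"
  have fin: "finite {A. A \<subseteq> {..<arity F} \<and> set_val F A \<noteq> 0}" by simp
  have ne: "{A. A \<subseteq> {..<arity F} \<and> set_val F A \<noteq> 0} \<noteq> {}" using X by blast
  have Y: "Y \<subseteq> {..<arity F}" "set_val F Y \<noteq> 0"
    using arg_min_if_finite(1)[OF fin ne, of card] by (auto simp: Y_def)
  have Ymin: "card Y \<le> card A" if "A \<subseteq> {..<arity F}" "set_val F A \<noteq> 0" for A
    using arg_min_least[OF fin ne, of A card] that by (simp add: Y_def)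
  have finY: "finite Y" using Y finite_subset by blast
  have Y0: "Y \<noteq> {}" using Y F0 by auto
  define w where "w = card Y"
  have w: "w \<ge> 1" using Y0 finY by (simp add: w_def Suc_le_eq card_gt_0_iff)
  have wk: "even (w + k)" using par[OF Y(1) X(1) Y(2) X(2)] k(2) by (auto simp: w_def)
  let ?os = "sorted_list_of_set Y"
  have os: "distinct ?os" "set ?os = Y" "length ?os = w" using finY by (auto simp: w_def)
  have sw: "scaled_tensor F w all_ones"
  proof (rule scaled_const[of F w "set_val F Y"])
    show "scaled_tensor F w (\<lambda>\<alpha>. set_val F Y * all_ones \<alpha>)"
    proof (rule scaled_ext[OF scaled_restrict[of ?os F, unfolded os]])
      fix \<alpha> :: "bool list" assume l: "length \<alpha> = w"
      show "set_val F (selected ?os \<alpha>) = set_val F Y * all_ones \<alpha>"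
      proof (cases "\<alpha> = replicate w True")
        case True
        then show ?thesis using selected_replicate(2)[OF os(3)] os(2) by (simp add: all_ones_def)
      next
        case False
        have "card (selected ?os \<alpha>) = hamming_weight \<alpha>" using count_list_True_selected os l by simp
        moreover have "hamming_weight \<alpha> < w" using False l
        proof (induction \<alpha> arbitrary: w)
          case (Cons b \<alpha>)
          then show ?case using Cons.IH[of "length \<alpha>"] count_le_length[of \<alpha> True]
            by (cases b; cases w) (auto simp: less_Suc_eq_le Suc_le_eq)
        qed simp
        ultimately have "set_val F (selected ?os \<alpha>) = 0"
          using Ymin[of "selected ?os \<alpha>"] selected_subset[of ?os \<alpha>] os(2) Y(1) w_def by fastforce
        then show ?thesis using False l by (simp add: all_ones_def)
      qed
    qed (use os Y in auto)
  qed (use Y in simp)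
  have red: "scaled_tensor F (m + 2 * q) all_ones \<Longrightarrow> scaled_tensor F m all_ones" for m q
  proof (induction q)
    case (Suc q)
    have "scaled_tensor F (0 + 2 + (m + 2 * q)) all_ones" using Suc.prems by simp
    from scaled_cap2[OF this] have "scaled_tensor F (m + 2 * q) all_ones" by (simp add: scaled_ext)
    then show ?case by (rule Suc.IH)
  qed simp
  have mul: "scaled_tensor F (Suc q * m) all_ones" if "scaled_tensor F m all_ones" for m q
  proof (induction q)
    case (Suc q)
    have "scaled_tensor F (m + Suc q * m) (\<lambda>\<alpha>. all_ones (take m \<alpha>) * all_ones (drop m \<alpha>))"
      by (rule scaled_mult[OF that Suc])
    then have "scaled_tensor F (m + Suc q * m) all_ones"
      by (rule scaled_ext) (simp flip: all_ones_append)
    then show ?case by simp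
  qed (use that in simp)
  \<comment> \<open>For odd \<open>w\<close>, joining pairs leaves a single edge carrying 1, and
    copies of it give every \<open>k\<close>. For even \<open>w\<close> two edges remain, and
    \<open>k\<close> is even as well.\<close>
  show ?thesis
  proof (cases "odd w")
    case True
    then have "scaled_tensor F (1 + 2 * (w div 2)) all_ones" using sw by simp
    then have "scaled_tensor F 1 all_ones" by (rule red)
    from mul[OF this, of "k - 1"] show ?thesis using k by simp
  next
    case False
    then have "w = 2 + 2 * ((w - 2) div 2)" using w by presburger
    then have "scaled_tensor F 2 all_ones" using sw red by metis
    moreover have "k = Suc (k div 2 - 1) * 2" using False wk k by presburger
    ultimately show ?thesis using mul by metis
  qed
qed

text \<open>The restriction of \<open>F\<close> to the face of the cube through \<open>X\<close>
  with free coordinates \<open>is\<close>.\<close>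

definition pinned :: "signature \<Rightarrow> nat set \<Rightarrow> nat list \<Rightarrow> bool list \<Rightarrow> complex" where
  "pinned F X is \<alpha> = set_val F (selected is \<alpha> \<union> (X - set is))"

text \<open>An intermediate stage: only zeros are pinned, and the ones of \<open>X\<close> outside
  \<open>is\<close> remain as edges that have yet to receive a 1.\<close>

lemma scaled_pinned_open:
  assumes "distinct is" "set is \<subseteq> {..<arity F}" "X \<subseteq> {..<arity F}"
  shows "\<exists>T. scaled_tensor F (length is + card (X - set is)) T \<and>
    (\<forall>\<alpha>. length \<alpha> = length is \<longrightarrow> T (\<alpha> @ replicate (card (X - set is)) True) = pinned F X is \<alpha>)"
proof -
  have fin: "finite (X - set is)" using assms finite_subset by blast
  let ?os = "sorted_list_of_set (X - set is)"
  have "distinct (is @ ?os)" "set (is @ ?os) \<subseteq> {..<arity F}" using assms fin by auto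
  from scaled_restrict[OF this] have "scaled_tensor F (length is + card (X - set is)) (\<lambda>\<alpha>. set_val F (selected (is @ ?os) \<alpha>))"
    using fin by simp
  moreover have "set_val F (selected (is @ ?os) (\<alpha> @ replicate (card (X - set is)) True)) = pinned F X is \<alpha>"
    if "length \<alpha> = length is" for \<alpha>
    using that fin by (simp add: selected_append selected_replicate pinned_def)
  ultimately show ?thesis by blast
qed

text \<open>Edges carrying 1 are obtained below a minimal support vector, which fails if the zero
  vector is in the support. In that case \<open>X\<close> is the zero vector and nothing has to be
  pinned to 1.\<close>

context
  fixes F :: signature and X :: "nat set"
  assumes par: "\<And>A B. A \<subseteq> {..<arity F} \<Longrightarrow> B \<subseteq> {..<arity F} \<Longrightarrow> set_val F A \<noteq> 0 \<Longrightarrow> set_val F B \<noteq> 0 \<Longrightarrow> even (card A + card B)"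
    and X: "X \<subseteq> {..<arity F}" "set_val F X \<noteq> 0" and X0: "set_val F {} \<noteq> 0 \<Longrightarrow> X = {}"
begin

lemma card_X_split: "card X = card (X \<inter> set is) + card (X - set is)"
  using X(1) finite_subset[of X "{..<arity F}"] by (metis card_Int_Diff finite_lessThan)

text \<open>The number of ones to be supplied has the parity of the weight of \<open>X\<close>, so
  \<open>all_ones\<close> is available with exactly that many edges.\<close>

lemma pinned_even:
  assumes "distinct is" "set is \<subseteq> {..<arity F}" and ev: "even (card (X \<inter> set is))"
  shows "scaled_tensor F (length is) (pinned F X is)"
proof -
  let ?r = "card (X - set is)"
  obtain T where T: "scaled_tensor F (length is + ?r) T"
    "\<And>\<alpha>. length \<alpha> = length is \<Longrightarrow> T (\<alpha> @ replicate ?r True) = pinned F X is \<alpha>"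
    using scaled_pinned_open[OF assms(1,2) X(1)] by blast
  show ?thesis
  proof (cases "?r = 0")
    case True
    have "scaled_tensor F (length is) T" using T(1) True by simp
    then show ?thesis by (rule scaled_ext) (use T(2) True in simp)
  next
    case False
    then have "set_val F {} = 0" using X0 by (metis card.empty empty_Diff)
    then have "scaled_tensor F (?r + 0) all_ones"
      using scaled_all_ones[OF par X, of ?r] False ev card_X_split[of "is"] by simp
    from scaled_compose[OF T(1) this] have
      "scaled_tensor F (length is) (\<lambda>\<alpha>. \<Sum>\<beta> | length \<beta> = ?r. T (take (length is) \<alpha> @ \<beta>) * all_ones (rev \<beta> @ drop (length is) \<alpha>))"
      by simp
    then show ?thesis
      by (rule scaled_ext) (simp add: all_ones_rev sum_all_ones T(2))
  qed
qed

text \<open>The number of ones to be supplied has the wrong parity. One more is produced, and the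
  surplus edge stays open as the last argument.\<close>

lemma pinned_odd:
  assumes "distinct is" "set is \<subseteq> {..<arity F}" and od: "odd (card (X \<inter> set is))"
  shows "scaled_tensor F (length is + 1) (\<lambda>\<alpha>. pinned F X is (take (length is) \<alpha>) * all_ones (drop (length is) \<alpha>))"
proof -
  let ?r = "card (X - set is)"
  obtain T where T: "scaled_tensor F (length is + ?r) T"
    "\<And>\<alpha>. length \<alpha> = length is \<Longrightarrow> T (\<alpha> @ replicate ?r True) = pinned F X is \<alpha>"
    using scaled_pinned_open[OF assms(1,2) X(1)] by blast
  have "X \<noteq> {}" using od by auto
  then have "set_val F {} = 0" using X0 by auto
  then have "scaled_tensor F (?r + 1) all_ones"
    using scaled_all_ones[OF par X, of "?r + 1"] od card_X_split[of "is"] by simp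
  from scaled_compose[OF T(1) this] show ?thesis
    by (rule scaled_ext) (simp add: all_ones_append all_ones_rev sum_all_ones T(2) flip: mult.assoc sum_distrib_right)
qed

text \<open>Two copies of \<open>F\<close> with the same pinned variables: if the number of pinned ones has the wrong
  parity, each copy keeps one of them open and these two edges are joined.\<close>

lemma pinned_pair:
  assumes "distinct is" "distinct js" "set is = set js" "set is \<subseteq> {..<arity F}" "length is = Suc m"
  shows "scaled_tensor F 2 (\<lambda>\<alpha>. \<Sum>\<beta> | length \<beta> = m. pinned F X is (\<alpha> ! 0 # \<beta>) * pinned F X js (\<alpha> ! 1 # \<beta>))"
proof -
  have lj: "length js = Suc m" using assms by (metis distinct_card)
  have c: "take 1 \<alpha> = [\<alpha> ! 0]" "drop 1 \<alpha> = [\<alpha> ! 1]" "drop (Suc 0) \<alpha> = [\<alpha> ! 1]" "take (Suc 0) \<alpha> = [\<alpha> ! 0]"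
    if "length \<alpha> = 2" for \<alpha> :: "bool list"
    using that by (auto simp: numeral_2_eq_2 length_Suc_conv)
  show ?thesis
  proof (cases "even (card (X \<inter> set is))")
    case True
    have 1: "scaled_tensor F (1 + m) (pinned F X is)" using pinned_even[OF assms(1,4) True] assms(5) by simp
    have "scaled_tensor F (m + 1) (\<lambda>\<alpha>. pinned F X js (rev \<alpha>))"
      using scaled_rev[OF pinned_even[of js]] True assms lj by simp
    from scaled_compose[OF 1 this] have "scaled_tensor F 2 (\<lambda>\<alpha>. \<Sum>\<beta> | length \<beta> = m.
        pinned F X is (take 1 \<alpha> @ \<beta>) * pinned F X js (rev (rev \<beta> @ drop 1 \<alpha>)))" by (simp add: numeral_2_eq_2)
    then show ?thesis by (rule scaled_ext) (simp add: c)
  next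
    case False
    let ?K = "\<lambda>is \<alpha>. pinned F X is (take (Suc m) \<alpha>) * all_ones (drop (Suc m) \<alpha>)"
    have 1: "scaled_tensor F (1 + Suc m) (?K is)" using pinned_odd[OF assms(1,4) False] assms(5) by simp
    have "scaled_tensor F (Suc m + 1) (\<lambda>\<alpha>. ?K js (rev \<alpha>))"
      using scaled_rev[OF pinned_odd[of js]] False assms lj by simp
    from scaled_compose[OF 1 this] have "scaled_tensor F 2 (\<lambda>\<alpha>. \<Sum>\<beta> | length \<beta> = Suc m.
        ?K is (take 1 \<alpha> @ \<beta>) * ?K js (rev (rev \<beta> @ drop 1 \<alpha>)))" by (simp add: numeral_2_eq_2)
    then show ?thesis
    proof (rule scaled_ext)
      fix \<alpha> :: "bool list" assume l: "length \<alpha> = 2"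
      have "(\<Sum>\<beta> | length \<beta> = Suc m. ?K is (take 1 \<alpha> @ \<beta>) * ?K js (rev (rev \<beta> @ drop 1 \<alpha>))) =
        (\<Sum>\<beta> | length \<beta> = m. ?K is (\<alpha> ! 0 # \<beta> @ [False]) * ?K js (\<alpha> ! 1 # \<beta> @ [False]) +
           ?K is (\<alpha> ! 0 # \<beta> @ [True]) * ?K js (\<alpha> ! 1 # \<beta> @ [True]))"
        unfolding sum_bool_lists_snoc by (rule sum.cong) (simp_all add: c[OF l])
      also have "\<dots> = (\<Sum>\<beta> | length \<beta> = m. pinned F X is (\<alpha> ! 0 # \<beta>) * pinned F X js (\<alpha> ! 1 # \<beta>))"
        by (rule sum.cong) simp_all
      finally show "(\<Sum>\<beta> | length \<beta> = Suc m. ?K is (take 1 \<alpha> @ \<beta>) * ?K js (rev (rev \<beta> @ drop 1 \<alpha>))) =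
        (\<Sum>\<beta> | length \<beta> = m. pinned F X is (\<alpha> ! 0 # \<beta>) * pinned F X js (\<alpha> ! 1 # \<beta>))" .
    qed
  qed
qed

end

section \<open>The three cases\<close>

definition realizes_nonaffine :: "signature \<Rightarrow> bool" where
  "realizes_nonaffine F \<longleftrightarrow> (\<exists>g. symmetric_sig g \<and> g \<in> matchgate_sigs - affine_sigs \<and> arity g \<ge> 1 \<and>
     planar_left_realizable {F} caps g)"

lemma length_2_conv_ex: "length \<alpha> = 2 \<Longrightarrow> \<exists>x y. \<alpha> = [x, y]"
  and length_3_conv_ex: "length \<alpha> = 3 \<Longrightarrow> \<exists>x y z. \<alpha> = [x, y, z]"
  for \<alpha> :: "'a list"
  by (auto simp: numeral_2_eq_2 numeral_3_eq_3 length_Suc_conv)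

lemma realizes_binary:
  assumes f: "scaled_tensor F 2 f" and z: "f [False, True] = 0" "f [True, False] = 0"
    and nz: "f [False, False] \<noteq> 0" "f [True, True] \<noteq> 0" "(f [True, True] / f [False, False]) ^ 4 \<noteq> 1"
  shows "realizes_nonaffine F"
proof -
  obtain l where l: "l \<noteq> 0" "planar_tensor F 2 (\<lambda>\<alpha>. l * f \<alpha>)" using f by (auto simp: scaled_tensor_def)
  define g where "g = symsig [l * f [False, False], 0, l * f [True, True]]"
  have "planar_tensor F 2 (sigval g)"
  proof (rule planar_tensor.ext[OF l(2)])
    fix \<alpha> :: "bool list" assume "length \<alpha> = 2"
    then obtain x y where "\<alpha> = [x, y]" using length_2_conv_ex by blast
    then show "l * f \<alpha> = sigval g \<alpha>" using z by (cases x; cases y) (auto simp: g_def numeral_2_eq_2)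
  qed
  from planar_tensor_realizable[OF this] have "planar_left_realizable {F} caps g"
    by (simp add: g_def symsig_def numeral_2_eq_2)
  moreover have "g \<notin> affine_sigs" unfolding g_def by (rule binary_even_nonaffine) (use nz l in auto)
  moreover have "g \<in> matchgate_sigs" unfolding g_def by (rule binary_even_matchgate)
  moreover have "symmetric_sig g" "arity g \<ge> 1" unfolding g_def by (simp_all add: symmetric_symsig)
  ultimately show ?thesis unfolding realizes_nonaffine_def by blast
qed

lemma realizes_ternary:
  assumes f: "scaled_tensor F 3 f" and v: "\<And>\<alpha>. length \<alpha> = 3 \<Longrightarrow> f \<alpha> = sigval (symsig [a, 0, b, 0]) \<alpha>"
    and nz: "a \<noteq> 0" "b \<noteq> 0" "(b / a)\<^sup>2 \<noteq> 1"
  shows "realizes_nonaffine F"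
proof -
  obtain l where l: "l \<noteq> 0" "planar_tensor F 3 (\<lambda>\<alpha>. l * f \<alpha>)" using f by (auto simp: scaled_tensor_def)
  define g where "g = symsig [l * a, 0, l * b, 0]"
  have "planar_tensor F 3 (sigval g)"
  proof (rule planar_tensor.ext[OF l(2)])
    fix \<alpha> :: "bool list" assume l3: "length \<alpha> = 3"
    then obtain x y z where "\<alpha> = [x, y, z]" using length_3_conv_ex by blast
    then show "l * f \<alpha> = sigval g \<alpha>" unfolding v[OF l3]
      by (cases x; cases y; cases z) (auto simp: g_def numeral_2_eq_2 numeral_3_eq_3)
  qed
  from planar_tensor_realizable[OF this] have "planar_left_realizable {F} caps g"
    by (simp add: g_def symsig_def numeral_3_eq_3)
  moreover have "g \<notin> affine_sigs" unfolding g_def by (rule ternary_even_nonaffine) (use nz l in auto)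
  moreover have "g \<in> matchgate_sigs" unfolding g_def by (rule ternary_even_matchgate) (use nz l in auto)
  moreover have "symmetric_sig g" "arity g \<ge> 1" unfolding g_def by (simp_all add: symmetric_symsig)
  ultimately show ?thesis unfolding realizes_nonaffine_def by blast
qed

text \<open>The parity signature joined to an edge carrying the bit 1 acts as a negation.\<close>

lemma scaled_flip:
  assumes f: "scaled_tensor F (Suc k + 1) (\<lambda>\<alpha>. f (take (Suc k) \<alpha>) * all_ones (drop (Suc k) \<alpha>))"
    and e: "scaled_tensor F 2 e" "e [False, True] = 0" "e [True, False] = 0"
  shows "scaled_tensor F (Suc k) (\<lambda>\<alpha>. f (take k \<alpha> @ [\<not> \<alpha> ! k]) * e [\<alpha> ! k, \<alpha> ! k])"
proof -
  \<comment> \<open>\<open>[1,0,1,0]\<close> is attached to the last edge of \<open>f\<close>, to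
    the edge carrying 1 and to one edge of \<open>e\<close>. Even parity makes the bits on
    \<open>f\<close> and \<open>e\<close> opposite, and the diagonal \<open>e\<close> passes its bit
    on to the dangling edge.\<close>
  have "scaled_tensor F (k + 3 + 1) (\<lambda>\<alpha>. (f (take (Suc k) (take (Suc k + 1) \<alpha>)) * all_ones (drop (Suc k) (take (Suc k + 1) \<alpha>))) * e (drop (Suc k + 1) \<alpha>))"
    using scaled_mult[OF f e(1)] by (simp add: numeral_3_eq_3 numeral_2_eq_2)
  from scaled_cap3[OF this] show ?thesis unfolding Suc_eq_plus1[of k]
  proof (rule scaled_ext)
    fix \<alpha> :: "bool list" assume "length \<alpha> = k + 1"
    then obtain \<gamma> v where [simp]: "\<alpha> = \<gamma> @ [v]" "length \<gamma> = k" by (metis Suc_eq_plus1 length_Suc_conv_rev)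
    let ?t = "\<lambda>x y w. take k \<alpha> @ [x, y, w] @ drop k \<alpha>"
    let ?h = "\<lambda>\<delta>. f (take (k + 1) (take (k + 1 + 1) \<delta>)) * all_ones (drop (k + 1) (take (k + 1 + 1) \<delta>)) * e (drop (k + 1 + 1) \<delta>)"
    show "?h (?t False False False) + ?h (?t False True True) + ?h (?t True False True) + ?h (?t True True False) =
         f (take k \<alpha> @ [\<not> \<alpha> ! k]) * e [\<alpha> ! k, \<alpha> ! k]"
      using e(2,3) by (cases v) (simp_all add: nth_append Suc_diff_le)
  qed
qed

lemma scaled_diag_mult:
  assumes "scaled_tensor F 2 d" "d [False, True] = 0" "d [True, False] = 0"
    and "scaled_tensor F 2 e" "e [False, True] = 0" "e [True, False] = 0"
  obtains h where "scaled_tensor F 2 h" "h [False, True] = 0" "h [True, False] = 0"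
    "h [False, False] = d [False, False] * e [False, False]" "h [True, True] = d [True, True] * e [True, True]"
proof -
  have 1: "scaled_tensor F (1 + 1) d" "scaled_tensor F (1 + 1) e" using assms by (simp_all add: numeral_2_eq_2)
  from scaled_compose[OF 1] show thesis
    by (intro that[of "\<lambda>\<alpha>. \<Sum>\<beta> | length \<beta> = 1. d (take 1 \<alpha> @ \<beta>) * e (rev \<beta> @ drop 1 \<alpha>)"])
      (use assms in \<open>simp_all add: numeral_2_eq_2 sum_bool_lists_Suc\<close>)
qed


text \<open>Multiplying the first and the third edge by diagonal tensors built from the three binary
  restrictions of \<open>f\<close> makes the three values of weight 2 equal.\<close>

lemma realizes_triple:
  assumes f: "scaled_tensor F 3 f"
    and odd: "\<And>\<alpha>. length \<alpha> = 3 \<Longrightarrow> odd (hamming_weight \<alpha>) \<Longrightarrow> f \<alpha> = 0"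
    and v: "f [False, False, False] = p" "f [True, True, False] = q12" "f [True, False, True] = q13" "f [False, True, True] = q23"
    and nz: "p \<noteq> 0" "q12 \<noteq> 0" "q13 \<noteq> 0" "q23 \<noteq> 0"
    and q4: "q13 ^ 4 = p ^ 4" "q12 ^ 4 = p ^ 4" "q23 ^ 4 = p ^ 4"
    and na: "(p * q12 * q13 * q23)\<^sup>2 \<noteq> p ^ 8"
  shows "realizes_nonaffine F"
proof -
  have z: "f [True, False, False] = 0" "f [False, True, False] = 0" "f [False, False, True] = 0" "f [True, True, True] = 0"
    by (rule odd; simp)+
  define dg where "dg a b h \<longleftrightarrow> scaled_tensor F 2 h \<and> h [False, True] = 0 \<and> h [True, False] = 0 \<and>
     h [False, False] = a \<and> h [True, True] = b" for a b h
  have mul: "\<exists>h. dg (a * a') (b * b') h" if "dg a b d" "dg a' b' e" for a b a' b' d e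
    using that unfolding dg_def by (elim conjE) (erule (2) scaled_diag_mult, assumption+, blast)
  have e12: "\<exists>h. dg p q12 h"
  proof -
    have "scaled_tensor F (2 + 1 + 0) f" using f by simp
    from scaled_cap1[OF this] have "dg p q12 (\<lambda>\<alpha>. f (take 2 \<alpha> @ [False] @ drop 2 \<alpha>))"
      using v z by (simp add: dg_def)
    then show ?thesis by blast
  qed
  have e13: "\<exists>h. dg p q13 h"
  proof -
    have "scaled_tensor F (1 + 1 + 1) f" using f by (simp add: numeral_3_eq_3)
    from scaled_cap1[OF this] have "dg p q13 (\<lambda>\<alpha>. f (take 1 \<alpha> @ [False] @ drop 1 \<alpha>))"
      using v z by (simp add: dg_def numeral_2_eq_2)
    then show ?thesis by blast
  qed
  have e23: "\<exists>h. dg p q23 h"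
  proof -
    have "scaled_tensor F (0 + 1 + 2) f" using f by (simp add: numeral_3_eq_3)
    from scaled_cap1[OF this] have "dg p q23 (\<lambda>\<alpha>. f (take 0 \<alpha> @ [False] @ drop 0 \<alpha>))"
      using v z by (simp add: dg_def numeral_2_eq_2)
    then show ?thesis by blast
  qed
  \<comment> \<open>With diagonal ratios x on the first and z on the third edge, the values of
    weight 2 become x q12, x z q13 and z q23; they agree for x = q23 / q13 and z = q12 / q13. Since
    \<open>q13 ^ 4 = p ^ 4\<close>, the inverse of q13 is \<open>q13 ^ 3 / p ^ 4\<close>; this
    explains the three factors q13.\<close>
  have inv: "\<exists>h. dg (p * (p * p) * p) (q13 * (q13 * q13) * q) h" if "\<exists>h. dg p q h" for q
    using e13 that mul by meson
  obtain d1 where d1: "dg (p * (p * p) * p) (q13 * (q13 * q13) * q23) d1" using inv[OF e23] by blast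
  obtain d3 where d3: "dg (p * (p * p) * p) (q13 * (q13 * q13) * q12) d3" using inv[OF e12] by blast
  have d1': "scaled_tensor F (1 + 1) d1" using d1 by (simp add: dg_def numeral_2_eq_2)
  have f': "scaled_tensor F (1 + 2) f" using f by (simp add: numeral_3_eq_3)
  from scaled_compose[OF d1' f'] have 1: "scaled_tensor F (2 + 1)
      (\<lambda>\<alpha>. \<Sum>\<beta> | length \<beta> = 1. d1 (take 1 \<alpha> @ \<beta>) * f (rev \<beta> @ drop 1 \<alpha>))" by (simp add: numeral_2_eq_2)
  have "scaled_tensor F (1 + 1) d3" using d3 by (simp add: dg_def numeral_2_eq_2)
  from scaled_compose[OF 1 this] have 2: "scaled_tensor F 3 (\<lambda>\<alpha>. \<Sum>\<gamma> | length \<gamma> = 1.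
      (\<Sum>\<beta> | length \<beta> = 1. d1 (take 1 (take 2 \<alpha> @ \<gamma>) @ \<beta>) * f (rev \<beta> @ drop 1 (take 2 \<alpha> @ \<gamma>))) * d3 (rev \<gamma> @ drop 2 \<alpha>))"
    by (simp add: numeral_2_eq_2 numeral_3_eq_3)
  define h where "h \<alpha> = (\<Sum>\<gamma> | length \<gamma> = 1.
      (\<Sum>\<beta> | length \<beta> = 1. d1 (take 1 (take 2 \<alpha> @ \<gamma>) @ \<beta>) * f (rev \<beta> @ drop 1 (take 2 \<alpha> @ \<gamma>))) * d3 (rev \<gamma> @ drop 2 \<alpha>))" for \<alpha>
  have h: "scaled_tensor F 3 h" using 2 unfolding h_def .
  have hv: "h [x, y, z] = d1 [x, x] * f [x, y, z] * d3 [z, z]" for x y z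
    using d1 d3 unfolding h_def dg_def by (cases x; cases z) (simp_all add: sum_bool_lists_Suc numeral_2_eq_2)
  define a where "a = (p * (p * p) * p) * p * (p * (p * p) * p)"
  define b where "b = (p * (p * p) * p) * (q13 * (q13 * q13)) * q12 * q23"
  have b13: "(q13 * (q13 * q13) * q23) * q13 * (q13 * (q13 * q13) * q12) = b"
    using q4(1) unfolding b_def by (simp add: power4_eq_xxxx mult_ac)
  show ?thesis
  proof (rule realizes_ternary[OF h, of a b])
    fix \<alpha> :: "bool list" assume l: "length \<alpha> = 3"
    then obtain x y z' where \<alpha>: "\<alpha> = [x, y, z']" using length_3_conv_ex by blast
    show "h \<alpha> = sigval (symsig [a, 0, b, 0]) \<alpha>"
      unfolding \<alpha> hv using z v d1 d3 b13 unfolding dg_def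
      by (cases x; cases y; cases z') (simp_all add: a_def b_def numeral_2_eq_2 numeral_3_eq_3 mult_ac)
  next
    show "a \<noteq> 0" "b \<noteq> 0" using nz by (simp_all add: a_def b_def)
    show "(b / a)\<^sup>2 \<noteq> 1"
    proof
      assume "(b / a)\<^sup>2 = 1"
      then have "b\<^sup>2 = a\<^sup>2" using \<open>a \<noteq> 0\<close> by (simp add: power_divide)
      moreover have "b\<^sup>2 = p ^ 6 * (p * q12 * q13 * q23)\<^sup>2 * q13 ^ 4"
        unfolding b_def by (simp add: power_mult_distrib eval_nat_numeral mult_ac)
      moreover have "a\<^sup>2 = p ^ 6 * p ^ 8 * p ^ 4"
        unfolding a_def by (simp add: power_mult_distrib eval_nat_numeral mult_ac)
      ultimately have "p ^ 6 * (p * q12 * q13 * q23)\<^sup>2 * p ^ 4 = p ^ 6 * p ^ 8 * p ^ 4"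
        using q4(1) by (simp only:)
      moreover have "x * y * z = x * y' * z \<Longrightarrow> x \<noteq> 0 \<Longrightarrow> z \<noteq> 0 \<Longrightarrow> y = y'" for x y y' z :: complex by simp
      ultimately show False using na nz(1) by (metis power_not_zero)
    qed
  qed
qed


lemma pinned_val:
  assumes "Y - set is = X - set is" "\<alpha> = map (\<lambda>i. i \<in> Y) is"
  shows "pinned F X is \<alpha> = set_val F Y"
proof -
  have "selected is (map (\<lambda>i. i \<in> Y) is) = Y \<inter> set is" by (induction "is") auto
  then show ?thesis unfolding pinned_def assms(2) assms(1)[symmetric] by (simp add: Int_Diff_Un)
qed

context
  fixes F :: signature and X :: "nat set"
  assumes par: "\<And>A B. A \<subseteq> {..<arity F} \<Longrightarrow> B \<subseteq> {..<arity F} \<Longrightarrow> set_val F A \<noteq> 0 \<Longrightarrow> set_val F B \<noteq> 0 \<Longrightarrow> even (card A + card B)"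
    and X: "X \<subseteq> {..<arity F}" "set_val F X \<noteq> 0" and X0: "set_val F {} \<noteq> 0 \<Longrightarrow> X = {}"
begin

lemma pinned_parity:
  assumes "distinct is" "set is \<subseteq> {..<arity F}" "length \<alpha> = length is" "odd (card (X \<inter> set is) + hamming_weight \<alpha>)"
  shows "pinned F X is \<alpha> = 0"
proof (rule ccontr)
  assume nz: "pinned F X is \<alpha> \<noteq> 0"
  have finX: "finite X" using X(1) finite_subset by blast
  have "selected is \<alpha> \<union> (X - set is) \<subseteq> {..<arity F}" using selected_subset[of "is" \<alpha>] assms(2) X(1) by blast
  then have "even (card X + card (selected is \<alpha> \<union> (X - set is)))"
    using par[OF X(1) _ X(2), of "selected is \<alpha> \<union> (X - set is)"] nz unfolding pinned_def by blast
  moreover have "card (selected is \<alpha> \<union> (X - set is)) = hamming_weight \<alpha> + card (X - set is)"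
  proof -
    have "card (selected is \<alpha> \<union> (X - set is)) = card (selected is \<alpha>) + card (X - set is)"
      by (rule card_Un_disjoint) (use selected_subset[of "is" \<alpha>] finX finite_subset[OF selected_subset] in auto)
    then show ?thesis using count_list_True_selected[OF assms(1,3)] by simp
  qed
  moreover have "card X = card (X \<inter> set is) + card (X - set is)"
    by (rule card_Int_Diff[OF finX])
  moreover have "even (a + r + (h + r)) \<Longrightarrow> even (a + h)" for a r h :: nat by presburger
  ultimately show False using assms(4) by metis
qed

text \<open>If \<open>i\<close> and \<open>j\<close> have equal bits in \<open>X\<close>, the pinned
  binary tensor is diagonal. Otherwise it is supported on unequal bits, and its second edge has to
  be negated.\<close>

lemma realizes_if_pair:
  assumes ij: "i < arity F" "j < arity F" "i \<noteq> j"
    and nz: "set_val F (sym_diff X {i, j}) \<noteq> 0" "(set_val F (sym_diff X {i, j}) / set_val F X) ^ 4 \<noteq> 1"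
  shows "realizes_nonaffine F"
proof -
  let ?p = "set_val F X" and ?q = "set_val F (sym_diff X {i, j})"
  let ?f = "pinned F X [i, j]"
  have dl: "distinct [i, j]" "set [i, j] \<subseteq> {..<arity F}" "length [i, j] = 2" using ij by auto
  have vp: "?f [i \<in> X, j \<in> X] = ?p" by (rule pinned_val) auto
  have vq: "?f [i \<notin> X, j \<notin> X] = ?q" by (rule pinned_val) (use ij in auto)
  have cX: "card (X \<inter> set [i, j]) = of_bool (i \<in> X) + of_bool (j \<in> X)"
    using ij by (cases "i \<in> X"; cases "j \<in> X") (auto simp: Int_insert_right)
  \<comment> \<open>Which of the two values lands at the zero input depends on \<open>X\<close>, so
    the ratio test is needed in both directions.\<close>
  have inv4: "(?p / ?q) ^ 4 \<noteq> 1" using nz X(2) by (auto simp: power_divide)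
  show ?thesis
  proof (cases "i \<in> X \<longleftrightarrow> j \<in> X")
    case True
    then have "even (card (X \<inter> set [i, j]))" unfolding cX by (cases "j \<in> X") simp_all
    from pinned_even[OF par X X0 dl(1,2) this] have f: "scaled_tensor F 2 ?f" by (simp add: numeral_2_eq_2)
    have "?f [False, True] = 0" "?f [True, False] = 0"
      by (rule pinned_parity[OF dl(1,2)]; use cX True in \<open>cases "j \<in> X"; simp\<close>)+
    then show ?thesis
      using realizes_binary[OF f] vp vq X(2) nz inv4 True by (cases "j \<in> X") simp_all
  next
    case False
    then have od: "odd (card (X \<inter> set [i, j]))" unfolding cX by (cases "j \<in> X") simp_all
    have z: "?f [False, False] = 0" "?f [True, True] = 0"
      by (rule pinned_parity[OF dl(1,2)]; use od in simp)+
    \<comment> \<open>The pinned tensor is a weighted disequality. Two of them in series with opposite directions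
      have constant weight, so \<open>e\<close> is a plain connection; it is needed since a cap cannot end in a
      dangling edge.\<close>
    have sw: "pinned F X [j, i] [x, y] = ?f [y, x]" for x y by (simp add: pinned_def insert_commute Un_ac)
    define r where "r = ?f [True, False]"
    define s where "s = ?f [False, True]"
    have rs: "r = ?p \<and> s = ?q \<or> r = ?q \<and> s = ?p" using vp vq False by (cases "j \<in> X") (auto simp: r_def s_def)
    then have rsnz: "r \<noteq> 0" "s \<noteq> 0" "(r / s) ^ 4 \<noteq> 1" using X(2) nz inv4 by auto
    define e where "e \<alpha> = (\<Sum>\<beta> | length \<beta> = 1. ?f (\<alpha> ! 0 # \<beta>) * pinned F X [j, i] (\<alpha> ! 1 # \<beta>))" for \<alpha> :: "bool list"
    have "scaled_tensor F 2 e"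
      unfolding e_def by (rule pinned_pair[OF par X X0]) (use ij in auto)
    moreover have "e [False, True] = 0" "e [True, False] = 0" "e [False, False] = s * r" "e [True, True] = s * r"
      by (simp_all add: e_def sum_bool_lists_Suc sw z r_def s_def)
    moreover have "scaled_tensor F (Suc 1 + 1) (\<lambda>\<alpha>. ?f (take (Suc 1) \<alpha>) * all_ones (drop (Suc 1) \<alpha>))"
      using pinned_odd[OF par X X0 dl(1,2) od] by simp
    ultimately have h: "scaled_tensor F 2 (\<lambda>\<alpha>. ?f (take 1 \<alpha> @ [\<not> \<alpha> ! 1]) * e [\<alpha> ! 1, \<alpha> ! 1])"
      and e: "e [False, False] = s * r" "e [True, True] = s * r"
      using scaled_flip[of F 1 ?f e] by (simp_all add: numeral_2_eq_2)
    show ?thesis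
      by (rule realizes_binary[OF h]) (use e z rsnz in \<open>simp_all add: r_def[symmetric] s_def[symmetric]\<close>)
  qed
qed

text \<open>By parity only the three neighbours of \<open>U\<close> and the point opposite to it can
  have nonzero values, and the latter has value 0. Equal bits of \<open>l\<close> and
  \<open>m\<close> in \<open>U\<close> allow edge \<open>l\<close> of one copy to be joined to edge
  \<open>m\<close> of the other. If the outputs differ from the bit of \<open>c\<close> in
  \<open>U\<close>, both copies contribute \<open>vc\<close>; if they agree with it, one copy
  contributes \<open>vl\<close> and the other \<open>vm\<close>, in two ways. The factor 2 gives the
  two values a ratio of modulus 2 or 1/2. Joining equal variables instead would give
  \<open>vl * vl + vm * vm\<close>, which may vanish.\<close>

lemma realizes_if_star_core:
  assumes T: "{c, l, m} \<subseteq> {..<arity F}" "c \<noteq> l" "c \<noteq> m" "l \<noteq> m"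
    and U: "U - {c, l, m} = X - {c, l, m}" "l \<in> U \<longleftrightarrow> m \<in> U"
    and odd: "odd (card (X \<inter> {c, l, m}) + card (U \<inter> {c, l, m}))"
    and v: "set_val F (sym_diff U {c}) = vc" "set_val F (sym_diff U {l}) = vl" "set_val F (sym_diff U {m}) = vm"
      "set_val F (sym_diff U {c, l, m}) = 0"
    and nz: "vc \<noteq> 0" "vl \<noteq> 0" "vm \<noteq> 0" "norm vl = norm vc" "norm vm = norm vc"
  shows "realizes_nonaffine F"
proof -
  let ?f = "pinned F X [c, l, m]"
  have dl: "distinct [c, l, m]" "set [c, l, m] \<subseteq> {..<arity F}" using T by auto
  have sw: "pinned F X [c, m, l] [x, y, z] = ?f [x, z, y]" for x y z
    by (simp add: pinned_def insert_commute Un_ac)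
  define s where "s = (c \<in> U)"
  define z where "z = (l \<in> U)"
  have zm: "m \<in> U \<longleftrightarrow> z" using U(2) by (simp add: z_def)
  have d: "sym_diff U W - set [c, l, m] = X - set [c, l, m]" if "W \<subseteq> {c, l, m}" for W
    using U(1) that by auto
  have f1: "?f [\<not> s, z, z] = vc"
    unfolding v(1)[symmetric] by (rule pinned_val[OF d]) (use T(2-4) zm in \<open>simp_all add: s_def z_def\<close>)
  have f2: "?f [s, \<not> z, z] = vl"
    unfolding v(2)[symmetric] by (rule pinned_val[OF d]) (use T(2-4) zm in \<open>simp_all add: s_def z_def\<close>)
  have f3: "?f [s, z, \<not> z] = vm"
    unfolding v(3)[symmetric] by (rule pinned_val[OF d]) (use T(2-4) zm in \<open>simp_all add: s_def z_def\<close>)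
  have f4: "?f [\<not> s, \<not> z, \<not> z] = 0"
    unfolding v(4)[symmetric] by (rule pinned_val[OF d]) (use T(2-4) zm in \<open>simp_all add: s_def z_def\<close>)
  have cU: "card (U \<inter> {c, l, m}) = of_bool s + of_bool z + of_bool z"
    using T zm by (cases s; cases z) (auto simp: Int_insert_right s_def z_def)
  have f0: "?f [s, z, z] = 0" "?f [\<not> s, \<not> z, z] = 0" "?f [\<not> s, z, \<not> z] = 0" "?f [s, \<not> z, \<not> z] = 0"
    by (rule pinned_parity[OF dl]; use odd cU in \<open>cases s; cases z; simp\<close>)+
  define g where "g \<alpha> = (\<Sum>\<beta> | length \<beta> = 2. ?f (\<alpha> ! 0 # \<beta>) * pinned F X [c, m, l] (\<alpha> ! 1 # \<beta>))" for \<alpha> :: "bool list"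
  have g: "scaled_tensor F 2 g"
    unfolding g_def by (rule pinned_pair[OF par X X0]) (use T in auto)
  have gv: "g [\<not> s, \<not> s] = vc * vc" "g [s, s] = 2 * (vl * vm)" "g [s, \<not> s] = 0" "g [\<not> s, s] = 0"
    using f0 f1 f2 f3 f4 unfolding g_def by (cases s; cases z; simp add: numeral_2_eq_2 sum_bool_lists_Suc sw)+
  have "norm (2 * (vl * vm) / (vc * vc)) = 2" using nz by (simp add: norm_mult norm_divide)
  then have n: "norm ((2 * (vl * vm) / (vc * vc)) ^ 4) = 16" "norm ((vc * vc / (2 * (vl * vm))) ^ 4) = 1 / 16"
    by (simp_all add: norm_power norm_divide norm_mult power_divide nz)
  have ne: "(2 * (vl * vm) / (vc * vc)) ^ 4 \<noteq> 1" "(vc * vc / (2 * (vl * vm))) ^ 4 \<noteq> 1"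
  proof -
    have "x \<noteq> 1" if "norm x \<noteq> 1" for x :: complex using that by auto
    then show "(2 * (vl * vm) / (vc * vc)) ^ 4 \<noteq> 1" "(vc * vc / (2 * (vl * vm))) ^ 4 \<noteq> 1" by (simp_all only: n) simp_all
  qed
  show ?thesis
    using realizes_binary[OF g] gv nz ne by (cases s) simp_all
qed

lemma realizes_if_star:
  assumes T: "{i, j, k} \<subseteq> {..<arity F}" "i \<noteq> j" "i \<noteq> k" "j \<noteq> k"
    and nz: "set_val F (sym_diff X {i, j}) \<noteq> 0" "set_val F (sym_diff X {i, k}) \<noteq> 0" "set_val F (sym_diff X {j, k}) = 0"
  shows "realizes_nonaffine F"
proof (cases "(set_val F (sym_diff X {i, j}) / set_val F X) ^ 4 = 1 \<and> (set_val F (sym_diff X {i, k}) / set_val F X) ^ 4 = 1")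
  case False
  then show ?thesis using realizes_if_pair[of i j] realizes_if_pair[of i k] T nz by auto
next
  case True
  have norm1: "norm x = norm y" if "(x / y) ^ 4 = 1" "y \<noteq> 0" for x y :: complex
  proof -
    have "norm (x / y) ^ 4 = 1" using that(1) by (metis norm_one norm_power)
    then have "norm (x / y) = 1" using power_eq_1_iff[of "norm (x / y)" 4] by simp
    then show ?thesis using that(2) by (simp add: norm_divide)
  qed
  \<comment> \<open>Seen from this neighbour of \<open>X\<close> the three indices play equal roles:
    the nonzero values are those at \<open>U\<close> with one index toggled, and the vanishing one
    is that with all three toggled.\<close>
  define U where "U = sym_diff X {i}"
  define v where "v c = set_val F (sym_diff U {c})" for c
  have vi: "v i = set_val F X" unfolding v_def U_def by (rule arg_cong[of _ _ "set_val F"]) auto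
  have vj: "v j = set_val F (sym_diff X {i, j})" unfolding v_def U_def by (rule arg_cong[of _ _ "set_val F"]) (use T in auto)
  have vk: "v k = set_val F (sym_diff X {i, k})" unfolding v_def U_def by (rule arg_cong[of _ _ "set_val F"]) (use T in auto)
  have v3: "set_val F (sym_diff U {i, j, k}) = 0"
  proof -
    have "sym_diff U {i, j, k} = sym_diff X {j, k}" using T by (auto simp: U_def)
    then show ?thesis using nz(3) by simp
  qed
  have vn: "v i \<noteq> 0" "v j \<noteq> 0" "v k \<noteq> 0" "norm (v j) = norm (v i)" "norm (v k) = norm (v i)"
    using vi vj vk X(2) nz True norm1 by auto
  have UX: "odd (card (X \<inter> {i, j, k}) + card (U \<inter> {i, j, k}))"
  proof -
    have "U \<inter> {i, j, k} = sym_diff (X \<inter> {i, j, k}) {i}" by (auto simp: U_def)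
    then have "even (card (U \<inter> {i, j, k})) \<longleftrightarrow> even (card (X \<inter> {i, j, k}) + 1)"
      using even_card_sym_diff[of "X \<inter> {i, j, k}" "{i}"] by simp
    then show ?thesis by auto
  qed
  have Ud: "U - {i, j, k} = X - {i, j, k}" by (auto simp: U_def)
  have core: "realizes_nonaffine F"
    if "{c, l, m} = {i, j, k}" "c \<noteq> l" "c \<noteq> m" "l \<noteq> m" "l \<in> U \<longleftrightarrow> m \<in> U" for c l m
  proof (rule realizes_if_star_core[of c l m U "v c" "v l" "v m"])
    have "c \<in> {i, j, k}" "l \<in> {i, j, k}" "m \<in> {i, j, k}" using that(1) by blast+
    then show "v c \<noteq> 0" "v l \<noteq> 0" "v m \<noteq> 0" "norm (v l) = norm (v c)" "norm (v m) = norm (v c)"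
      using vn by auto
    show "set_val F (sym_diff U {c, l, m}) = 0" unfolding that(1) by (rule v3)
    show "U - {c, l, m} = X - {c, l, m}" unfolding that(1) by (rule Ud)
    show "odd (card (X \<inter> {c, l, m}) + card (U \<inter> {c, l, m}))" unfolding that(1) by (rule UX)
    show "{c, l, m} \<subseteq> {..<arity F}" unfolding that(1) by (rule T(1))
  qed (use that in \<open>simp_all add: v_def\<close>)
  \<comment> \<open>Two of three bits agree; the remaining index becomes the output edge of both
    copies.\<close>
  have "(j \<in> U \<longleftrightarrow> k \<in> U) \<or> (i \<in> U \<longleftrightarrow> k \<in> U) \<or> (i \<in> U \<longleftrightarrow> j \<in> U)" by blast
  then show ?thesis
  proof (elim disjE)
    assume "j \<in> U \<longleftrightarrow> k \<in> U" then show ?thesis using core[of i j k] T by simp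
  next
    assume "i \<in> U \<longleftrightarrow> k \<in> U" then show ?thesis using core[of j i k] T by (simp add: insert_commute)
  next
    assume "i \<in> U \<longleftrightarrow> j \<in> U" then show ?thesis using core[of k i j] T by (simp add: insert_commute)
  qed
qed

text \<open>If \<open>X\<close> contains an odd number of the three indices, the pinned tensor has
  odd support; negating its third edge moves it to even support.\<close>

lemma realizes_if_triple:
  assumes T: "{i, j, k} \<subseteq> {..<arity F}" "i \<noteq> j" "i \<noteq> k" "j \<noteq> k"
    and v: "set_val F X = p" "set_val F (sym_diff X {i, j}) = pij" "set_val F (sym_diff X {i, k}) = pik" "set_val F (sym_diff X {j, k}) = pjk"
    and nz: "pij \<noteq> 0" "pik \<noteq> 0" "pjk \<noteq> 0" and na: "((pij / p) * (pik / p) / (pjk / p))\<^sup>2 \<noteq> 1"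
  shows "realizes_nonaffine F"
proof (cases "(pij / p) ^ 4 = 1 \<and> (pik / p) ^ 4 = 1 \<and> (pjk / p) ^ 4 = 1")
  case False
  then show ?thesis using realizes_if_pair[of i j] realizes_if_pair[of i k] realizes_if_pair[of j k] T nz v by auto
next
  case True
  have p: "p \<noteq> 0" using X(2) v by simp
  have p4: "pij ^ 4 = p ^ 4" "pik ^ 4 = p ^ 4" "pjk ^ 4 = p ^ 4" using True p by (auto simp: power_divide)
  have pow8: "x ^ 8 = (x ^ 4)\<^sup>2" for x :: complex by (simp flip: power_mult)
  \<comment> \<open>The witness condition in a form symmetric in the four values, so that it does
    not matter which of them lands at the zero input of the pinned tensor.\<close>
  have prod: "(p * pij * pik * pjk)\<^sup>2 \<noteq> p ^ 8"
  proof
    assume h: "(p * pij * pik * pjk)\<^sup>2 = p ^ 8"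
    define K where "K = (p * pjk)\<^sup>2"
    have K0: "K \<noteq> 0" using p nz(3) by (simp add: K_def)
    have "(pij * pik)\<^sup>2 * K * K = p ^ 8 * K"
      unfolding h[symmetric] K_def by (simp add: power_mult_distrib mult_ac)
    also have "p ^ 8 = p ^ 4 * p ^ 4" by (simp only: pow8 power2_eq_square)
    also have "\<dots> = p ^ 4 * pjk ^ 4" using p4(3) by simp
    also have "\<dots> = K * K" unfolding K_def by (simp add: power_mult_distrib eval_nat_numeral mult_ac)
    finally have "(pij * pik)\<^sup>2 = (p * pjk)\<^sup>2" using K0 by (simp add: K_def[symmetric])
    moreover have "(pij / p) * (pik / p) / (pjk / p) = pij * pik / (p * pjk)" using p by simp
    ultimately have "((pij / p) * (pik / p) / (pjk / p))\<^sup>2 = 1" using p nz(3) by (simp add: power_divide)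
    then show False using na by blast
  qed
  let ?f = "pinned F X [i, j, k]"
  have dl: "distinct [i, j, k]" "set [i, j, k] \<subseteq> {..<arity F}" using T by auto
  have f0: "?f [i \<in> X, j \<in> X, k \<in> X] = p" unfolding v(1)[symmetric] by (rule pinned_val) auto
  have f1: "?f [i \<notin> X, j \<notin> X, k \<in> X] = pij" unfolding v(2)[symmetric] by (rule pinned_val) (use T in auto)
  have f2: "?f [i \<notin> X, j \<in> X, k \<notin> X] = pik" unfolding v(3)[symmetric] by (rule pinned_val) (use T in auto)
  have f3: "?f [i \<in> X, j \<notin> X, k \<notin> X] = pjk" unfolding v(4)[symmetric] by (rule pinned_val) (use T in auto)
  have cX: "card (X \<inter> set [i, j, k]) = of_bool (i \<in> X) + of_bool (j \<in> X) + of_bool (k \<in> X)"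
    using T by (cases "i \<in> X"; cases "j \<in> X"; cases "k \<in> X") (auto simp: Int_insert_right)
  show ?thesis
  proof (cases "even (card (X \<inter> set [i, j, k]))")
    case True
    from pinned_even[OF par X X0 dl True] have f: "scaled_tensor F 3 ?f" by (simp add: numeral_3_eq_3)
    have odd: "?f \<alpha> = 0" if "length \<alpha> = 3" "odd (hamming_weight \<alpha>)" for \<alpha>
      by (rule pinned_parity[OF dl]) (use that True in auto)
    define a b c d where "a = ?f [False, False, False]" and "b = ?f [True, True, False]"
      and "c = ?f [True, False, True]" and "d = ?f [False, True, True]"
    have "a \<noteq> 0 \<and> b \<noteq> 0 \<and> c \<noteq> 0 \<and> d \<noteq> 0 \<and> a ^ 4 = p ^ 4 \<and> b ^ 4 = p ^ 4 \<and> c ^ 4 = p ^ 4 \<and> d ^ 4 = p ^ 4 \<and>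
      a * b * c * d = p * pij * pik * pjk"
      using f0 f1 f2 f3 nz p p4 True unfolding cX a_def b_def c_def d_def
      by (cases "i \<in> X"; cases "j \<in> X"; cases "k \<in> X") (simp_all add: mult_ac)
    moreover have "a ^ 8 = p ^ 8" if "a ^ 4 = p ^ 4" using that by (simp only: pow8)
    ultimately show ?thesis
      using realizes_triple[OF f odd a_def[symmetric] b_def[symmetric] c_def[symmetric] d_def[symmetric]] prod by simp
  next
    case False
    have z: "?f [False, False, False] = 0" "?f [True, True, False] = 0" "?f [True, False, True] = 0" "?f [False, True, True] = 0"
      by (rule pinned_parity[OF dl]; use False in simp)+
    define a b c d where "a = ?f [True, False, False]" and "b = ?f [False, True, False]"
      and "c = ?f [False, False, True]" and "d = ?f [True, True, True]"
    have abcd: "a \<noteq> 0" "b \<noteq> 0" "c \<noteq> 0" "d \<noteq> 0" "a ^ 4 = p ^ 4" "b ^ 4 = p ^ 4" "c ^ 4 = p ^ 4" "d ^ 4 = p ^ 4"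
      "a * b * c * d = p * pij * pik * pjk"
      using f0 f1 f2 f3 nz p p4 False unfolding cX a_def b_def c_def d_def
      by (cases "i \<in> X"; cases "j \<in> X"; cases "k \<in> X"; simp add: mult_ac)+
    let ?K = "\<lambda>\<alpha>. ?f (take (Suc 2) \<alpha>) * all_ones (drop (Suc 2) \<alpha>)"
    have K: "scaled_tensor F (Suc 2 + 1) ?K"
      using pinned_odd[OF par X X0 dl False] by (simp add: numeral_2_eq_2)
    then have "scaled_tensor F (2 + 2 + 0) ?K" by simp
    \<comment> \<open>Joining the third edge to the open edge carrying 1 fixes its bit to 1. The
      resulting diagonal tensor with values c and d serves as the connection in the negation; its
      weights enter the new values, but the hypotheses of \<open>realizes_triple\<close>
      survive.\<close>
    have "scaled_tensor F (2 + 0) (\<lambda>\<alpha>. ?f (\<alpha> @ [True]))"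
      by (rule scaled_ext[OF scaled_cap2[OF \<open>scaled_tensor F (2 + 2 + 0) ?K\<close>]]) simp
    then have e: "scaled_tensor F 2 (\<lambda>\<alpha>. ?f (\<alpha> @ [True]))" by simp
    have "scaled_tensor F (Suc 2) (\<lambda>\<alpha>. ?f (take 2 \<alpha> @ [\<not> \<alpha> ! 2]) * ?f ([\<alpha> ! 2, \<alpha> ! 2] @ [True]))"
      by (rule scaled_flip[OF K e]) (use z in auto)
    then have h: "scaled_tensor F 3 (\<lambda>\<alpha>. ?f (take 2 \<alpha> @ [\<not> \<alpha> ! 2]) * ?f ([\<alpha> ! 2, \<alpha> ! 2] @ [True]))"
      (is "scaled_tensor F 3 ?h") by simp
    have hodd: "?h \<alpha> = 0" if l: "length \<alpha> = 3" "odd (hamming_weight \<alpha>)" for \<alpha>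
    proof -
      obtain x y w where \<alpha>: "\<alpha> = [x, y, w]" using length_3_conv_ex[OF l(1)] by blast
      show ?thesis using l(2) z unfolding \<alpha> by (cases x; cases y; cases w) (simp_all add: numeral_2_eq_2)
    qed
    have c8: "c ^ 8 = p ^ 8" using abcd(7) by (simp only: pow8)
    show ?thesis
    proof (rule realizes_triple[OF h hodd, where p = "c * c" and ?q12.0 = "d * c" and ?q13.0 = "a * d" and ?q23.0 = "b * d"])
      show "?h [False, False, False] = c * c" "?h [True, True, False] = d * c" "?h [True, False, True] = a * d"
        "?h [False, True, True] = b * d"
        by (simp_all add: a_def b_def c_def d_def numeral_2_eq_2)
      show "c * c \<noteq> 0" "d * c \<noteq> 0" "a * d \<noteq> 0" "b * d \<noteq> 0" using abcd by auto
      show "(a * d) ^ 4 = (c * c) ^ 4" "(d * c) ^ 4 = (c * c) ^ 4" "(b * d) ^ 4 = (c * c) ^ 4"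
        using abcd by (simp_all add: power_mult_distrib)
      show "(c * c * (d * c) * (a * d) * (b * d))\<^sup>2 \<noteq> (c * c) ^ 8"
      proof
        assume "(c * c * (d * c) * (a * d) * (b * d))\<^sup>2 = (c * c) ^ 8"
        moreover have "(c * c * (d * c) * (a * d) * (b * d))\<^sup>2 = (a * b * c * d)\<^sup>2 * (c ^ 4 * d ^ 4)"
          by (simp add: power_mult_distrib eval_nat_numeral mult_ac)
        moreover have "c ^ 4 * d ^ 4 = c ^ 8" by (simp only: pow8 abcd(7,8) power2_eq_square)
        moreover have "(c * c) ^ 8 = c ^ 8 * c ^ 8" by (simp add: power_mult_distrib)
        ultimately have "(a * b * c * d)\<^sup>2 * c ^ 8 = c ^ 8 * c ^ 8" by (simp only:)
        then have "(a * b * c * d)\<^sup>2 = c ^ 8" using abcd(3) by (metis mult_right_cancel power_not_zero)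
        then show False using prod abcd(9) c8 by simp
      qed
    qed
  qed
qed

end

theorem theorem29:
  fixes F :: signature and n :: nat
  assumes "F \<in> permutable_matchgate_sigs - affine_sigs"
    and "arity F = n"
  shows "\<exists>g. symmetric_sig g \<and> g \<in> matchgate_sigs - affine_sigs \<and>
           (n \<ge> 1 \<longrightarrow> arity g \<ge> 1) \<and>
           planar_left_realizable {F} {symsig [1,0], symsig [1,0,1], symsig [1,0,1,0]} g"
proof -
  have F: "F \<in> permutable_matchgate_sigs" "F \<notin> affine_sigs" using assms by auto
  have "permute_sig id F = F" unfolding permute_sig_def by simp
  then have FM: "F \<in> matchgate_sigs"
    using F(1) permutes_id unfolding permutable_matchgate_sigs_def by (metis (mono_tags, lifting) mem_Collect_eq)
  show ?thesis
  proof (cases "n \<ge> 1")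
    \<comment> \<open>Without variables, \<open>F\<close> itself is the desired signature, realized
      by a single isolated vertex.\<close>
    case False
    then have n0: "arity F = 0" using assms(2) by simp
    have "planar_tensor F (0 + arity F) (\<lambda>\<alpha>. 1 * sigval F (permute_list id (drop 0 \<alpha>)))"
      by (rule planar_tensor.vertex[OF planar_tensor.empty permutes_id])
    then have "planar_tensor F (arity F) (sigval F)" by simp
    from planar_tensor_realizable[OF this] have "planar_left_realizable {F} caps F" by simp
    moreover have "symmetric_sig F" using n0 by (simp add: symmetric_sig_def)
    ultimately show ?thesis using False FM F(2) by blast
  next
    case True
    then have n1: "arity F \<ge> 1" using assms(2) by simp
    note par = matchgate_parity[OF FM]
    have "\<exists>X. X \<subseteq> {..<arity F} \<and> set_val F X \<noteq> 0"
    proof (rule ccontr)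
      assume "\<not> (\<exists>X. X \<subseteq> {..<arity F} \<and> set_val F X \<noteq> 0)"
      then have "F \<in> affine_sigs"
        by (intro affine_sigI[OF n1, of "{}" "{}" "\<lambda>_. 0" 0]) auto
      then show False using F(2) by blast
    qed
    \<comment> \<open>The zero vector is preferred whenever it lies in the support; then no ones
      have to be supplied.\<close>
    then obtain X where X: "X \<subseteq> {..<arity F}" "set_val F X \<noteq> 0" and X0: "set_val F {} \<noteq> 0 \<Longrightarrow> X = {}"
      by (metis empty_subsetI)
    have "realizes_nonaffine F"
    proof (rule nonaffine_witness[OF n1 F(2) permutable_exchange[OF F(1)] par X])
      fix i j k assume "{i, j, k} \<subseteq> {..<arity F}" "i \<noteq> j" "i \<noteq> k" "j \<noteq> k"
        "set_val F (sym_diff X {i, j}) / set_val F X \<noteq> 0" "set_val F (sym_diff X {i, k}) / set_val F X \<noteq> 0"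
        "set_val F (sym_diff X {j, k}) / set_val F X = 0"
      then show ?thesis using realizes_if_star[OF par X X0, of i j k] X(2) by auto
    next
      fix i j assume "{i, j} \<subseteq> {..<arity F}" "i \<noteq> j" "set_val F (sym_diff X {i, j}) / set_val F X \<noteq> 0"
        "(set_val F (sym_diff X {i, j}) / set_val F X) ^ 4 \<noteq> 1"
      then show ?thesis using realizes_if_pair[OF par X X0, of i j] by auto
    next
      fix i j k assume "{i, j, k} \<subseteq> {..<arity F}" "i \<noteq> j" "i \<noteq> k" "j \<noteq> k"
        "set_val F (sym_diff X {i, j}) / set_val F X \<noteq> 0" "set_val F (sym_diff X {i, k}) / set_val F X \<noteq> 0"
        "set_val F (sym_diff X {j, k}) / set_val F X \<noteq> 0"
        "(set_val F (sym_diff X {i, j}) / set_val F X * (set_val F (sym_diff X {i, k}) / set_val F X) /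
          (set_val F (sym_diff X {j, k}) / set_val F X))\<^sup>2 \<noteq> 1"
      then show ?thesis using realizes_if_triple[OF par X X0 _ _ _ _ refl refl refl refl, of i j k] by auto
    qed
    then show ?thesis unfolding realizes_nonaffine_def by blast
  qed
qed

end
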